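(* Let $(G_t)_{t\in[0,T]}$ be a centred Gaussian process with $G_0=0$ and covariance $R(s,t)=\mathbb{E}[G_tG_s]$ such that: (i) for each fixed $s\in[0,T]$, $t\mapsto R(s,t)$ is absolutely continuous on $[0,T]$; (ii) for each fixed $t\in[0,T]$, the difference $s\mapsto\frac{\partial R(s,t)}{\partial t}-\frac{\partial R^{B}(s,t)}{\partial t}$ is absolutely continuous on $[0,T]$, where $R^B$ is the covariance of fractional Brownian motion with Hurst parameter $H\in(0,1)$. Then for all $f,g\in\mathcal{V}_{[0,T]}$, $$\langle f,g\rangle_{\mathfrak{H}}-\langle f,g\rangle_{\mathfrak{H}_1}=\int_{[0,T]^2} f(t)g(s)\,\frac{\partial}{\partial s}\Big(\frac{\partial R(s,t)}{\partial t}-\frac{\partial R^{B}(s,t)}{\partial t}\Big)\,\mathrm{d}t\,\mathrm{d}s.$$ If in addition (iii) there exists a positive constant $C$ independent of $T$ such that $$\Big|\frac{\partial}{\partial s}\Big(\frac{\partial R(s,t)}{\partial t}-\frac{\partial R^{B}(s,t)}{\partial t}\Big)\Big|\le C\,(ts)^{H-1}\quad\text{for almost every }(s,t),$$ then there is a positive constant $C$ independent of $T$ such that for all $f,g\in\mathcal{V}_{[0,T]}$, $$\big|\langle f,g\rangle_{\mathfrak{H}}-\langle f,g\rangle_{\mathfrak{H}_1}\big|\le C\,\nu(|f|)\,\nu(|g|),$$ where $\nu(f)=\int_0^T f\,\mathrm{d}\nu$ and $\nu(\mathrm{d}x)=x^{H-1}\,\mathrm{d}x$.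
   Context: $T>0$ and $R^B(s,t)=\frac12\big(s^{2H}+t^{2H}-|t-s|^{2H}\big)$ is the covariance function of the fractional Brownian motion $(B^H_t)_{t\in[0,T]}$. The process $G$ and its covariance $R$ are assumed continuous. $\mathcal{V}_{[0,T]}$ is the set of bounded variation functions on $[0,T]$. The Hilbert space $\mathfrak{H}$ is the closure of the real step functions on $[0,T]$ under the inner product determined by $\langle \mathbf{1}_{[a,b]},\mathbf{1}_{[c,d]}\rangle_{\mathfrak{H}}=\mathbb{E}[(G_b-G_a)(G_d-G_c)]$; $\mathfrak{H}_1$ is the corresponding space for $B^H$. Functions in $\mathcal{V}_{[0,T]}$ are regarded as elements of $\mathfrak{H}$ (and similarly of $\mathfrak{H}_1$, with $R^B$ in place of $R$), and for $f,g\in\mathcal{V}_{[0,T]}$ one has $\langle f,g\rangle_{\mathfrak{H}}=\int_{[0,T]^2}R(s,t)\,\nu_f(\mathrm{d}t)\,\nu_g(\mathrm{d}s)$, where $\nu_g$ is the restriction to $[0,T]$ of the signed Lebesgue-Stieltjes measure on $\mathbb{R}$ of the function equal to $g$ on $[0,T]$ and to $0$ elsewhere.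
   Formalization: The first identity is asserted for those f, g for which the integrand on the right is Lebesgue integrable on [0,T]^2; (i)-(ii) alone do not ensure that this integral exists (add to R^B the sum of (1/k)φ_k(s)φ_k(t) with disjoint unit bumps φ_k). *)

theory Defs
  imports "HOL-Probability.Probability"
begin

section \<open>Functions of bounded variation and absolutely continuous functions\<close>

definition variation_sums :: "(real \<Rightarrow> real) \<Rightarrow> real set \<Rightarrow> real set" where
  "variation_sums f A =
     {(\<Sum>i<n. \<bar>f (x (Suc i)) - f (x i)\<bar>) | (n::nat) (x::nat \<Rightarrow> real).
        mono_on {..n} x \<and> x ` {..n} \<subseteq> A}"

definition variation :: "(real \<Rightarrow> real) \<Rightarrow> real set \<Rightarrow> real" where
  "variation f A = Sup (variation_sums f A)"

definition bv_functions :: "real \<Rightarrow> (real \<Rightarrow> real) set" where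
  "bv_functions T = {f. bdd_above (variation_sums f {0..T})}"

text \<open>The library constant \<^const>\<open>absolutely_continuous\<close> is the notion for measures.\<close>

definition abs_continuous_on :: "real set \<Rightarrow> (real \<Rightarrow> real) \<Rightarrow> bool" where
  "abs_continuous_on A f \<longleftrightarrow>
     (\<forall>\<epsilon>>0. \<exists>\<delta>>0. \<forall>(n::nat) (l::nat \<Rightarrow> real) (u::nat \<Rightarrow> real).
        (\<forall>i<n. l i \<le> u i \<and> {l i..u i} \<subseteq> A) \<and>
        disjoint_family_on (\<lambda>i. {l i<..<u i}) {..<n} \<and>
        (\<Sum>i<n. u i - l i) < \<delta> \<longrightarrow>
        (\<Sum>i<n. \<bar>f (u i) - f (l i)\<bar>) < \<epsilon>)"


section \<open>Signed Lebesgue--Stieltjes measures\<close>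

text \<open>
  The library has no signed measures, so \<open>\<nu>\<^sub>g\<close> is represented by a pair of finite positive measures
  whose difference is \<open>\<nu>\<^sub>g\<close>. The extension by zero of \<open>g\<close> is the difference of the nondecreasing
  functions \<open>(V + g) / 2\<close> and \<open>(V - g) / 2\<close>, where \<open>V x\<close> is its variation on \<open>{..x}\<close>. Taking right
  limits makes them right-continuous, as \<^const>\<open>interval_measure\<close> requires. The difference of the
  two measures then assigns \<open>g (b+) - g (a+)\<close> to \<open>{a<..b}\<close>, whatever the one-sided continuity
  of \<open>g\<close>; in particular \<open>\<nu>\<^sub>g\<close> has the atoms \<open>g (0+)\<close> at \<open>0\<close> and \<open>- g (T-)\<close> at \<open>T\<close>.
\<close>

definition zero_ext :: "real \<Rightarrow> (real \<Rightarrow> real) \<Rightarrow> real \<Rightarrow> real" where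
  "zero_ext T g x = (if x \<in> {0..T} then g x else 0)"

definition right_lim :: "(real \<Rightarrow> real) \<Rightarrow> real \<Rightarrow> real" where
  "right_lim F x = Lim (at_right x) F"

definition ls_plus :: "real \<Rightarrow> (real \<Rightarrow> real) \<Rightarrow> real measure" where
  "ls_plus T g = interval_measure
     (right_lim (\<lambda>x. (variation (zero_ext T g) {..x} + zero_ext T g x) / 2))"

definition ls_minus :: "real \<Rightarrow> (real \<Rightarrow> real) \<Rightarrow> real measure" where
  "ls_minus T g = interval_measure
     (right_lim (\<lambda>x. (variation (zero_ext T g) {..x} - zero_ext T g x) / 2))"

definition ls_integral :: "real \<Rightarrow> (real \<Rightarrow> real) \<Rightarrow> (real \<Rightarrow> real) \<Rightarrow> real" where
  "ls_integral T g h =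
     (LINT x:{0..T}|ls_plus T g. h x) - (LINT x:{0..T}|ls_minus T g. h x)"


section \<open>Gaussian processes and the inner product determined by a covariance\<close>

definition centred_gaussian_rv :: "'a measure \<Rightarrow> ('a \<Rightarrow> real) \<Rightarrow> bool" where
  "centred_gaussian_rv M X \<longleftrightarrow>
     X \<in> borel_measurable M \<and>
     ((AE \<omega> in M. X \<omega> = 0) \<or> (\<exists>\<sigma>>0. distributed M lborel X (normal_density 0 \<sigma>)))"

definition centred_gaussian_process :: "'a measure \<Rightarrow> real set \<Rightarrow> (real \<Rightarrow> 'a \<Rightarrow> real) \<Rightarrow> bool" where
  "centred_gaussian_process M I G \<longleftrightarrow>
     prob_space M \<and>
     (\<forall>S c. finite S \<and> S \<subseteq> I \<longrightarrow> centred_gaussian_rv M (\<lambda>\<omega>. \<Sum>t\<in>S. c t * G t \<omega>))"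

definition covariance :: "'a measure \<Rightarrow> (real \<Rightarrow> 'a \<Rightarrow> real) \<Rightarrow> real \<Rightarrow> real \<Rightarrow> real" where
  "covariance M G s t = (\<integral>\<omega>. G t \<omega> * G s \<omega> \<partial>M)"

definition fbm_cov :: "real \<Rightarrow> real \<Rightarrow> real \<Rightarrow> real" where
  "fbm_cov H s t = (s powr (2 * H) + t powr (2 * H) - \<bar>t - s\<bar> powr (2 * H)) / 2"

text \<open>
  \<open>D\<close> is a version of \<open>\<partial>R(s,t)/\<partial>t - \<partial>R\<^sup>B(s,t)/\<partial>t\<close>. For fixed \<open>s\<close> the two derivatives exist only for
  almost every \<open>t\<close>; in particular \<open>t \<mapsto> R\<^sup>B(s,t)\<close> is not differentiable at \<open>t = s\<close> when \<open>H \<le> 1/2\<close>.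
  Since \<^const>\<open>deriv\<close> is unspecified at such points, it is not evaluated there. If moreover every
  \<open>s \<mapsto> D s t\<close> is continuous, then the functions \<open>s \<mapsto> D s t\<close> are determined for almost every \<open>t\<close>.
\<close>

definition derivative_difference ::
    "real \<Rightarrow> real \<Rightarrow> (real \<Rightarrow> real \<Rightarrow> real) \<Rightarrow> (real \<Rightarrow> real \<Rightarrow> real) \<Rightarrow> bool" where
  "derivative_difference H T R D \<longleftrightarrow>
     (\<forall>s\<in>{0..T}. AE t\<in>{0..T} in lborel. D s t = deriv (\<lambda>t. R s t) t - deriv (\<lambda>t. fbm_cov H s t) t)"

text \<open>
  The inner product, restricted to functions of bounded variation on \<open>[0,T]\<close>, of the Hilbert space
  obtained by completing the step functions on \<open>[0,T]\<close> with respect to the covariance \<open>R\<close>: it is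
  the integral of \<open>R s t\<close> against \<open>\<nu>\<^sub>f(dt) \<nu>\<^sub>g(ds)\<close>, written as an iterated
  integral (\<open>R\<close> is continuous and the measures are finite). On indicators of intervals it is the
  prescribed inner product, see \<open>cov_inner_indicator\<close> and \<open>cov_inner_indicator_process\<close>.
\<close>

definition cov_inner :: "(real \<Rightarrow> real \<Rightarrow> real) \<Rightarrow> real \<Rightarrow> (real \<Rightarrow> real) \<Rightarrow> (real \<Rightarrow> real) \<Rightarrow> real" where
  "cov_inner R T f g = ls_integral T g (\<lambda>s. ls_integral T f (\<lambda>t. R s t))"

definition nu_integral :: "real \<Rightarrow> real \<Rightarrow> (real \<Rightarrow> real) \<Rightarrow> real" where
  "nu_integral H T f = (LINT x:{0..T}|density lborel (\<lambda>x. ennreal (x powr (H - 1))). f x)"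


lemma variation_sums_mono: "A \<subseteq> B \<Longrightarrow> variation_sums f A \<subseteq> variation_sums f B"
  unfolding variation_sums_def by blast

lemma variation_sums_nonempty: "a \<in> A \<Longrightarrow> 0 \<in> variation_sums f A"
  unfolding variation_sums_def
  by (auto intro!: exI[of _ "0::nat"] exI[of _ "\<lambda>_. a"] simp: mono_on_def)

lemma variation_sums_2:
  assumes "a \<le> b" "a \<in> A" "b \<in> A"
  shows "\<bar>f b - f a\<bar> \<in> variation_sums f A"
  unfolding variation_sums_def using assms
  by (auto intro!: exI[of _ "1::nat"] exI[of _ "\<lambda>i. if i = 0 then a else b"] simp: mono_on_def)

lemma sum_abs_mono_seq_le:
  fixes F :: "real \<Rightarrow> real"
  assumes "mono_on {..n} x" "mono F" "\<And>y. 0 \<le> F y \<and> F y \<le> 1"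
  shows "(\<Sum>i<n. \<bar>F (x (Suc i)) - F (x i)\<bar>) \<le> 1"
proof -
  have "(\<Sum>i<n. \<bar>F (x (Suc i)) - F (x i)\<bar>) = (\<Sum>i<n. F (x (Suc i)) - F (x i))"
  proof (rule sum.cong[OF refl])
    fix i assume "i \<in> {..<n}"
    then have "x i \<le> x (Suc i)" using assms(1) by (auto simp: mono_on_def)
    then show "\<bar>F (x (Suc i)) - F (x i)\<bar> = F (x (Suc i)) - F (x i)"
      using monoD[OF assms(2)] by fastforce
  qed
  also have "\<dots> = F (x n) - F (x 0)"
    by (rule sum_lessThan_telescope)
  also have "\<dots> \<le> 1"
    using assms(3)[of "x n"] assms(3)[of "x 0"] by linarith
  finally show ?thesis .
qed

lemma zero_ext_variation_bdd:
  assumes g: "g \<in> bv_functions T" and T: "0 \<le> T"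
  shows "bdd_above (variation_sums (zero_ext T g) UNIV)"
proof -
  obtain B where B: "\<And>v. v \<in> variation_sums g {0..T} \<Longrightarrow> v \<le> B"
    using g unfolding bv_functions_def bdd_above_def by auto
  define c where "c x = max 0 (min T x)" for x :: real
  define N where "N = \<bar>g 0\<bar> + B"
  have c_in: "c x \<in> {0..T}" for x using T by (auto simp: c_def)
  have gN: "\<bar>g t\<bar> \<le> N" if "t \<in> {0..T}" for t
  proof -
    have "\<bar>g t - g 0\<bar> \<le> B" using that T by (intro B variation_sums_2) auto
    then show ?thesis by (simp add: N_def)
  qed
  have N0: "0 \<le> N" using gN[of 0] T by fastforce
  define F1 where "F1 x = (if (0::real) \<le> x then 1 else 0 :: real)" for x
  define F2 where "F2 x = (if T < x then 1 else 0 :: real)" for x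
  have step: "\<bar>zero_ext T g y - zero_ext T g x\<bar>
      \<le> \<bar>g (c y) - g (c x)\<bar> + N * \<bar>F1 y - F1 x\<bar> + N * \<bar>F2 y - F2 x\<bar>" if "x \<le> y" for x y
  proof -
    have z: "zero_ext T g u = (F1 u - F2 u) * g (c u)" for u
      using T by (simp add: zero_ext_def F1_def F2_def c_def)
    have w: "\<bar>F1 x - F2 x\<bar> \<le> 1" using T by (simp add: F1_def F2_def)
    have "zero_ext T g y - zero_ext T g x
        = (F1 x - F2 x) * (g (c y) - g (c x)) + g (c y) * ((F1 y - F1 x) - (F2 y - F2 x))"
      unfolding z by (simp add: algebra_simps)
    also have "\<bar>\<dots>\<bar> \<le> 1 * \<bar>g (c y) - g (c x)\<bar> + N * (\<bar>F1 y - F1 x\<bar> + \<bar>F2 y - F2 x\<bar>)"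
      by (intro order_trans[OF abs_triangle_ineq] add_mono; unfold abs_mult)
         (intro mult_mono w gN c_in abs_triangle_ineq4 N0; simp)+
    finally show ?thesis by (simp add: distrib_left)
  qed
  show ?thesis
  proof (rule bdd_aboveI)
    fix v assume "v \<in> variation_sums (zero_ext T g) UNIV"
    then obtain n x where v: "v = (\<Sum>i<n. \<bar>zero_ext T g (x (Suc i)) - zero_ext T g (x i)\<bar>)"
      and x: "mono_on {..n::nat} x"
      unfolding variation_sums_def by auto
    have "v \<le> (\<Sum>i<n. \<bar>g (c (x (Suc i))) - g (c (x i))\<bar> + N * \<bar>F1 (x (Suc i)) - F1 (x i)\<bar>
                  + N * \<bar>F2 (x (Suc i)) - F2 (x i)\<bar>)"
      unfolding v using x by (intro sum_mono step) (auto simp: mono_on_def)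
    also have "\<dots> = (\<Sum>i<n. \<bar>g ((c \<circ> x) (Suc i)) - g ((c \<circ> x) i)\<bar>)
                  + N * (\<Sum>i<n. \<bar>F1 (x (Suc i)) - F1 (x i)\<bar>)
                  + N * (\<Sum>i<n. \<bar>F2 (x (Suc i)) - F2 (x i)\<bar>)"
      by (simp add: sum.distrib sum_distrib_left)
    also have "\<dots> \<le> B + N * 1 + N * 1"
    proof (intro add_mono mult_left_mono N0 sum_abs_mono_seq_le[OF x])
      have "mono_on {..n} (c \<circ> x)"
        using x by (fastforce simp: mono_on_def c_def max_def min_def)
      then show "(\<Sum>i<n. \<bar>g ((c \<circ> x) (Suc i)) - g ((c \<circ> x) i)\<bar>) \<le> B"
        using c_in by (intro B) (auto simp: variation_sums_def intro!: exI[of _ n] exI[of _ "c \<circ> x"])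
    qed (auto simp: F1_def F2_def mono_def)
    finally show "v \<le> B + N * 1 + N * 1" .
  qed
qed

lemma variation_step:
  assumes b: "bdd_above (variation_sums f UNIV)" and "x \<le> y"
  shows "variation f {..x} + \<bar>f y - f x\<bar> \<le> variation f {..y}"
proof -
  have b': "bdd_above (variation_sums f A)" for A
    using b variation_sums_mono[of A UNIV f] by (meson bdd_above_mono subset_UNIV)
  have "variation f {..x} \<le> variation f {..y} - \<bar>f y - f x\<bar>"
    unfolding variation_def
  proof (rule cSup_least)
    show "variation_sums f {..x} \<noteq> {}" using variation_sums_nonempty[of x "{..x}" f] by auto
    fix v assume "v \<in> variation_sums f {..x}"
    then obtain n p where v: "v = (\<Sum>i<n. \<bar>f (p (Suc i)) - f (p i)\<bar>)"
      and p: "mono_on {..n::nat} p" "p ` {..n} \<subseteq> {..x}"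
      unfolding variation_sums_def by auto
    define q where "q i = (if i \<le> n then p i else if i = Suc n then x else y)" for i
    have "(\<Sum>i<Suc (Suc n). \<bar>f (q (Suc i)) - f (q i)\<bar>) \<in> variation_sums f {..y}"
      unfolding variation_sums_def mem_Collect_eq
    proof (intro exI conjI)
      show "mono_on {..Suc (Suc n)} q"
      proof (rule mono_onI)
        fix i j assume ij: "i \<in> {..Suc (Suc n)}" "j \<in> {..Suc (Suc n)}" "i \<le> j"
        have px: "p k \<le> x" if "k \<le> n" for k using p(2) that by auto
        consider "j \<le> n" | "i \<le> n" "n < j" | "n < i" by linarith
        then show "q i \<le> q j"
        proof cases
          case 1
          then show ?thesis using ij p(1) by (simp add: q_def mono_on_def)
        next
          case 2
          then show ?thesis using px[of i] \<open>x \<le> y\<close> by (simp add: q_def)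
        next
          case 3
          then show ?thesis using ij \<open>x \<le> y\<close> by (simp add: q_def)
        qed
      qed
      show "q ` {..Suc (Suc n)} \<subseteq> {..y}"
        using p \<open>x \<le> y\<close> unfolding q_def by (auto simp: image_subset_iff intro: order_trans)
    qed simp
    then have "(\<Sum>i<Suc (Suc n). \<bar>f (q (Suc i)) - f (q i)\<bar>) \<le> Sup (variation_sums f {..y})"
      by (intro cSup_upper b')
    moreover have "(\<Sum>i<n. \<bar>f (q (Suc i)) - f (q i)\<bar>) = v"
      unfolding v by (intro sum.cong) (auto simp: q_def)
    ultimately show "v \<le> Sup (variation_sums f {..y}) - \<bar>f y - f x\<bar>"
      by (simp add: q_def)
  qed
  then show ?thesis by simp
qed

lemma right_lim_tendsto:
  assumes "mono F" "bdd_below (range F)"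
  shows "(F \<longlongrightarrow> right_lim F x) (at_right x)"
proof -
  have "(F \<longlongrightarrow> Inf (F ` ({x<..} \<inter> UNIV))) (at x within ({x<..} \<inter> UNIV))"
    using assms
    by (intro Lim_right_bound[where K="Inf (range F)"]) (auto simp: mono_def intro!: cInf_lower)
  then show ?thesis
    unfolding right_lim_def by (auto simp: tendsto_Lim)
qed

lemma right_lim_bounds:
  assumes "mono F" "bdd_below (range F)"
  shows "F x \<le> right_lim F x" and "x < y \<Longrightarrow> right_lim F x \<le> F y"
proof -
  note * = right_lim_tendsto[OF assms, of x]
  show "F x \<le> right_lim F x"
    by (rule tendsto_lowerbound[OF *]) (auto simp: eventually_at_filter intro!: always_eventually monoD[OF assms(1)])
  assume "x < y"
  then show "right_lim F x \<le> F y"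
    by (intro tendsto_upperbound[OF *])
       (auto simp: eventually_at_right[OF \<open>x < y\<close>] intro!: exI[of _ y] monoD[OF assms(1)])
qed

lemma right_lim_mono:
  assumes "mono F" "bdd_below (range F)" "x \<le> y"
  shows "right_lim F x \<le> right_lim F y"
  using right_lim_bounds[OF assms(1,2)] assms(3) by (metis order.trans order_le_less)

lemma right_lim_continuous:
  assumes "mono F" "bdd_below (range F)"
  shows "continuous (at_right x) (right_lim F)"
proof -
  have "continuous (at_right x) (right_lim F) \<longleftrightarrow>
     (\<forall>e>0. \<exists>d>0. right_lim F (x + d) - right_lim F x < e)"
    by (rule continuous_at_right_real_increasing) (rule right_lim_mono[OF assms])
  moreover have "\<exists>d>0. right_lim F (x + d) - right_lim F x < e" if "e > 0" for e
  proof -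
    have "\<forall>\<^sub>F y in at_right x. F y < right_lim F x + e"
      using order_tendstoD(2)[OF right_lim_tendsto[OF assms]] that by simp
    then obtain b where b: "b > x" "\<And>y. x < y \<Longrightarrow> y < b \<Longrightarrow> F y < right_lim F x + e"
      unfolding eventually_at_right[OF less_add_one] by auto
    define d where "d = (b - x) / 3"
    have "d > 0" "x + d < x + 2 * d" "x + 2 * d < b" using b(1) by (auto simp: d_def field_simps)
    then have "right_lim F (x + d) \<le> F (x + 2 * d)" "F (x + 2 * d) < right_lim F x + e"
      using right_lim_bounds(2)[OF assms] b(2)[of "x + 2 * d"] by auto
    with \<open>d > 0\<close> show ?thesis by (intro exI[of _ d]) auto
  qed
  ultimately show ?thesis by blast
qed

lemma finite_interval_measure_right_lim:
  assumes F: "mono F" "bdd_below (range F)" and B: "\<And>x y. F x - F y \<le> B"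
  shows "finite_measure (interval_measure (right_lim F))"
    and "a \<le> b \<Longrightarrow> measure (interval_measure (right_lim F)) {a<..b} = right_lim F b - right_lim F a"
proof -
  have em: "emeasure (interval_measure (right_lim F)) {a<..b} = right_lim F b - right_lim F a"
    if "a \<le> b" for a b
    using that by (intro emeasure_interval_measure_Ioc right_lim_mono[OF F] right_lim_continuous[OF F])
  show "a \<le> b \<Longrightarrow> measure (interval_measure (right_lim F)) {a<..b} = right_lim F b - right_lim F a"
    by (intro measure_interval_measure_Ioc right_lim_mono[OF F] right_lim_continuous[OF F])
  have le: "right_lim F b - right_lim F a \<le> B" for a b
    using right_lim_bounds(2)[OF F less_add_one[of b]] right_lim_bounds(1)[OF F, of a] B[of "b + 1" a]
    by linarith
  let ?M = "interval_measure (right_lim F)"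
  have U: "(\<Union>n::nat. {- real n<..real n}) = UNIV"
  proof (intro set_eqI iffI UNIV_I)
    fix x :: real
    obtain n where "\<bar>x\<bar> < real n" using reals_Archimedean2 by blast
    then have "x \<in> {- real n<..real n}" by auto
    then show "x \<in> (\<Union>n::nat. {- real n<..real n})" by blast
  qed
  have "emeasure ?M (space ?M) = (SUP n. emeasure ?M {- real n<..real n})"
    by (subst SUP_emeasure_incseq) (auto simp: U incseq_def)
  also have "\<dots> \<le> ennreal B"
    by (intro SUP_least) (auto simp: em le intro!: ennreal_leI)
  finally show "finite_measure ?M"
    by (intro finite_measureI) (auto simp: top_unique)
qed

lemma ls_decomposition:
  assumes g: "g \<in> bv_functions T" and T: "0 \<le> T"
  shows "finite_measure (ls_plus T g)" "finite_measure (ls_minus T g)"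
    and "(zero_ext T g \<longlongrightarrow> right_lim (zero_ext T g) x) (at_right x)"
    and "a \<le> b \<Longrightarrow> measure (ls_plus T g) {a<..b} - measure (ls_minus T g) {a<..b}
           = right_lim (zero_ext T g) b - right_lim (zero_ext T g) a"
proof -
  let ?g = "zero_ext T g"
  define P where "P = (\<lambda>x. (variation ?g {..x} + ?g x) / 2)"
  define N where "N = (\<lambda>x. (variation ?g {..x} - ?g x) / 2)"
  note b = zero_ext_variation_bdd[OF g T]
  have st: "variation ?g {..x} + \<bar>?g y - ?g x\<bar> \<le> variation ?g {..y}" if "x \<le> y" for x y
    by (rule variation_step[OF b that])
  have mP: "mono P" and mN: "mono N"
    unfolding P_def N_def using st by (auto intro!: monoI simp: abs_le_iff) (smt (verit) st)+
  obtain B where B: "\<And>v. v \<in> variation_sums ?g UNIV \<Longrightarrow> v \<le> B"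
    using b unfolding bdd_above_def by auto
  have V: "0 \<le> variation ?g {..x} \<and> variation ?g {..x} \<le> B" for x
  proof
    have "bdd_above (variation_sums ?g {..x})"
      using b variation_sums_mono[of "{..x}" UNIV ?g] by (meson bdd_above_mono subset_UNIV)
    then show "0 \<le> variation ?g {..x}"
      unfolding variation_def by (intro cSup_upper variation_sums_nonempty[of x]) auto
    show "variation ?g {..x} \<le> B"
      unfolding variation_def using variation_sums_nonempty[of x "{..x}" ?g]
        variation_sums_mono[of "{..x}" UNIV ?g]
      by (intro cSup_least B) auto
  qed
  have gB: "\<bar>?g x\<bar> \<le> B" for x
  proof -
    have "\<bar>?g x - ?g (min (- 1) x)\<bar> \<le> B"
      by (intro B variation_sums_2) auto
    then show ?thesis by (auto simp: zero_ext_def split: if_splits)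
  qed
  have PB: "\<bar>P x\<bar> \<le> B" and NB: "\<bar>N x\<bar> \<le> B" for x
    using V[of x] gB[of x] unfolding P_def N_def by (auto simp: abs_le_iff)
  have bP: "bdd_below (range P)" and bN: "bdd_below (range N)"
    using PB NB by (auto intro!: bdd_belowI[of _ "- B"] simp: abs_le_iff) (smt (verit))+
  have dP: "P x - P y \<le> 2 * B" and dN: "N x - N y \<le> 2 * B" for x y
    using PB[of x] PB[of y] NB[of x] NB[of y] by auto
  have eqP: "ls_plus T g = interval_measure (right_lim P)"
    and eqN: "ls_minus T g = interval_measure (right_lim N)"
    by (simp_all add: ls_plus_def ls_minus_def P_def N_def)
  show "finite_measure (ls_plus T g)" "finite_measure (ls_minus T g)"
    unfolding eqP eqN
    by (rule finite_interval_measure_right_lim[OF mP bP dP] finite_interval_measure_right_lim[OF mN bN dN])+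
  have gPN: "?g = (\<lambda>x. P x - N x)" by (auto simp: P_def N_def field_simps)
  have lim: "(?g \<longlongrightarrow> right_lim P x - right_lim N x) (at_right x)" for x
    by (subst gPN) (intro tendsto_diff right_lim_tendsto mP bP mN bN)
  then have r: "right_lim ?g x = right_lim P x - right_lim N x" for x
    unfolding right_lim_def[of ?g] by (intro tendsto_Lim) auto
  show "(?g \<longlongrightarrow> right_lim ?g x) (at_right x)" using lim r by simp
  show "a \<le> b \<Longrightarrow> measure (ls_plus T g) {a<..b} - measure (ls_minus T g) {a<..b}
           = right_lim ?g b - right_lim ?g a"
    unfolding eqP eqN r
    using finite_interval_measure_right_lim(2)[OF mP bP dP, of a b]
      finite_interval_measure_right_lim(2)[OF mN bN dN, of a b] by simp
qed

lemma signed_combination_zero: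
  fixes m :: "'k \<Rightarrow> real measure" and c :: "'k \<Rightarrow> real"
  assumes K: "finite K"
    and fin: "\<And>k. k \<in> K \<Longrightarrow> finite_measure (m k)"
    and sets: "\<And>k. k \<in> K \<Longrightarrow> sets (m k) = sets borel"
    and Ioc: "\<And>a b. a \<le> b \<Longrightarrow> (\<Sum>k\<in>K. c k * measure (m k) {a<..b}) = 0"
    and h: "h \<in> borel_measurable borel" "\<And>x. \<bar>h x\<bar> \<le> B"
  shows "(\<Sum>k\<in>K. c k * (\<integral>x. h x \<partial>m k)) = 0"
proof -
  have sp: "space (m k) = UNIV" if "k \<in> K" for k
    using sets_eq_imp_space_eq[OF sets[OF that]] by simp
  have UN: "(\<Sum>k\<in>K. c k * measure (m k) UNIV) = 0"
  proof (rule LIMSEQ_unique)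
    have U: "(\<Union>n::nat. {- real n<..real n}) = UNIV"
    proof (intro set_eqI iffI UNIV_I)
      fix x :: real
      obtain n where "\<bar>x\<bar> < real n" using reals_Archimedean2 by blast
      then have "x \<in> {- real n<..real n}" by auto
      then show "x \<in> (\<Union>n::nat. {- real n<..real n})" by blast
    qed
    have "(\<lambda>n. measure (m k) {- real n<..real n}) \<longlonglongrightarrow> measure (m k) UNIV" if "k \<in> K" for k
    proof -
      have "incseq (\<lambda>n. {- real n<..real n})" by (auto simp: incseq_def)
      moreover have "range (\<lambda>n. {- real n<..real n}) \<subseteq> sets (m k)" by (auto simp: sets[OF that])
      ultimately have "(\<lambda>n. measure (m k) {- real n<..real n}) \<longlonglongrightarrow> measure (m k) (\<Union>n::nat. {- real n<..real n})"
        by (intro finite_measure.finite_Lim_measure_incseq[OF fin[OF that]])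
      then show ?thesis by (simp add: U)
    qed
    then show "(\<lambda>n. \<Sum>k\<in>K. c k * measure (m k) {- real n<..real n})
        \<longlonglongrightarrow> (\<Sum>k\<in>K. c k * measure (m k) UNIV)"
      by (intro tendsto_sum tendsto_mult_left) auto
    show "(\<lambda>n. \<Sum>k\<in>K. c k * measure (m k) {- real n<..real n}) \<longlonglongrightarrow> 0"
      by (simp add: Ioc)
  qed
  have meas: "(\<Sum>k\<in>K. c k * measure (m k) A) = 0" if "A \<in> sets borel" for A
  proof -
    have stable: "Int_stable (range (\<lambda>(a, b). {a<..b::real}))"
      by (auto simp: Int_stable_def)
    have sig: "sets borel = sigma_sets UNIV (range (\<lambda>(a, b). {a<..b::real}))"
      by (subst borel_sigma_sets_Ioc) simp
    have closed: "range (\<lambda>(a, b). {a<..b::real}) \<subseteq> Pow UNIV" by auto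
    from that have A: "A \<in> sigma_sets UNIV (range (\<lambda>(a, b). {a<..b::real}))" by (simp add: sig)
    from stable closed A show ?thesis
    proof (induction rule: sigma_sets_induct_disjoint)
      case (basic A)
      then obtain a b where A: "A = {a<..b}" by auto
      show ?case using Ioc[of a b] by (cases "a \<le> b") (auto simp: A)
    next
      case (compl A)
      have "measure (m k) (UNIV - A) = measure (m k) UNIV - measure (m k) A" if "k \<in> K" for k
        using finite_measure.finite_measure_compl[OF fin[OF that], of A] compl(1)
        by (simp add: sp[OF that] sets[OF that] sig)
      then show ?case using compl(2) UN by (simp add: right_diff_distrib sum_subtractf)
    next
      case (union A)
      have "(\<lambda>i. \<Sum>k\<in>K. c k * measure (m k) (A i)) sums (\<Sum>k\<in>K. c k * measure (m k) (\<Union>i. A i))"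
      proof (intro sums_sum sums_mult)
        fix k assume k: "k \<in> K"
        show "(\<lambda>i. measure (m k) (A i)) sums measure (m k) (\<Union>i. A i)"
          by (rule finite_measure.finite_measure_UNION[OF fin[OF k]])
             (use union in \<open>auto simp: sets[OF k] sig\<close>)
      qed
      then show ?case using union(3) by (simp add: sums_unique[symmetric] sums_iff)
    qed auto
  qed
  have nonneg: "(\<exists>B. \<forall>x. u x \<le> B) \<longrightarrow> (\<Sum>k\<in>K. c k * (\<integral>x. u x \<partial>m k)) = 0"
    if "u \<in> borel_measurable borel" "\<And>x. 0 \<le> u x" for u :: "real \<Rightarrow> real"
    using that
  proof (induction rule: borel_measurable_induct_real)
    case (set A)
    have "(\<integral>x. indicator A x \<partial>m k) = measure (m k) A" if "k \<in> K" for k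
      using set by (simp add: sp[OF that])
    then show ?case using meas set by simp
  next
    case (mult u r)
    then show ?case
    proof (cases "r = 0")
      case False
      then have r: "r > 0" using \<open>0 \<le> r\<close> by simp
      have "(\<Sum>k\<in>K. c k * (\<integral>x. u x \<partial>m k)) = 0" if "\<forall>x. r * u x \<le> B" for B
      proof -
        have "\<forall>x. u x \<le> B / r" using that r by (simp add: field_simps)
        then show ?thesis using mult by blast
      qed
      moreover have "(\<Sum>k\<in>K. c k * (\<integral>x. r * u x \<partial>m k)) = r * (\<Sum>k\<in>K. c k * (\<integral>x. u x \<partial>m k))"
        by (simp add: sum_distrib_left mult_ac)
      ultimately show ?thesis by auto
    qed simp
  next
    case (add u v)
    show ?case
    proof
      assume "\<exists>B. \<forall>x. v x + u x \<le> B"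
      then obtain B where B: "\<And>x. v x + u x \<le> B" by blast
      have uB: "u x \<le> B" and vB: "v x \<le> B" for x
      proof -
        have "0 \<le> u x" "0 \<le> v x" using add by blast+
        then show "u x \<le> B" "v x \<le> B" using B[of x] by linarith+
      qed
      have "integrable (m k) u \<and> integrable (m k) v" if "k \<in> K" for k
        using add uB vB sets[OF that]
        by (auto intro!: finite_measure.integrable_const_bound[OF fin[OF that], where B=B]
                 cong: measurable_cong_sets)
      then have "(\<Sum>k\<in>K. c k * (\<integral>x. v x + u x \<partial>m k))
          = (\<Sum>k\<in>K. c k * (\<integral>x. v x \<partial>m k)) + (\<Sum>k\<in>K. c k * (\<integral>x. u x \<partial>m k))"
        by (simp add: sum.distrib[symmetric] distrib_left)
      then show "(\<Sum>k\<in>K. c k * (\<integral>x. v x + u x \<partial>m k)) = 0"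
      proof -
        have "\<exists>B. \<forall>x. u x \<le> B" "\<exists>B. \<forall>x. v x \<le> B" using uB vB by blast+
        with add have "(\<Sum>k\<in>K. c k * (\<integral>x. u x \<partial>m k)) = 0" "(\<Sum>k\<in>K. c k * (\<integral>x. v x \<partial>m k)) = 0"
          by blast+
        with \<open>(\<Sum>k\<in>K. c k * (\<integral>x. v x + u x \<partial>m k)) = _\<close> show ?thesis by simp
      qed
    qed
  next
    case (seq U)
    show ?case
    proof
      assume "\<exists>B. \<forall>x. u x \<le> B"
      then obtain B where B: "\<And>x. u x \<le> B" by blast
      have UB: "U i x \<le> B" for i x
      proof -
        have "U i x \<le> u x"
          using \<open>incseq U\<close> \<open>\<And>x. x \<in> space borel \<Longrightarrow> (\<lambda>i. U i x) \<longlonglongrightarrow> u x\<close>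
          by (intro incseq_le) (auto simp: incseq_def le_fun_def)
        with B[of x] show ?thesis by linarith
      qed
      have "(\<lambda>i. \<integral>x. U i x \<partial>m k) \<longlonglongrightarrow> (\<integral>x. u x \<partial>m k)" if "k \<in> K" for k
      proof (rule integral_dominated_convergence[where w="\<lambda>_. B"])
        show "u \<in> borel_measurable (m k)" "\<And>i. U i \<in> borel_measurable (m k)"
          using that(1) seq \<open>u \<in> borel_measurable borel\<close> sets[OF that]
          by (auto cong: measurable_cong_sets)
        show "integrable (m k) (\<lambda>_. B)"
          by (rule finite_measure.integrable_const[OF fin[OF that]])
      qed (use seq UB in auto)
      then have "(\<lambda>i. \<Sum>k\<in>K. c k * (\<integral>x. U i x \<partial>m k)) \<longlonglongrightarrow> (\<Sum>k\<in>K. c k * (\<integral>x. u x \<partial>m k))"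
        by (intro tendsto_sum tendsto_mult_left) auto
      moreover have "(\<Sum>k\<in>K. c k * (\<integral>x. U i x \<partial>m k)) = 0" for i
        using seq UB by blast
      ultimately show "(\<Sum>k\<in>K. c k * (\<integral>x. u x \<partial>m k)) = 0"
        by (simp add: LIMSEQ_const_iff)
    qed
  qed
  have int: "integrable (m k) (\<lambda>x. max 0 (h x)) \<and> integrable (m k) (\<lambda>x. max 0 (- h x))" if "k \<in> K" for k
  proof -
    have hm: "h \<in> borel_measurable (m k)" using h(1) sets[OF that] by (simp cong: measurable_cong_sets)
    have "0 \<le> B" using h(2)[of 0] by linarith
    then show ?thesis
      using hm h(2)
      by (intro conjI finite_measure.integrable_const_bound[OF fin[OF that], where B=B])
         (auto simp: max_def abs_le_iff)
  qed
  have "(\<Sum>k\<in>K. c k * (\<integral>x. h x \<partial>m k))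
      = (\<Sum>k\<in>K. c k * (\<integral>x. max 0 (h x) - max 0 (- h x) \<partial>m k))"
    by (intro sum.cong arg_cong2[where f="(*)"] Bochner_Integration.integral_cong) (auto simp: max_def)
  also have "\<dots> = (\<Sum>k\<in>K. c k * (\<integral>x. max 0 (h x) \<partial>m k)) - (\<Sum>k\<in>K. c k * (\<integral>x. max 0 (- h x) \<partial>m k))"
    using int by (simp add: right_diff_distrib sum_subtractf)
  also have "\<dots> = 0"
  proof -
    have "0 \<le> B" using h(2)[of 0] by linarith
    then have "\<forall>x. max 0 (h x) \<le> B" "\<forall>x. max 0 (- h x) \<le> B"
      using h(2) by (auto simp: abs_le_iff)
    then have "(\<Sum>k\<in>K. c k * (\<integral>x. max 0 (h x) \<partial>m k)) = 0" "(\<Sum>k\<in>K. c k * (\<integral>x. max 0 (- h x) \<partial>m k)) = 0"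
      using nonneg[of "\<lambda>x. max 0 (h x)"] nonneg[of "\<lambda>x. max 0 (- h x)"] h(1) by (auto simp del: max.bounded_iff)
    then show ?thesis by simp
  qed
  finally show ?thesis .
qed

lemma ls_integral_indicator:
  assumes ab: "0 \<le> a" "a \<le> b" "b \<le> T"
    and h: "(\<lambda>x. indicator {0..T} x * h x) \<in> borel_measurable borel" "\<And>x. x \<in> {0..T} \<Longrightarrow> \<bar>h x\<bar> \<le> B"
  shows "ls_integral T (indicator {a..b}) h = h a - h b"
proof -
  let ?g = "indicator {a..b} :: real \<Rightarrow> real"
  have T: "0 \<le> T" using ab by linarith
  have g: "?g \<in> bv_functions T"
  proof -
    define F1 where "F1 x = (if a \<le> x then 1 else 0 :: real)" for x
    define F2 where "F2 x = (if b < x then 1 else 0 :: real)" for x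
    have "v \<le> 1 + 1" if v: "v \<in> variation_sums ?g {0..T}" for v
    proof -
      obtain n x where v: "v = (\<Sum>i<n. \<bar>?g (x (Suc i)) - ?g (x i)\<bar>)" and x: "mono_on {..n::nat} x"
        using v unfolding variation_sums_def by auto
      have "v \<le> (\<Sum>i<n. \<bar>F1 (x (Suc i)) - F1 (x i)\<bar> + \<bar>F2 (x (Suc i)) - F2 (x i)\<bar>)"
        unfolding v using ab by (intro sum_mono) (auto simp: F1_def F2_def)
      also have "\<dots> \<le> 1 + 1"
        unfolding sum.distrib
        by (intro add_mono sum_abs_mono_seq_le[OF x]) (auto simp: F1_def F2_def mono_def)
      finally show ?thesis .
    qed
    then show ?thesis unfolding bv_functions_def by (auto intro!: bdd_aboveI)
  qed
  note dec = ls_decomposition[OF g T]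
  have r: "right_lim (zero_ext T ?g) x = (if a \<le> x \<and> x < b then 1 else 0)" for x
  proof -
    have "((\<lambda>_. if a \<le> x \<and> x < b then 1 else 0 :: real) \<longlongrightarrow> (if a \<le> x \<and> x < b then 1 else 0)) (at_right x)"
      by (rule tendsto_const)
    moreover have "\<forall>\<^sub>F y in at_right x. (if a \<le> x \<and> x < b then 1 else 0) = zero_ext T ?g y"
    proof -
      define d where "d = (if x < a then a else if x < b then b else x + 1)"
      have "x < d" by (auto simp: d_def)
      then have "\<forall>\<^sub>F y in at_right x. x < y \<and> y < d"
        by (auto simp: eventually_at_right[OF \<open>x < d\<close>])
      then show ?thesis
        by eventually_elim (use ab in \<open>auto simp: d_def zero_ext_def indicator_def split: if_splits\<close>)
    qed
    ultimately have "(zero_ext T ?g \<longlongrightarrow> (if a \<le> x \<and> x < b then 1 else 0)) (at_right x)"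
      by (rule Lim_transform_eventually)
    then show ?thesis unfolding right_lim_def by (intro tendsto_Lim) auto
  qed
  define m where "m = (\<lambda>k::nat. if k = 0 then ls_plus T ?g else if k = 1 then ls_minus T ?g
      else if k = 2 then return borel a else return borel b)"
  define c where "c = (\<lambda>k::nat. if k = 0 then 1 else if k = 1 then - 1 else if k = 2 then - 1 else 1 :: real)"
  have sum4: "(\<Sum>k<4. F k) = F 0 + F 1 + F 2 + F 3" for F :: "nat \<Rightarrow> real"
    by (simp add: eval_nat_numeral)
  have "(\<Sum>k<4. c k * (\<integral>x. indicator {0..T} x * h x \<partial>m k)) = 0"
  proof (rule signed_combination_zero[where B="max 0 B"])
    show "finite_measure (m k)" if "k \<in> {..<4}" for k
      using dec(1,2) prob_space_return[of a borel] prob_space_return[of b borel]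
      by (auto simp: m_def prob_space_def)
    show "sets (m k) = sets borel" if "k \<in> {..<4}" for k
      by (auto simp: m_def ls_plus_def ls_minus_def)
    show "(\<Sum>k<4. c k * measure (m k) {p<..q}) = 0" if "p \<le> q" for p q
    proof -
      have "(if a \<le> q \<and> q < b then 1 else 0) - (if a \<le> p \<and> p < b then 1 else 0 :: real)
          = indicator {p<..q} a - indicator {p<..q} b"
        using that ab by (auto simp: indicator_def)
      then show ?thesis
        using dec(4)[OF that] by (simp add: sum4 c_def m_def r measure_return)
    qed
    show "\<bar>indicator {0..T} x * h x\<bar> \<le> max 0 B" for x
      using h(2)[of x] by (auto simp: indicator_def)
  qed (use h in auto)
  then show ?thesis
    using ab h(1)
    by (simp add: sum4 c_def m_def ls_integral_def set_lebesgue_integral_def integral_return)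
qed

lemma cov_inner_indicator:
  fixes R :: "real \<Rightarrow> real \<Rightarrow> real"
  assumes ab: "0 \<le> a" "a \<le> b" "b \<le> T" and cd: "0 \<le> c" "c \<le> d" "d \<le> T"
    and R: "continuous_on ({0..T} \<times> {0..T}) (\<lambda>(s, t). R s t)"
  shows "cov_inner R T (indicator {a..b}) (indicator {c..d}) = R c a - R c b - (R d a - R d b)"
proof -
  have "bounded ((\<lambda>(s, t). R s t) ` ({0..T} \<times> {0..T}))"
    by (intro compact_imp_bounded compact_continuous_image R compact_Times compact_Icc)
  then obtain B where B: "\<And>s t. s \<in> {0..T} \<Longrightarrow> t \<in> {0..T} \<Longrightarrow> \<bar>R s t\<bar> \<le> B"
    unfolding bounded_iff by fastforce
  have sec1: "continuous_on {0..T} (\<lambda>t. R s t)" if "s \<in> {0..T}" for s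
    using that by (intro continuous_on_compose2[OF R, of "{0..T}" "\<lambda>t. (s, t)", simplified])
      (auto intro!: continuous_intros)
  have sec2: "continuous_on {0..T} (\<lambda>s. R s t)" if "t \<in> {0..T}" for t
    using that by (intro continuous_on_compose2[OF R, of "{0..T}" "\<lambda>s. (s, t)", simplified])
      (auto intro!: continuous_intros)
  have bm: "(\<lambda>x. indicator {0..T} x * h x) \<in> borel_measurable borel" if "continuous_on {0..T} h"
    for h :: "real \<Rightarrow> real"
    using borel_measurable_continuous_on_indicator[OF _ that] by simp
  have inner: "ls_integral T (indicator {a..b}) (\<lambda>t. R s t) = R s a - R s b" if "s \<in> {0..T}" for s
    using ab B[OF that] by (intro ls_integral_indicator bm sec1[OF that]) auto
  have "cov_inner R T (indicator {a..b}) (indicator {c..d}) =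
        ls_integral T (indicator {c..d}) (\<lambda>s. R s a - R s b)"
    unfolding cov_inner_def ls_integral_def[of _ "indicator {c..d}"]
    by (intro arg_cong2[where f="(-)"] set_lebesgue_integral_cong)
       (auto simp: ls_plus_def ls_minus_def inner)
  also have "\<dots> = (R c a - R c b) - (R d a - R d b)"
  proof (rule ls_integral_indicator[OF cd])
    show "(\<lambda>x. indicator {0..T} x * (R x a - R x b)) \<in> borel_measurable borel"
      using ab by (intro bm continuous_on_diff sec2) auto
    show "\<bar>R x a - R x b\<bar> \<le> 2 * B" if "x \<in> {0..T}" for x
      using B[OF that, of a] B[OF that, of b] ab by auto
  qed
  finally show ?thesis .
qed

lemma centred_gaussian_rv_square_integrable:
  assumes "centred_gaussian_rv M X"
  shows "integrable M (\<lambda>\<omega>. (X \<omega>)\<^sup>2)"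
proof -
  from assms consider "AE \<omega> in M. X \<omega> = 0" | \<sigma> where "\<sigma> > 0" "distributed M lborel X (normal_density 0 \<sigma>)"
    unfolding centred_gaussian_rv_def by auto
  then show ?thesis
  proof cases
    case 1
    have "integrable M (\<lambda>\<omega>. (X \<omega>)\<^sup>2) \<longleftrightarrow> integrable M (\<lambda>\<omega>. 0 :: real)"
      using 1 assms by (intro integrable_cong_AE) (auto simp: centred_gaussian_rv_def)
    then show ?thesis by simp
  next
    case 2
    have "integrable lborel (\<lambda>x. normal_density 0 \<sigma> x * (x - 0)\<^sup>2)"
      by (rule integrable_normal_moment[OF 2(1)])
    then show ?thesis
      using distributed_integrable[OF 2(2), of "\<lambda>x. x\<^sup>2"] by simp
  qed
qed

lemma cov_inner_indicator_process:
  fixes G :: "real \<Rightarrow> 'a \<Rightarrow> real"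
  assumes ab: "0 \<le> a" "a \<le> b" "b \<le> T" and cd: "0 \<le> c" "c \<le> d" "d \<le> T"
    and G: "centred_gaussian_process M {0..T} G"
    and R: "continuous_on ({0..T} \<times> {0..T}) (\<lambda>(s, t). covariance M G s t)"
  shows "cov_inner (covariance M G) T (indicator {a..b}) (indicator {c..d})
    = (\<integral>\<omega>. (G b \<omega> - G a \<omega>) * (G d \<omega> - G c \<omega>) \<partial>M)"
proof -
  have rv: "centred_gaussian_rv M (G t)" if "t \<in> {0..T}" for t
    using G[unfolded centred_gaussian_process_def, THEN conjunct2, rule_format, of "{t}" "\<lambda>_. 1"] that
    by simp
  have int: "integrable M (\<lambda>\<omega>. G s \<omega> * G t \<omega>)" if "s \<in> {0..T}" "t \<in> {0..T}" for s t
  proof (rule Bochner_Integration.integrable_bound)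
    show "integrable M (\<lambda>\<omega>. (G s \<omega>)\<^sup>2 + (G t \<omega>)\<^sup>2)"
      using that by (intro Bochner_Integration.integrable_add centred_gaussian_rv_square_integrable rv)
    show "(\<lambda>\<omega>. G s \<omega> * G t \<omega>) \<in> borel_measurable M"
      using rv[OF that(1)] rv[OF that(2)] unfolding centred_gaussian_rv_def
      by (intro borel_measurable_times) auto
    have "\<bar>x * y\<bar> \<le> x\<^sup>2 + y\<^sup>2" for x y :: real
    proof -
      have "2 * (\<bar>x\<bar> * \<bar>y\<bar>) \<le> x\<^sup>2 + y\<^sup>2"
        using sum_squares_bound[of "\<bar>x\<bar>" "\<bar>y\<bar>"] by (simp add: mult.assoc)
      moreover have "0 \<le> \<bar>x\<bar> * \<bar>y\<bar>" by simp
      ultimately show ?thesis unfolding abs_mult by linarith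
    qed
    then show "AE \<omega> in M. norm (G s \<omega> * G t \<omega>) \<le> norm ((G s \<omega>)\<^sup>2 + (G t \<omega>)\<^sup>2)"
      by (intro AE_I2) simp
  qed
  have "(\<integral>\<omega>. (G b \<omega> - G a \<omega>) * (G d \<omega> - G c \<omega>) \<partial>M)
      = (\<integral>\<omega>. (G b \<omega> * G d \<omega> - G b \<omega> * G c \<omega>) - (G a \<omega> * G d \<omega> - G a \<omega> * G c \<omega>) \<partial>M)"
    by (rule Bochner_Integration.integral_cong) (auto simp: left_diff_distrib right_diff_distrib)
  also have "\<dots> = (covariance M G d b - covariance M G c b) - (covariance M G d a - covariance M G c a)"
    unfolding covariance_def using ab cd
    by (subst Bochner_Integration.integral_diff Bochner_Integration.integrable_diff;
        (intro Bochner_Integration.integrable_diff int; simp)?)+ simp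
  finally show ?thesis
    using cov_inner_indicator[OF ab cd R] by linarith
qed

end

(*
  Write Delta = R - R^B, a continuous function whose sections are absolutely continuous. For
  Phi continuous on [0,T] and g of bounded variation, the integral of Phi against nu_g is the limit
  of the sums of c_i (Phi(x_i) - Phi(x_(i+1))) over uniform grids, for any c_i that differ from
  g(x_(i+1)) by at most the variation of g on the cell. Taking for c_i soft thresholded values of g,
  so that |c_i| <= |g| on the i-th cell, yields by dominated convergence

    int Phi dnu_g = - int g psi,   where   Phi(d) - Phi(c) = int_c^d psi.

  Apply this first to Delta(s,.), with density D(s,.), and f, and then to
  Phi(s) = int Delta(s,t) nu_f(dt) = - int f(t) D(s,t) dt and g. The increments of this Phi are
  obtained from Fubini's theorem, but only on cells where |g| is bounded below: it is only the product
  f(t) g(s) dD/ds(s,t) that is assumed to be integrable. Under the pointwise bound they satisfy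
  |Phi(d) - Phi(c)| <= C nu(|f|) nu([c,d]), and the same sums give the estimate.

  The fundamental theorem of calculus for absolutely continuous functions comes from the
  Radon-Nikodym theorem applied to the Stieltjes measures of V and V - h, with V the variation of h.
*)
theory Submission
  imports Defs
begin

text \<open>Two defects of the mixed derivative E = dD/ds shape the proof. First, E is known only
  through its sections: for each t it is the derivative of an absolutely continuous function of s.
  Joint measurability and integrability are at hand only for the product f(t) g(s) E(s,t), and in
  the estimate not even for that. The estimate therefore cannot start from the double integral; it
  goes through the increments D(d,t) - D(c,t), which are integrals of E(.,t) for every t. Second,
  \<open>deriv\<close> takes arbitrary values where there is no derivative, so densities are
  determined only up to null sets. This is why integrals are taken over the completed measure, where
  a change on a null set preserves measurability.

  Thresholding rather than sampling g matters because |g psi| is the only dominating function at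
  hand: a sampled step function can be nonzero at zeros of g, where psi is uncontrolled.\<close>

section \<open>Primitives of integrable functions\<close>

text \<open>The condition concerns all increments, so restriction to subintervals and differences
  are immediate. The completed measure makes the notion stable under changing \<phi> on a null set.
  For b < a it holds vacuously for every \<phi>.\<close>

definition is_primitive :: "real \<Rightarrow> real \<Rightarrow> (real \<Rightarrow> real) \<Rightarrow> (real \<Rightarrow> real) \<Rightarrow> bool" where
  "is_primitive a b \<phi> h \<longleftrightarrow> set_integrable lebesgue {a..b} \<phi> \<and>
     (\<forall>c d. a \<le> c \<and> c \<le> d \<and> d \<le> b \<longrightarrow> h d - h c = (LINT x:{c..d}|lebesgue. \<phi> x))"

lemma AE_lebesgue_neq: "AE x in lebesgue. x \<noteq> (a :: real)"
proof -
  have "{a} \<in> null_sets lebesgue" using negligible_iff_null_sets[of "{a}"] by simp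
  then show ?thesis by (rule AE_not_in[THEN eventually_mono]) simp
qed

text \<open>Lebesgue differentiation along the intervals [x, x + h] yields the right difference
  quotient only. The left one is the right one of the reflected pair - F (- x), \<phi> (- x), and
  both limits exist off a common null set.\<close>

lemma integral_has_derivative_ae:
  fixes \<phi> F :: "real \<Rightarrow> real"
  assumes int: "\<And>x y. \<phi> integrable_on {x..y}"
    and F: "\<And>x y. x \<le> y \<Longrightarrow> F y - F x = integral {x..y} \<phi>"
  shows "AE x in lebesgue. (F has_real_derivative \<phi> x) (at x)"
proof -
  have right: "\<exists>N. negligible N \<and> (\<forall>x. x \<notin> N \<longrightarrow> ((\<lambda>h. (F (x + h) - F x) / h) \<longlongrightarrow> \<phi> x) (at_right 0))"
    if int: "\<And>x y. \<phi> integrable_on {x..y}"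
    and F: "\<And>x y. x \<le> y \<Longrightarrow> F y - F x = integral {x..y} \<phi>" for \<phi> F :: "real \<Rightarrow> real"
  proof -
    obtain N where N: "negligible N"
      "\<And>x e. \<lbrakk>x \<notin> N; 0 < e\<rbrakk> \<Longrightarrow> \<exists>d>0. \<forall>h. 0 < h \<and> h < d \<longrightarrow>
          norm (integral (cbox x (x + h *\<^sub>R One)) \<phi> /\<^sub>R h ^ DIM(real) - \<phi> x) < e"
      using integrable_ccontinuous_explicit[of \<phi>] int by auto
    have "((\<lambda>h. (F (x + h) - F x) / h) \<longlongrightarrow> \<phi> x) (at_right 0)" if x: "x \<notin> N" for x
    proof (rule tendstoI)
      fix e :: real assume "0 < e"
      then obtain d where d: "d > 0" "\<And>h. 0 < h \<Longrightarrow> h < d \<Longrightarrow> norm (integral {x..x + h} \<phi> / h - \<phi> x) < e"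
        using N(2)[OF x \<open>0 < e\<close>] by (auto simp: divide_inverse mult.commute)
      have "dist ((F (x + h) - F x) / h) (\<phi> x) < e" if "0 < h" "h < d" for h
        using d(2)[OF that] F[of x "x + h"] that by (simp add: dist_real_def)
      then show "\<forall>\<^sub>F h in at_right 0. dist ((F (x + h) - F x) / h) (\<phi> x) < e"
        using d(1) by (auto simp: eventually_at_right[of 0 1] intro!: exI[of _ d])
    qed
    with N(1) show ?thesis by blast
  qed
  obtain N1 where N1: "negligible N1"
    "\<And>x. x \<notin> N1 \<Longrightarrow> ((\<lambda>h. (F (x + h) - F x) / h) \<longlongrightarrow> \<phi> x) (at_right 0)"
    using right[OF int F] by blast
  have "\<exists>N. negligible N \<and> (\<forall>x. x \<notin> N \<longrightarrow>
          ((\<lambda>h. (- F (- (x + h)) - - F (- x)) / h) \<longlongrightarrow> \<phi> (- x)) (at_right 0))"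
  proof (rule right)
    show "(\<lambda>x. \<phi> (- x)) integrable_on {x..y}" for x y
      using int[of "- y" "- x"] Henstock_Kurzweil_Integration.integrable_reflect_real[where f=\<phi> and a="- y" and b="- x"] by simp
    show "- F (- y) - - F (- x) = integral {x..y} (\<lambda>x. \<phi> (- x))" if "x \<le> y" for x y
      using F[of "- y" "- x"] that Henstock_Kurzweil_Integration.integral_reflect_real[where f=\<phi> and a="- y" and b="- x"] by simp
  qed
  then obtain N2 where N2: "negligible N2"
    "\<And>x. x \<notin> N2 \<Longrightarrow> ((\<lambda>h. (F (- x) - F (- x - h)) / h) \<longlongrightarrow> \<phi> (- x)) (at_right 0)"
    by (auto simp: add.commute)
  have neg: "negligible (N1 \<union> uminus ` N2)"
    using N1(1) N2(1) by (intro negligible_Un negligible_differentiable_image_negligible)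
      (auto simp: differentiable_on_def)
  have D: "(F has_real_derivative \<phi> x) (at x)" if x: "x \<notin> N1 \<union> uminus ` N2" for x
  proof -
    have "- x \<notin> N2" using x by force
    note L = N2(2)[OF this, simplified]
    have "((\<lambda>h. (F (x + - h) - F x) / - h) \<longlongrightarrow> \<phi> x) (at_right 0)"
      by (rule Lim_transform_eventually[OF L])
         (auto simp: eventually_at_right[of 0 1] field_simps intro!: exI[of _ 1])
    then have "((\<lambda>h. (F (x + h) - F x) / h) \<longlongrightarrow> \<phi> x) (at_left 0)"
      using filterlim_at_left_to_right[of "\<lambda>h. (F (x + h) - F x) / h" "nhds (\<phi> x)" 0] by simp
    with N1(2)[of x] x show ?thesis
      unfolding DERIV_def by (auto intro: filterlim_split_at_real)
  qed
  have "{x. \<not> (F has_real_derivative \<phi> x) (at x)} \<subseteq> N1 \<union> uminus ` N2" using D by blast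
  then show ?thesis
    by (intro AE_I[of _ _ "N1 \<union> uminus ` N2"]) (use neg in \<open>auto simp: negligible_iff_null_sets null_sets_def\<close>)
qed

lemma is_primitiveD:
  assumes "is_primitive a b \<phi> h" "a \<le> c" "c \<le> d" "d \<le> b"
  shows "set_integrable lebesgue {c..d} \<phi>" "h d - h c = (LINT x:{c..d}|lebesgue. \<phi> x)"
proof -
  show "set_integrable lebesgue {c..d} \<phi>"
    by (rule set_integrable_subset[of _ "{a..b}"]) (use assms in \<open>auto simp: is_primitive_def\<close>)
  show "h d - h c = (LINT x:{c..d}|lebesgue. \<phi> x)" using assms by (auto simp: is_primitive_def)
qed

lemma is_primitive_diff:
  assumes "is_primitive a b \<phi> h" "is_primitive a b \<psi> k"
  shows "is_primitive a b (\<lambda>x. \<phi> x - \<psi> x) (\<lambda>x. h x - k x)"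
  unfolding is_primitive_def
proof (intro conjI allI impI)
  show "set_integrable lebesgue {a..b} (\<lambda>x. \<phi> x - \<psi> x)"
    using assms by (intro set_integral_diff) (auto simp: is_primitive_def)
  fix c d assume "a \<le> c \<and> c \<le> d \<and> d \<le> b"
  then show "h d - k d - (h c - k c) = (LINT x:{c..d}|lebesgue. \<phi> x - \<psi> x)"
    using is_primitiveD[OF assms(1), of c d] is_primitiveD[OF assms(2), of c d]
    by (simp add: set_integral_diff)
qed

lemma is_primitive_cmult:
  assumes "is_primitive a b \<phi> h"
  shows "is_primitive a b (\<lambda>x. k * \<phi> x) (\<lambda>x. k * h x)"
  unfolding is_primitive_def
proof (intro conjI allI impI)
  show "set_integrable lebesgue {a..b} (\<lambda>x. k * \<phi> x)"
    using assms by (auto simp: is_primitive_def)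
  fix c d assume "a \<le> c \<and> c \<le> d \<and> d \<le> b"
  then show "k * h d - k * h c = (LINT x:{c..d}|lebesgue. k * \<phi> x)"
    using is_primitiveD[OF assms(1), of c d]
    by (simp add: right_diff_distrib[symmetric])
qed

text \<open>Measurability of \<psi> comes from the completeness of the measure.\<close>

lemma is_primitive_cong_AE:
  assumes h: "is_primitive a b \<phi> h" and ae: "AE x\<in>{a..b} in lebesgue. \<psi> x = \<phi> x"
  shows "is_primitive a b \<psi> h"
proof -
  have ae': "AE x in lebesgue. indicator {c..d} x *\<^sub>R \<phi> x = indicator {c..d} x *\<^sub>R \<psi> x"
    if "a \<le> c" "d \<le> b" for c d
    using ae by eventually_elim (use that in \<open>auto simp: indicator_def\<close>)
  have m: "(\<lambda>x. indicator {c..d} x *\<^sub>R \<phi> x) \<in> borel_measurable lebesgue"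
    if "a \<le> c" "d \<le> b" for c d
    using is_primitiveD(1)[OF h, of c d] that
    by (cases "c \<le> d") (auto simp: set_integrable_def)
  note m' = borel_measurable_AE[OF m ae']
  have int: "set_integrable lebesgue {a..b} \<psi>"
    using integrable_cong_AE[OF m m' ae', of a b] h by (auto simp: is_primitive_def set_integrable_def)
  have "(LINT x:{c..d}|lebesgue. \<phi> x) = (LINT x:{c..d}|lebesgue. \<psi> x)" if "a \<le> c" "d \<le> b" for c d
    using integral_cong_AE[OF m m' ae', of c d] that by (simp add: set_lebesgue_integral_def)
  then show ?thesis using int h by (auto simp: is_primitive_def)
qed

text \<open>Extending h by constants and \<phi> by zero outside [a, b] reduces this to the whole
  line. The endpoints, where h need not have a two-sided derivative, are discarded as null.\<close>

lemma is_primitive_AE_deriv: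
  assumes "is_primitive a b \<phi> h"
  shows "AE x\<in>{a..b} in lebesgue. (h has_real_derivative \<phi> x) (at x)"
proof (cases "a < b")
  case True
  define c where "c x = max a (min b x)" for x
  have c: "c x \<in> {a..b}" "c x \<le> c y" if "x \<le> y" for x y using True that by (auto simp: c_def)
  define \<phi>0 where "\<phi>0 x = indicator {a..b} x *\<^sub>R \<phi> x" for x
  have int0: "integrable lebesgue \<phi>0"
    using assms by (auto simp: is_primitive_def set_integrable_def \<phi>0_def[abs_def])
  have ai: "\<phi>0 absolutely_integrable_on {x..y}" for x y
    unfolding set_integrable_def using int0 by (intro integrable_mult_indicator) auto
  have "AE x in lebesgue. ((h \<circ> c) has_real_derivative \<phi>0 x) (at x)"
  proof (rule integral_has_derivative_ae)
    show "\<phi>0 integrable_on {x..y}" for x y using ai set_lebesgue_integral_eq_integral(1) by blast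
    fix x y :: real assume xy: "x \<le> y"
    have "(h \<circ> c) y - (h \<circ> c) x = (LINT u:{c x..c y}|lebesgue. \<phi> u)"
      using is_primitiveD(2)[OF assms, of "c x" "c y"] c[OF xy] c(1)[of y y] by auto
    also have "\<dots> = (LINT u:{x..y}|lebesgue. \<phi>0 u)"
    proof -
      \<comment> \<open>If [x, y] misses [a, b], then c x = c y is an endpoint and [c x, c y] is a
        point instead of the empty set; hence equality only almost everywhere.\<close>
      from AE_lebesgue_neq[of "c x"] AE_lebesgue_neq[of "c y"] have "AE u in lebesgue. indicator {c x..c y} u *\<^sub>R \<phi> u = indicator {x..y} u *\<^sub>R \<phi>0 u"
        by eventually_elim (use True xy in \<open>auto simp: c_def \<phi>0_def indicator_def max_def min_def split: if_splits\<close>)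
      moreover have "(\<lambda>u. indicator {c x..c y} u *\<^sub>R \<phi> u) \<in> borel_measurable lebesgue"
        using is_primitiveD(1)[OF assms, of "c x" "c y"] c[OF xy] c(1)[of y y] by (auto simp: set_integrable_def)
      ultimately show ?thesis
        unfolding set_lebesgue_integral_def
        using ai[of x y] by (intro integral_cong_AE) (auto simp: set_integrable_def)
    qed
    also have "\<dots> = integral {x..y} \<phi>0"
      by (rule set_lebesgue_integral_eq_integral(2)[OF ai])
    finally show "(h \<circ> c) y - (h \<circ> c) x = integral {x..y} \<phi>0" .
  qed
  moreover note AE_lebesgue_neq[of a] AE_lebesgue_neq[of b]
  ultimately show ?thesis
  proof eventually_elim
    case (elim x)
    show ?case
    proof
      assume "x \<in> {a..b}"
      with elim(2,3) have x: "x \<in> {a<..<b}" by auto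
      have "((h \<circ> c) has_real_derivative \<phi> x) (at x)"
        using elim(1) x by (simp add: \<phi>0_def)
      moreover have "(h \<circ> c) y = h y" if "y \<in> {a<..<b}" for y
        using that by (simp add: c_def)
      ultimately show "(h has_real_derivative \<phi> x) (at x)"
        by (rule has_field_derivative_transform_within_open[OF _ open_greaterThanLessThan x])
    qed
  qed
next
  case False
  from AE_lebesgue_neq[of a] show ?thesis
    by eventually_elim (use False in auto)
qed

text \<open>This allows \<open>deriv\<close> to serve as the density, whatever it returns on the
  null set of points without a derivative.\<close>

lemma is_primitive_deriv:
  assumes "is_primitive a b \<phi> h"
  shows "is_primitive a b (deriv h) h"
proof -
  have "AE x\<in>{a..b} in lebesgue. deriv h x = \<phi> x"
    using is_primitive_AE_deriv[OF assms] by eventually_elim (auto dest: DERIV_imp_deriv)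
  then show ?thesis by (rule is_primitive_cong_AE[OF assms])
qed

section \<open>Absolutely continuous functions\<close>

text \<open>Truncate the same partition at l from above and from below. A cell straddling l is split
  through h l by the triangle inequality; on every other cell one of the two truncated increments is
  zero.\<close>

lemma variation_sums_split:
  fixes h :: "real \<Rightarrow> real"
  assumes "v \<in> variation_sums h A"
  obtains v1 v2 where "v1 \<in> variation_sums h (insert l (A \<inter> {..l}))"
    "v2 \<in> variation_sums h (insert l (A \<inter> {l..}))" "v \<le> v1 + v2"
proof -
  obtain n x where v: "v = (\<Sum>i<n. \<bar>h (x (Suc i)) - h (x i)\<bar>)"
    and x: "mono_on {..n::nat} x" "x ` {..n} \<subseteq> A"
    using assms unfolding variation_sums_def by auto
  let ?y = "\<lambda>i. min (x i) l" and ?z = "\<lambda>i. max (x i) l"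
  show thesis
  proof (rule that)
    show "(\<Sum>i<n. \<bar>h (?y (Suc i)) - h (?y i)\<bar>) \<in> variation_sums h (insert l (A \<inter> {..l}))"
      unfolding variation_sums_def mem_Collect_eq using x
      by (intro exI[of _ n] exI[of _ ?y] conjI refl)
         (auto simp: mono_on_def min_def image_subset_iff intro: order_trans)
    show "(\<Sum>i<n. \<bar>h (?z (Suc i)) - h (?z i)\<bar>) \<in> variation_sums h (insert l (A \<inter> {l..}))"
      unfolding variation_sums_def mem_Collect_eq using x
      by (intro exI[of _ n] exI[of _ ?z] conjI refl)
         (auto simp: mono_on_def max_def image_subset_iff intro: order_trans)
    have "x i \<le> x (Suc i)" if "i < n" for i using x(1) that by (auto simp: mono_on_def)
    then show "v \<le> (\<Sum>i<n. \<bar>h (?y (Suc i)) - h (?y i)\<bar>) + (\<Sum>i<n. \<bar>h (?z (Suc i)) - h (?z i)\<bar>)"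
      unfolding v sum.distrib[symmetric]
      by (intro sum_mono) (fastforce simp: min_def max_def)
  qed
qed

lemma bdd_above_variation_sums_subset:
  assumes "bdd_above (variation_sums h B)" "A \<subseteq> B"
  shows "bdd_above (variation_sums h A)"
  using assms variation_sums_mono by (meson bdd_above_mono)

text \<open>Together with \<open>variation_step\<close> this confines the increment of the variation
  function between 0 and the variation on the cell.\<close>

lemma variation_Iic_le:
  assumes bdd: "bdd_above (variation_sums h UNIV)" and "l \<le> u"
  shows "variation h {..u} \<le> variation h {..l} + variation h {l..u}"
  unfolding variation_def[of _ "{..u}"]
proof (rule cSup_least)
  show "variation_sums h {..u} \<noteq> {}" using variation_sums_nonempty[of u "{..u}" h] by auto
  fix v assume "v \<in> variation_sums h {..u}"
  then obtain v1 v2 where v: "v1 \<in> variation_sums h (insert l ({..u} \<inter> {..l}))"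
    "v2 \<in> variation_sums h (insert l ({..u} \<inter> {l..}))" "v \<le> v1 + v2"
    by (rule variation_sums_split)
  have "insert l ({..u} \<inter> {..l}) = {..l}" "insert l ({..u} \<inter> {l..}) = {l..u}"
    using \<open>l \<le> u\<close> by auto
  with v have "v1 \<le> variation h {..l}" "v2 \<le> variation h {l..u}"
    unfolding variation_def by (auto intro!: cSup_upper bdd_above_variation_sums_subset[OF bdd])
  with v(3) show "v \<le> variation h {..l} + variation h {l..u}" by linarith
qed

text \<open>General finite index sets serve two later families: the pairs of an interval and a
  subcell, and the grid cells that meet a compact set.\<close>

lemma abs_continuous_onD:
  assumes "abs_continuous_on A h" "0 < e"
  obtains d where "0 < d" "\<And>(K :: 'k set) l u. finite K \<Longrightarrow> (\<And>i. i \<in> K \<Longrightarrow> l i \<le> u i \<and> {l i..u i} \<subseteq> A) \<Longrightarrow>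
    disjoint_family_on (\<lambda>i. {l i<..<u i}) K \<Longrightarrow> (\<Sum>i\<in>K. u i - l i) < d \<Longrightarrow> (\<Sum>i\<in>K. \<bar>h (u i) - h (l i)\<bar>) < e"
proof -
  obtain d where d: "0 < d" and ac: "\<And>(n::nat) l u. (\<forall>i<n. l i \<le> u i \<and> {l i..u i} \<subseteq> A) \<Longrightarrow>
      disjoint_family_on (\<lambda>i. {l i<..<u i}) {..<n} \<Longrightarrow> (\<Sum>i<n. u i - l i) < d \<Longrightarrow>
      (\<Sum>i<n. \<bar>h (u i) - h (l i)\<bar>) < e"
    using assms unfolding abs_continuous_on_def by meson
  show thesis
  proof (rule that[OF d])
    fix K :: "'k set" and l u
    assume K: "finite K" and lu: "\<And>i. i \<in> K \<Longrightarrow> l i \<le> u i \<and> {l i..u i} \<subseteq> A"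
      and dis: "disjoint_family_on (\<lambda>i. {l i<..<u i}) K" and less: "(\<Sum>i\<in>K. u i - l i) < d"
    obtain p where p: "bij_betw p {..<card K} K"
      using ex_bij_betw_nat_finite[OF K] by (auto simp: atLeast0LessThan)
    have re: "(\<Sum>i\<in>K. F i) = (\<Sum>j<card K. F (p j))" for F :: "'k \<Rightarrow> real"
      by (rule sum.reindex_bij_betw[OF p, symmetric])
    have "p j \<in> K" if "j < card K" for j using p that by (auto simp: bij_betw_def)
    moreover have "p i \<noteq> p j" if "i < card K" "j < card K" "i \<noteq> j" for i j
      using p that by (auto simp: bij_betw_def inj_on_def)
    ultimately show "(\<Sum>i\<in>K. \<bar>h (u i) - h (l i)\<bar>) < e"
      unfolding re using lu less dis unfolding re disjoint_family_on_def
      by (intro ac) (auto simp: disjoint_family_on_def)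
  qed
qed

lemma mono_sequence_disjoint:
  fixes x :: "nat \<Rightarrow> real"
  assumes "mono_on {..n} x"
  shows "disjoint_family_on (\<lambda>i. {x i<..<x (Suc i)}) {..<n}"
proof -
  have "{x i<..<x (Suc i)} \<inter> {x j<..<x (Suc j)} = {}" if "i < j" "j < n" for i j
  proof -
    have "x (Suc i) \<le> x j" using assms that by (auto simp: mono_on_def)
    then show ?thesis by auto
  qed
  then show ?thesis
    unfolding disjoint_family_on_def by (metis Int_commute lessThan_iff nat_neq_iff)
qed

text \<open>With the \<delta> belonging to \<epsilon> = 1, every partition of an interval shorter
  than \<delta> has variation sum below 1, and finitely many such intervals cover [a, b].\<close>

lemma abs_continuous_bounded_variation:
  assumes ac: "abs_continuous_on {a..b} h"
  shows "bdd_above (variation_sums h {a..b})"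
proof -
  obtain d where d: "0 < d" and D: "\<And>(K :: nat set) l u. finite K \<Longrightarrow> (\<And>i. i \<in> K \<Longrightarrow> l i \<le> u i \<and> {l i..u i} \<subseteq> {a..b}) \<Longrightarrow>
    disjoint_family_on (\<lambda>i. {l i<..<u i}) K \<Longrightarrow> (\<Sum>i\<in>K. u i - l i) < d \<Longrightarrow> (\<Sum>i\<in>K. \<bar>h (u i) - h (l i)\<bar>) < 1"
    by (rule abs_continuous_onD[OF ac zero_less_one]) blast
  have small: "bdd_above (variation_sums h {p..q})" if "{p..q} \<subseteq> {a..b}" "q - p < d" for p q
  proof (rule bdd_aboveI)
    fix v assume "v \<in> variation_sums h {p..q}"
    then obtain n x where v: "v = (\<Sum>i<n. \<bar>h (x (Suc i)) - h (x i)\<bar>)"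
      and x: "mono_on {..n::nat} x" "x ` {..n} \<subseteq> {p..q}"
      unfolding variation_sums_def by auto
    have xi: "x i \<in> {p..q}" if "i \<le> n" for i using x(2) that by auto
    have "(\<Sum>i<n. x (Suc i) - x i) = x n - x 0" by (rule sum_lessThan_telescope)
    also have "\<dots> < d" using xi[of n] xi[of 0] that by auto
    finally have less: "(\<Sum>i<n. x (Suc i) - x i) < d" .
    have "v < 1"
      unfolding v
    proof (rule D[OF _ _ mono_sequence_disjoint[OF x(1)] less])
      fix i assume i: "i \<in> {..<n}"
      then have "x i \<le> x (Suc i)" using x(1) by (auto simp: mono_on_def)
      then show "x i \<le> x (Suc i) \<and> {x i..x (Suc i)} \<subseteq> {a..b}"
        using xi[of i] xi[of "Suc i"] i that by auto
    qed simp
    then show "v \<le> 1" by simp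
  qed
  \<comment> \<open>The right end advances by at most d / 2 < d in each step and is cut off at b, so
    \<open>small\<close> applies to every new piece.\<close>
  have "bdd_above (variation_sums h {a..min b (a + real k * (d / 2))})" for k
  proof (induction k)
    case 0
    then show ?case using small[of a "min b a"] d by auto
  next
    case (Suc k)
    let ?p = "\<lambda>k. min b (a + real k * (d / 2))"
    have "?p (Suc k) - ?p k < d" using d by (auto simp: field_simps min_def)
    moreover have "?p k \<le> ?p (Suc k)" using d by (auto simp: field_simps min_def)
    ultimately show ?case
    proof (cases "a \<le> b")
      case True
      have pk: "a \<le> ?p k" "?p k \<le> ?p (Suc k)" using d True by (auto simp: field_simps min_def)
      obtain B1 where B1: "\<And>v. v \<in> variation_sums h {a..?p k} \<Longrightarrow> v \<le> B1"
        using Suc unfolding bdd_above_def by auto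
      have "bdd_above (variation_sums h {?p k..?p (Suc k)})"
        using True pk \<open>?p (Suc k) - ?p k < d\<close> by (intro small) auto
      then obtain B2 where B2: "\<And>v. v \<in> variation_sums h {?p k..?p (Suc k)} \<Longrightarrow> v \<le> B2"
        unfolding bdd_above_def by auto
      show ?thesis
      proof (rule bdd_aboveI)
        fix v assume "v \<in> variation_sums h {a..?p (Suc k)}"
        then obtain v1 v2 where v: "v1 \<in> variation_sums h (insert (?p k) ({a..?p (Suc k)} \<inter> {..?p k}))"
          "v2 \<in> variation_sums h (insert (?p k) ({a..?p (Suc k)} \<inter> {?p k..}))" "v \<le> v1 + v2"
          by (rule variation_sums_split)
        have "insert (?p k) ({a..?p (Suc k)} \<inter> {..?p k}) = {a..?p k}"
          "insert (?p k) ({a..?p (Suc k)} \<inter> {?p k..}) = {?p k..?p (Suc k)}"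
          using pk by auto
        with v B1 B2 show "v \<le> B1 + B2" by (metis add_mono order_trans)
      qed
    next
      case False
      then have "{a..?p (Suc k)} \<subseteq> {a..?p k}" by auto
      with Suc show ?thesis by (rule bdd_above_variation_sums_subset)
    qed
  qed
  moreover obtain k :: nat where "(b - a) / (d / 2) < real k" using reals_Archimedean2 by blast
  then have "min b (a + real k * (d / 2)) = b" using d by (simp add: field_simps min_def)
  ultimately show ?thesis by metis
qed

text \<open>Choosing a nearly maximal element in every S i at once turns a bound for all selections
  into a bound for the sum of the suprema. The 1 in the denominator of \<eta> covers empty
  K.\<close>

lemma sum_cSup_le:
  fixes S :: "'k \<Rightarrow> real set"
  assumes "finite K" "\<And>i. i \<in> K \<Longrightarrow> S i \<noteq> {} \<and> bdd_above (S i)"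
    and le: "\<And>s. (\<And>i. i \<in> K \<Longrightarrow> s i \<in> S i) \<Longrightarrow> (\<Sum>i\<in>K. s i) \<le> B"
  shows "(\<Sum>i\<in>K. Sup (S i)) \<le> B"
proof (rule field_le_epsilon)
  fix e :: real assume e: "0 < e"
  define \<eta> where "\<eta> = e / (real (card K) + 1)"
  have \<eta>: "0 < \<eta>" using e by (simp add: \<eta>_def)
  have "\<exists>s\<in>S i. Sup (S i) - \<eta> < s" if "i \<in> K" for i
    using assms(2)[OF that] \<eta> less_cSup_iff[of "S i" "Sup (S i) - \<eta>"] by simp
  then obtain s where s: "\<And>i. i \<in> K \<Longrightarrow> s i \<in> S i" "\<And>i. i \<in> K \<Longrightarrow> Sup (S i) - \<eta> < s i" by metis
  have "(\<Sum>i\<in>K. Sup (S i)) \<le> (\<Sum>i\<in>K. s i + \<eta>)"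
    using s(2) by (intro sum_mono) (simp add: less_imp_le diff_less_eq)
  also have "\<dots> = (\<Sum>i\<in>K. s i) + real (card K) * \<eta>" by (simp add: sum.distrib)
  finally have "(\<Sum>i\<in>K. Sup (S i)) \<le> (\<Sum>i\<in>K. s i) + real (card K) * \<eta>" .
  moreover have "real (card K) * \<eta> \<le> e" using e by (simp add: \<eta>_def field_simps)
  moreover have "(\<Sum>i\<in>K. s i) \<le> B" by (rule le[OF s(1)])
  ultimately show "(\<Sum>i\<in>K. Sup (S i)) \<le> B + e" by linarith
qed

text \<open>Replace each interval of a short disjoint family by the cells of a partition of it. The
  refined family is still disjoint and not longer in total, so absolute continuity of h bounds its
  increments; then take suprema over the partitions. The bound e / 2 is used because a supremum
  preserves only the weak inequality.\<close>

lemma abs_continuous_variation: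
  assumes ac: "abs_continuous_on UNIV h" and bdd: "bdd_above (variation_sums h UNIV)"
  shows "abs_continuous_on UNIV (\<lambda>x. variation h {..x})"
  unfolding abs_continuous_on_def
proof (intro allI impI)
  fix e :: real assume e: "0 < e"
  then have e2: "0 < e / 2" by simp
  obtain d where d: "0 < d" and D: "\<And>(K :: (nat \<times> nat) set) l u. finite K \<Longrightarrow> (\<And>i. i \<in> K \<Longrightarrow> l i \<le> u i \<and> {l i..u i} \<subseteq> UNIV) \<Longrightarrow>
    disjoint_family_on (\<lambda>i. {l i<..<u i}) K \<Longrightarrow> (\<Sum>i\<in>K. u i - l i) < d \<Longrightarrow> (\<Sum>i\<in>K. \<bar>h (u i) - h (l i)\<bar>) < e / 2"
    by (rule abs_continuous_onD[OF ac e2]) blast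
  show "\<exists>d>0. \<forall>(n::nat) l u. (\<forall>i<n. l i \<le> u i \<and> {l i..u i} \<subseteq> UNIV) \<and>
      disjoint_family_on (\<lambda>i. {l i<..<u i}) {..<n} \<and> (\<Sum>i<n. u i - l i) < d \<longrightarrow>
      (\<Sum>i<n. \<bar>variation h {..u i} - variation h {..l i}\<bar>) < e"
  proof (intro exI[of _ d] conjI d allI impI, elim conjE)
    fix n :: nat and l u :: "nat \<Rightarrow> real"
    assume lu: "\<forall>i<n. l i \<le> u i \<and> {l i..u i} \<subseteq> UNIV" and dis: "disjoint_family_on (\<lambda>i. {l i<..<u i}) {..<n}"
      and less: "(\<Sum>i<n. u i - l i) < d"
    have "(\<Sum>i<n. \<bar>variation h {..u i} - variation h {..l i}\<bar>) \<le> (\<Sum>i<n. Sup (variation_sums h {l i..u i}))"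
    proof (rule sum_mono)
      fix i assume "i \<in> {..<n}"
      then have i: "l i \<le> u i" using lu by auto
      show "\<bar>variation h {..u i} - variation h {..l i}\<bar> \<le> Sup (variation_sums h {l i..u i})"
        using variation_step[OF bdd i] variation_Iic_le[OF bdd i] by (auto simp: variation_def)
    qed
    also have "\<dots> \<le> e / 2"
    proof (rule sum_cSup_le)
      show "variation_sums h {l i..u i} \<noteq> {} \<and> bdd_above (variation_sums h {l i..u i})" if "i \<in> {..<n}" for i
        using that lu variation_sums_nonempty[of "l i" "{l i..u i}" h] bdd_above_variation_sums_subset[OF bdd]
        by auto
      fix s assume s: "\<And>i. i \<in> {..<n} \<Longrightarrow> s i \<in> variation_sums h {l i..u i}"
      define Q where "Q i m x \<longleftrightarrow> s i = (\<Sum>k<m. \<bar>h (x (Suc k)) - h (x k)\<bar>) \<and>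
          mono_on {..m::nat} x \<and> x ` {..m} \<subseteq> {l i..u i}" for i m x
      have "\<exists>m x. Q i m x" if "i < n" for i
        using s[of i] that unfolding variation_sums_def Q_def by auto
      then obtain m x where "\<And>i. i < n \<Longrightarrow> Q i (m i) (x i)" by metis
      then have mx: "\<And>i. i < n \<Longrightarrow> s i = (\<Sum>k<m i. \<bar>h (x i (Suc k)) - h (x i k)\<bar>)"
        "\<And>i. i < n \<Longrightarrow> mono_on {..m i} (x i)" "\<And>i. i < n \<Longrightarrow> x i ` {..m i} \<subseteq> {l i..u i}"
        unfolding Q_def by blast+
      have xi: "l i \<le> x i k" "x i k \<le> u i" if "i < n" "k \<le> m i" for i k using mx(3)[OF that(1)] that(2) by (auto simp: image_subset_iff)
      \<comment> \<open>The pair (i, k) stands for the k-th cell in the partition of the i-th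
        interval.\<close>
      let ?K = "SIGMA i:{..<n}. {..<m i}"
      have S: "(\<Sum>i<n. \<Sum>k<m i. F i k) = (\<Sum>q\<in>?K. F (fst q) (snd q))" for F :: "nat \<Rightarrow> nat \<Rightarrow> real"
        by (subst sum.Sigma) (auto simp: split_beta)
      have "(\<Sum>i<n. s i) = (\<Sum>i<n. \<Sum>k<m i. \<bar>h (x i (Suc k)) - h (x i k)\<bar>)"
        using mx(1) by (intro sum.cong) auto
      also have "\<dots> = (\<Sum>q\<in>?K. \<bar>h (x (fst q) (Suc (snd q))) - h (x (fst q) (snd q))\<bar>)"
        by (rule S)
      also have "\<dots> < e / 2"
      proof (rule D)
        fix q assume "q \<in> ?K"
        then show "x (fst q) (snd q) \<le> x (fst q) (Suc (snd q)) \<and> {x (fst q) (snd q)..x (fst q) (Suc (snd q))} \<subseteq> UNIV"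
          using mx(2)[of "fst q"] by (auto simp: mono_on_def)
      next
        show "disjoint_family_on (\<lambda>q. {x (fst q) (snd q)<..<x (fst q) (Suc (snd q))}) ?K"
          unfolding disjoint_family_on_def
        proof (intro ballI impI)
          fix q r assume q: "q \<in> ?K" and r: "r \<in> ?K" and "q \<noteq> r"
          show "{x (fst q) (snd q)<..<x (fst q) (Suc (snd q))} \<inter> {x (fst r) (snd r)<..<x (fst r) (Suc (snd r))} = {}"
          proof (cases "fst q = fst r")
            case True
            then have "snd q \<noteq> snd r" using \<open>q \<noteq> r\<close> by (auto simp: prod_eq_iff)
            then show ?thesis
              using mono_sequence_disjoint[OF mx(2)[of "fst q"]] q r True by (fastforce simp: disjoint_family_on_def)
          next
            case False
            have "{x (fst q) (snd q)<..<x (fst q) (Suc (snd q))} \<subseteq> {l (fst q)<..<u (fst q)}" if "q \<in> ?K" for q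
              using xi[of "fst q" "snd q"] xi[of "fst q" "Suc (snd q)"] that by fastforce
            from this[OF q] this[OF r] show ?thesis
              using dis False q r unfolding disjoint_family_on_def by fastforce
          qed
        qed
        have "(\<Sum>q\<in>?K. x (fst q) (Suc (snd q)) - x (fst q) (snd q)) = (\<Sum>i<n. x i (m i) - x i 0)"
          by (subst S[symmetric]) (simp add: sum_lessThan_telescope)
        also have "\<dots> \<le> (\<Sum>i<n. u i - l i)"
          using xi by (intro sum_mono diff_mono) auto
        finally show "(\<Sum>q\<in>?K. x (fst q) (Suc (snd q)) - x (fst q) (snd q)) < d" using less by simp
      qed auto
      finally show "(\<Sum>i<n. s i) \<le> e / 2" by simp
    qed simp
    finally show "(\<Sum>i<n. \<bar>variation h {..u i} - variation h {..l i}\<bar>) < e" using e by simp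
  qed
qed

text \<open>Clamping is monotone and does not lengthen intervals, so a short disjoint family remains
  one.\<close>

lemma abs_continuous_on_clamp:
  assumes ac: "abs_continuous_on {a..b} h" and ab: "a \<le> b"
  shows "abs_continuous_on UNIV (\<lambda>x. h (max a (min b x)))"
  unfolding abs_continuous_on_def
proof (intro allI impI)
  fix e :: real assume e: "0 < e"
  let ?c = "\<lambda>x. max a (min b x)"
  obtain d where d: "0 < d" and D: "\<And>(K :: nat set) l u. finite K \<Longrightarrow> (\<And>i. i \<in> K \<Longrightarrow> l i \<le> u i \<and> {l i..u i} \<subseteq> {a..b}) \<Longrightarrow>
    disjoint_family_on (\<lambda>i. {l i<..<u i}) K \<Longrightarrow> (\<Sum>i\<in>K. u i - l i) < d \<Longrightarrow> (\<Sum>i\<in>K. \<bar>h (u i) - h (l i)\<bar>) < e"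
    by (rule abs_continuous_onD[OF ac e]) blast
  show "\<exists>d>0. \<forall>(n::nat) l u. (\<forall>i<n. l i \<le> u i \<and> {l i..u i} \<subseteq> UNIV) \<and>
      disjoint_family_on (\<lambda>i. {l i<..<u i}) {..<n} \<and> (\<Sum>i<n. u i - l i) < d \<longrightarrow>
      (\<Sum>i<n. \<bar>h (?c (u i)) - h (?c (l i))\<bar>) < e"
  proof (intro exI[of _ d] conjI d allI impI, elim conjE)
    fix n :: nat and l u :: "nat \<Rightarrow> real"
    assume lu: "\<forall>i<n. l i \<le> u i \<and> {l i..u i} \<subseteq> UNIV" and dis: "disjoint_family_on (\<lambda>i. {l i<..<u i}) {..<n}"
      and less: "(\<Sum>i<n. u i - l i) < d"
    show "(\<Sum>i<n. \<bar>h (?c (u i)) - h (?c (l i))\<bar>) < e"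
    proof (rule D)
      show "?c (l i) \<le> ?c (u i) \<and> {?c (l i)..?c (u i)} \<subseteq> {a..b}" if "i \<in> {..<n}" for i
        using lu that ab by fastforce
      have "{?c (l i)<..<?c (u i)} \<subseteq> {l i<..<u i}" for i
        using ab by (auto simp: max_def min_def split: if_splits)
      then show "disjoint_family_on (\<lambda>i. {?c (l i)<..<?c (u i)}) {..<n}"
        using dis unfolding disjoint_family_on_def by blast
      have "(\<Sum>i<n. ?c (u i) - ?c (l i)) \<le> (\<Sum>i<n. u i - l i)"
        using lu ab by (intro sum_mono) (auto simp: max_def min_def)
      then show "(\<Sum>i<n. ?c (u i) - ?c (l i)) < d" using less by simp
    qed simp
  qed
qed

lemma abs_continuous_on_diff:
  assumes "abs_continuous_on A h" "abs_continuous_on A k"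
  shows "abs_continuous_on A (\<lambda>x. h x - k x)"
  unfolding abs_continuous_on_def
proof (intro allI impI)
  fix e :: real assume "0 < e"
  then have e2: "0 < e / 2" by simp
  obtain d1 where d1: "0 < d1" and D1: "\<And>(K :: nat set) l u. finite K \<Longrightarrow> (\<And>i. i \<in> K \<Longrightarrow> l i \<le> u i \<and> {l i..u i} \<subseteq> A) \<Longrightarrow>
    disjoint_family_on (\<lambda>i. {l i<..<u i}) K \<Longrightarrow> (\<Sum>i\<in>K. u i - l i) < d1 \<Longrightarrow> (\<Sum>i\<in>K. \<bar>h (u i) - h (l i)\<bar>) < e / 2"
    by (rule abs_continuous_onD[OF assms(1) e2]) blast
  obtain d2 where d2: "0 < d2" and D2: "\<And>(K :: nat set) l u. finite K \<Longrightarrow> (\<And>i. i \<in> K \<Longrightarrow> l i \<le> u i \<and> {l i..u i} \<subseteq> A) \<Longrightarrow>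
    disjoint_family_on (\<lambda>i. {l i<..<u i}) K \<Longrightarrow> (\<Sum>i\<in>K. u i - l i) < d2 \<Longrightarrow> (\<Sum>i\<in>K. \<bar>k (u i) - k (l i)\<bar>) < e / 2"
    by (rule abs_continuous_onD[OF assms(2) e2]) blast
  show "\<exists>d>0. \<forall>(n::nat) l u. (\<forall>i<n. l i \<le> u i \<and> {l i..u i} \<subseteq> A) \<and>
      disjoint_family_on (\<lambda>i. {l i<..<u i}) {..<n} \<and> (\<Sum>i<n. u i - l i) < d \<longrightarrow>
      (\<Sum>i<n. \<bar>(h (u i) - k (u i)) - (h (l i) - k (l i))\<bar>) < e"
  proof (intro exI[of _ "min d1 d2"] conjI allI impI, use d1 d2 in simp, elim conjE)
    fix n :: nat and l u :: "nat \<Rightarrow> real"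
    assume lu: "\<forall>i<n. l i \<le> u i \<and> {l i..u i} \<subseteq> A" "disjoint_family_on (\<lambda>i. {l i<..<u i}) {..<n}"
      "(\<Sum>i<n. u i - l i) < min d1 d2"
    have "(\<Sum>i<n. \<bar>(h (u i) - k (u i)) - (h (l i) - k (l i))\<bar>)
        \<le> (\<Sum>i<n. \<bar>h (u i) - h (l i)\<bar> + \<bar>k (u i) - k (l i)\<bar>)"
      by (intro sum_mono) auto
    also have "\<dots> < e / 2 + e / 2"
      unfolding sum.distrib using lu by (intro add_strict_mono D1 D2) auto
    finally show "(\<Sum>i<n. \<bar>(h (u i) - k (u i)) - (h (l i) - k (l i))\<bar>) < e" by simp
  qed
qed

lemma abs_continuous_on_imp_continuous:
  assumes ac: "abs_continuous_on UNIV h"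
  shows "isCont h x"
  unfolding continuous_at_eps_delta
proof (intro allI impI)
  fix e :: real assume e: "0 < e"
  obtain d where d: "0 < d" and D: "\<And>(K :: unit set) l u. finite K \<Longrightarrow> (\<And>i. i \<in> K \<Longrightarrow> l i \<le> u i \<and> {l i..u i} \<subseteq> UNIV) \<Longrightarrow>
    disjoint_family_on (\<lambda>i. {l i<..<u i}) K \<Longrightarrow> (\<Sum>i\<in>K. u i - l i) < d \<Longrightarrow> (\<Sum>i\<in>K. \<bar>h (u i) - h (l i)\<bar>) < e"
    by (rule abs_continuous_onD[OF ac e]) blast
  have "dist (h y) (h x) < e" if "dist y x < d" for y
    using D[of "{()}" "\<lambda>_. min x y" "\<lambda>_. max x y"] that
    by (cases "x \<le> y") (auto simp: disjoint_family_on_def dist_real_def abs_minus_commute)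
  with d show "\<exists>d>0. \<forall>y. dist y x < d \<longrightarrow> dist (h y) (h x) < e" by blast
qed

section \<open>Densities of absolutely continuous functions\<close>

lemma Ioc_subset_UN_Ioc: "{p 0<..p k} \<subseteq> (\<Union>j<k. {p j<..p (Suc j)})" for p :: "nat \<Rightarrow> 'a :: linorder"
proof (induction k)
  case (Suc k)
  have "{p 0<..p (Suc k)} \<subseteq> {p 0<..p k} \<union> {p k<..p (Suc k)}" by auto
  then show ?case using Suc by (auto simp: lessThan_Suc)
qed simp

lemma disjoint_family_Ioc:
  fixes p :: "nat \<Rightarrow> 'a :: linorder"
  assumes "mono p"
  shows "disjoint_family (\<lambda>j. {p j<..p (Suc j)})"
proof -
  have "{p i<..p (Suc i)} \<inter> {p j<..p (Suc j)} = {}" if "i < j" for i j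
    using monoD[OF assms, of "Suc i" j] that by auto
  then show ?thesis unfolding disjoint_family_on_def by (metis Int_commute nat_neq_iff)
qed

text \<open>The density exists once the Stieltjes measure of F vanishes on Lebesgue null sets.
  Absolute continuity speaks of finitely many intervals, while covering a null set may take
  infinitely many. Inner regularity of the finite measure reduces the claim to compact null sets,
  where finite coverings suffice.\<close>

lemma abs_continuous_primitive_mono:
  assumes F: "mono F" "\<And>x. \<bar>F x\<bar> \<le> B" and ac: "abs_continuous_on UNIV F"
  shows "\<exists>\<phi>. \<forall>a b. is_primitive a b \<phi> F"
proof -
  have bb: "bdd_below (range F)" using F(2) by (intro bdd_belowI[of _ "- B"]) (auto simp: abs_le_iff minus_le_iff)
  have rl: "right_lim F = F"
  proof
    fix x
    have "(F \<longlongrightarrow> F x) (at_right x)"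
      using abs_continuous_on_imp_continuous[OF ac, of x] by (auto simp: isCont_def intro: filterlim_mono at_le)
    then show "right_lim F x = F x" unfolding right_lim_def by (intro tendsto_Lim) auto
  qed
  define \<mu> where "\<mu> = interval_measure F"
  have dF: "F x - F y \<le> 2 * B" for x y using F(2)[of x] F(2)[of y] by auto
  interpret \<mu>: finite_measure \<mu>
    using finite_interval_measure_right_lim(1)[OF F(1) bb dF] by (simp add: rl \<mu>_def)
  have m: "measure \<mu> {x<..y} = F y - F x" if "x \<le> y" for x y
    using finite_interval_measure_right_lim(2)[OF F(1) bb dF that] by (simp add: rl \<mu>_def)
  have sets\<mu>[simp, measurable_cong]: "sets \<mu> = sets borel" and sp[simp]: "space \<mu> = UNIV"
    by (simp_all add: \<mu>_def)
  txt \<open>A fine grid turns an open neighbourhood of a compact null set into finitely many disjoint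
    intervals of small total length, to which absolute continuity applies.\<close>
  have small: "measure \<mu> K \<le> e" if K: "compact K" "emeasure lborel K = 0" and e: "0 < e" for K e
  proof -
    obtain d where d: "0 < d" and D: "\<And>(K :: nat set) l u. finite K \<Longrightarrow> (\<And>i. i \<in> K \<Longrightarrow> l i \<le> u i \<and> {l i..u i} \<subseteq> UNIV) \<Longrightarrow>
      disjoint_family_on (\<lambda>i. {l i<..<u i}) K \<Longrightarrow> (\<Sum>i\<in>K. u i - l i) < d \<Longrightarrow> (\<Sum>i\<in>K. \<bar>F (u i) - F (l i)\<bar>) < e"
      by (rule abs_continuous_onD[OF ac e]) blast
    have Kb: "K \<in> sets borel" using K(1) by (simp add: borel_compact)
    obtain U where U: "open U" "K \<subseteq> U" "emeasure lborel (U - K) < d"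
      using outer_regular_lborel[OF Kb d] by blast
    have "emeasure lborel U \<le> emeasure lborel (U - K) + emeasure lborel K"
      using U Kb by (intro order_trans[OF _ emeasure_subadditive] emeasure_mono) auto
    then have U': "emeasure lborel U < d" using U(3) K(2) by auto
    obtain r where r: "r > 0" "(\<Union>x\<in>K. ball x r) \<subseteq> U"
      using compact_subset_open_imp_ball_epsilon_subset[OF K(1) U(1,2)] by blast
    obtain N where N: "\<And>x. x \<in> K \<Longrightarrow> \<bar>x\<bar> < N" "0 < N"
      using compact_imp_bounded[OF K(1)] unfolding bounded_pos_less by auto
    obtain n :: nat where n: "2 * N / r < real n" using reals_Archimedean2 by blast
    then have n0: "0 < real n" using N(2) r(1) by (meson divide_pos_pos less_trans zero_less_mult_iff zero_less_numeral)
    \<comment> \<open>As n > 2 N / r, the cell width w is smaller than r: a grid cell that meets K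
      stays within distance r of a point of K, hence in U.\<close>
    define w where "w = 2 * N / real n"
    have w: "0 < w" "w < r" using n n0 N(2) r(1) by (auto simp: w_def field_simps)
    define p where "p j = - N + real j * w" for j :: nat
    have pS: "p (Suc j) = p j + w" for j by (simp add: p_def algebra_simps)
    have pmono: "mono p" using w(1) by (auto simp: p_def mono_def)
    have pn: "p 0 = - N" "p n = N" using n0 by (auto simp: p_def w_def)
    define J where "J = {j. j < n \<and> {p j<..p (Suc j)} \<inter> K \<noteq> {}}"
    have J: "finite J" by (simp add: J_def)
    have dis: "disjoint_family_on (\<lambda>j. {p j<..p (Suc j)}) J"
      using disjoint_family_Ioc[OF pmono] by (rule disjoint_family_on_mono[rotated]) simp
    have "K \<subseteq> {p 0<..p n}" using N(1) by (force simp: pn abs_less_iff)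
    then have KJ: "K \<subseteq> (\<Union>j\<in>J. {p j<..p (Suc j)})" using Ioc_subset_UN_Ioc[of p n] by (fastforce simp: J_def)
    have JU: "(\<Union>j\<in>J. {p j<..p (Suc j)}) \<subseteq> U"
    proof (intro UN_least subsetI)
      fix j x assume "j \<in> J" and x: "x \<in> {p j<..p (Suc j)}"
      then obtain y where "y \<in> K" "y \<in> {p j<..p (Suc j)}" unfolding J_def by blast
      then have "x \<in> ball y r" using x w by (auto simp: dist_real_def pS)
      then show "x \<in> U" using r(2) \<open>y \<in> K\<close> by blast
    qed
    have "ennreal (\<Sum>j\<in>J. p (Suc j) - p j) = (\<Sum>j\<in>J. emeasure lborel {p j<..p (Suc j)})"
      using w(1) by (subst sum_ennreal[symmetric]) (auto simp: pS)
    also have "\<dots> = emeasure lborel (\<Union>j\<in>J. {p j<..p (Suc j)})"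
      by (rule sum_emeasure[OF _ dis J]) auto
    also have "\<dots> \<le> emeasure lborel U" using JU U(1) by (intro emeasure_mono) auto
    finally have len: "(\<Sum>j\<in>J. p (Suc j) - p j) < d"
      using U' d by (metis ennreal_less_iff le_less_trans less_imp_le linorder_not_less ennreal_leI)
    have "measure \<mu> K \<le> measure \<mu> (\<Union>j\<in>J. {p j<..p (Suc j)})"
      using J by (intro \<mu>.finite_measure_mono KJ sets.finite_UN) auto
    also have "\<dots> \<le> (\<Sum>j\<in>J. measure \<mu> {p j<..p (Suc j)})"
      using J by (intro \<mu>.finite_measure_subadditive_finite) auto
    also have "\<dots> = (\<Sum>j\<in>J. \<bar>F (p (Suc j)) - F (p j)\<bar>)"
      using w(1) monoD[OF F(1)] by (intro sum.cong) (auto simp: m pS)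
    also have "\<dots> < e"
    proof (rule D[OF J _ _ len])
      show "p i \<le> p (Suc i) \<and> {p i..p (Suc i)} \<subseteq> UNIV" for i using w(1) by (simp add: pS)
      show "disjoint_family_on (\<lambda>i. {p i<..<p (Suc i)}) J"
        using dis unfolding disjoint_family_on_def by fastforce
    qed
    finally show ?thesis by simp
  qed
  have "absolutely_continuous lborel \<mu>"
    unfolding absolutely_continuous_def
  proof
    fix A :: "real set" assume A: "A \<in> null_sets lborel"
    then have Ab: "A \<in> sets borel" by auto
    have "emeasure \<mu> A = (SUP K \<in> {K. K \<subseteq> A \<and> compact K}. emeasure \<mu> K)"
      using \<mu>.emeasure_finite Ab by (intro inner_regular) auto
    also have "\<dots> \<le> 0"
    proof (rule SUP_least)
      fix K assume K: "K \<in> {K. K \<subseteq> A \<and> compact K}"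
      then have "emeasure lborel K \<le> emeasure lborel A" using Ab by (intro emeasure_mono) auto
      then have "emeasure lborel K = 0" using A by auto
      then have "measure \<mu> K \<le> 0 + e" if "0 < e" for e using small[of K e] K that by auto
      then have "measure \<mu> K \<le> 0" by (rule field_le_epsilon)
      then show "emeasure \<mu> K \<le> 0" by (simp add: \<mu>.emeasure_eq_measure measure_le_0_iff)
    qed
    finally show "A \<in> null_sets \<mu>" using Ab by auto
  qed
  then obtain f where f[measurable]: "f \<in> borel_measurable lborel" and df: "density lborel f = \<mu>"
    using sigma_finite_measure.Radon_Nikodym[OF sigma_finite_lborel, of \<mu>] by auto
  have em: "emeasure \<mu> A = (\<integral>\<^sup>+x. f x * indicator A x \<partial>lborel)" if "A \<in> sets borel" for A
    using that by (simp add: df[symmetric] emeasure_density)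
  have fin: "(\<integral>\<^sup>+x. f x \<partial>lborel) \<noteq> \<infinity>" using em[of UNIV] \<mu>.emeasure_finite[of UNIV] by simp
  then have ae: "AE x in lborel. f x \<noteq> \<infinity>" by (intro nn_integral_PInf_AE) auto
  define \<phi> where "\<phi> x = enn2real (f x)" for x
  have [measurable]: "\<phi> \<in> borel_measurable borel" unfolding \<phi>_def[abs_def] by simp
  have eq: "AE x in lborel. ennreal (\<phi> x) = f x" using ae by eventually_elim (simp add: \<phi>_def less_top)
  have nonneg: "0 \<le> \<phi> x" for x by (simp add: \<phi>_def)
  have int: "integrable lborel \<phi>"
  proof (rule integrableI_nonneg)
    have "(\<integral>\<^sup>+x. \<phi> x \<partial>lborel) = (\<integral>\<^sup>+x. f x \<partial>lborel)" using eq by (rule nn_integral_cong_AE)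
    then show "(\<integral>\<^sup>+x. \<phi> x \<partial>lborel) < \<infinity>" using fin by (simp add: less_top)
  qed (use nonneg in auto)
  have "F d - F c = (LINT x:{c..d}|lebesgue. \<phi> x)" if "c \<le> d" for c d
  proof -
    have "(LINT x:{c..d}|lebesgue. \<phi> x) = (LINT x|lborel. indicator {c..d} x * \<phi> x)"
      unfolding set_lebesgue_integral_def by (subst integral_completion) auto
    also have "\<dots> = (LINT x|lborel. indicator {c<..d} x * \<phi> x)"
      using AE_lborel_singleton[of c] by (intro integral_cong_AE) (auto elim!: eventually_mono simp: indicator_def)
    also have "\<dots> = enn2real (\<integral>\<^sup>+x. ennreal (indicator {c<..d} x * \<phi> x) \<partial>lborel)"
      using nonneg by (intro integral_eq_nn_integral) auto
    also have "(\<integral>\<^sup>+x. ennreal (indicator {c<..d} x * \<phi> x) \<partial>lborel) = (\<integral>\<^sup>+x. f x * indicator {c<..d} x \<partial>lborel)"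
      using eq by (intro nn_integral_cong_AE) (auto elim!: eventually_mono simp: indicator_def)
    also have "\<dots> = emeasure \<mu> {c<..d}" by (simp add: em)
    also have "enn2real \<dots> = F d - F c" using m[OF that] by (simp add: measure_def)
    finally show ?thesis by simp
  qed
  moreover have "set_integrable lebesgue {a..b} \<phi>" for a b
    unfolding set_integrable_def using int integrable_completion[of \<phi> lborel]
    by (intro integrable_mult_indicator) auto
  ultimately have "is_primitive a b \<phi> F" for a b by (auto simp: is_primitive_def)
  then show ?thesis by blast
qed

lemma is_primitive_transform:
  assumes "is_primitive a b \<phi> h" "\<And>x. x \<in> {a..b} \<Longrightarrow> k x = h x + c"
  shows "is_primitive a b \<phi> k"
  using assms by (auto simp: is_primitive_def)

text \<open>k extends h by constants because the Stieltjes measures live on the whole line. V and V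
  - k are nondecreasing, since V grows by at least the modulus of the increment of k.\<close>

theorem abs_continuous_primitive:
  assumes ac: "abs_continuous_on {a..b} h"
  obtains \<phi> where "is_primitive a b \<phi> h"
proof (cases "a \<le> b")
  case True
  define k where "k x = h (max a (min b x))" for x
  have ack: "abs_continuous_on UNIV k"
    unfolding k_def using abs_continuous_on_clamp[OF ac True] .
  obtain B where B: "\<And>v. v \<in> variation_sums h {a..b} \<Longrightarrow> v \<le> B"
    using abs_continuous_bounded_variation[OF ac] unfolding bdd_above_def by auto
  have sub: "variation_sums k UNIV \<subseteq> variation_sums h {a..b}"
  proof
    fix v assume "v \<in> variation_sums k UNIV"
    then obtain n x where "v = (\<Sum>i<n. \<bar>k (x (Suc i)) - k (x i)\<bar>)" "mono_on {..n::nat} x"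
      unfolding variation_sums_def by auto
    then show "v \<in> variation_sums h {a..b}"
      unfolding variation_sums_def mem_Collect_eq k_def using True
      by (intro exI[of _ n] exI[of _ "\<lambda>i. max a (min b (x i))"] conjI)
         (auto simp: mono_on_def max_def min_def intro: order_trans)
  qed
  have kbv: "bdd_above (variation_sums k UNIV)" using B sub by (intro bdd_aboveI[of _ B]) auto
  define V where "V x = variation k {..x}" for x
  have acV: "abs_continuous_on UNIV V"
    unfolding V_def by (rule abs_continuous_variation[OF ack kbv])
  have step: "V x + \<bar>k y - k x\<bar> \<le> V y" if "x \<le> y" for x y
    unfolding V_def by (rule variation_step[OF kbv that])
  have Vb: "\<bar>V x\<bar> \<le> B" for x
  proof -
    have ne: "0 \<in> variation_sums k {..x}" by (rule variation_sums_nonempty[of x]) simp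
    have "V x \<le> B"
      unfolding V_def variation_def using ne B sub variation_sums_mono[of "{..x}" UNIV k]
      by (intro cSup_least) auto
    moreover have "0 \<le> V x"
      unfolding V_def variation_def using bdd_above_variation_sums_subset[OF kbv]
      by (intro cSup_upper ne) auto
    ultimately show ?thesis by simp
  qed
  have kb: "\<bar>k x\<bar> \<le> B + \<bar>k a\<bar>" for x
  proof -
    have "\<bar>k x - k a\<bar> \<le> B"
      using subsetD[OF sub variation_sums_2[of "min a x" "max a x" UNIV k]] B[of "\<bar>k x - k a\<bar>"]
      by (cases "a \<le> x") (auto simp: min_def max_def abs_minus_commute)
    then show ?thesis by linarith
  qed
  have mono: "mono V" "mono (\<lambda>x. V x - k x)"
    using step by (fastforce intro!: monoI)+
  obtain \<phi>1 where 1: "\<And>a b. is_primitive a b \<phi>1 V"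
    using abs_continuous_primitive_mono[OF mono(1) Vb acV] by blast
  have "\<bar>V x - k x\<bar> \<le> B + (B + \<bar>k a\<bar>)" for x using Vb[of x] kb[of x] by linarith
  then obtain \<phi>2 where 2: "\<And>a b. is_primitive a b \<phi>2 (\<lambda>x. V x - k x)"
    using abs_continuous_primitive_mono[OF mono(2) _ abs_continuous_on_diff[OF acV ack]] by blast
  have "is_primitive a b (\<lambda>x. \<phi>1 x - \<phi>2 x) h"
    by (rule is_primitive_transform[OF is_primitive_diff[OF 1 2], where c=0]) (simp add: k_def)
  then show thesis by (rule that)
next
  case False
  then have "is_primitive a b (\<lambda>_. 0) h" by (auto simp: is_primitive_def set_integrable_def)
  then show thesis by (rule that)
qed

section \<open>Primitives of powers\<close>

text \<open>For \<alpha> < 1 the derivative is unbounded at c, and its absolute integrability needs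
  an argument. The parameter k of g rescales the left branch: k = 1 gives the function itself, k =
  -1 a nondecreasing function whose derivative is the modulus of the original one. The fundamental
  theorem integrates both derivatives, and the second dominates the first.\<close>

lemma is_primitive_abs_powr:
  assumes "0 < \<alpha>"
  obtains \<phi> where "is_primitive a b \<phi> (\<lambda>t. \<bar>t - c\<bar> powr \<alpha>)"
proof -
  define g where "g k t = (if t < c then k else 1) * \<bar>t - c\<bar> powr \<alpha>" for k t :: real
  define g' where "g' k t = \<alpha> * (if t < c then - k else 1) * \<bar>t - c\<bar> powr (\<alpha> - 1)" for k t :: real
  have der: "(g k has_real_derivative g' k t) (at t)" if "t \<noteq> c" for k t
  proof -
    from that consider "t < c" | "c < t" by fastforce
    then show ?thesis
    proof cases
      case 1
      have "((\<lambda>t. k * (c - t) powr \<alpha>) has_real_derivative g' k t) (at t)"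
        using 1 by (auto intro!: derivative_eq_intros simp: g'_def)
      then show ?thesis
        by (rule has_field_derivative_transform_within_open[of _ _ _ "{..<c}"]) (use 1 in \<open>auto simp: g_def\<close>)
    next
      case 2
      have "((\<lambda>t. (t - c) powr \<alpha>) has_real_derivative g' k t) (at t)"
        using 2 by (auto intro!: derivative_eq_intros simp: g'_def)
      then show ?thesis
        by (rule has_field_derivative_transform_within_open[of _ _ _ "{c<..}"]) (use 2 in \<open>auto simp: g_def\<close>)
    qed
  qed
  have hi: "(g' k has_integral (g k q - g k p)) {p..q}" if "p \<le> q" for p q k
  proof (rule fundamental_theorem_of_calculus_interior_strong[of "{c}"])
    have "isCont (g k) t" for t
    proof (cases "t = c")
      case True
      have "((\<lambda>t. \<bar>t - c\<bar> powr \<alpha>) \<longlongrightarrow> \<bar>c - c\<bar> powr \<alpha>) (at c)"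
        using \<open>0 < \<alpha>\<close> by (intro tendsto_intros) auto
      then have "((\<lambda>t. (if t < c then k else 1) * \<bar>t - c\<bar> powr \<alpha>) \<longlongrightarrow> 0) (at c)"
        by (intro lim_null_mult_left_bounded[where B="max \<bar>k\<bar> 1"]) auto
      then show ?thesis unfolding isCont_def g_def True by simp
    next
      case False
      then show ?thesis using der[of t k] by (auto intro: DERIV_isCont)
    qed
    then show "continuous_on {p..q} (g k)" by (simp add: continuous_at_imp_continuous_on)
    fix t assume "t \<in> {p<..<q} - {c}"
    then have "(g k has_real_derivative g' k t) (at t)" by (intro der) auto
    then show "(g k has_vector_derivative g' k t) (at t)"
      by (simp add: has_real_derivative_iff_has_vector_derivative)
  qed (use that in auto)
  have ai: "g' 1 absolutely_integrable_on {p..q}" if "p \<le> q" for p q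
  proof (rule absolutely_integrable_integrable_bound)
    show "g' 1 integrable_on {p..q}" "g' (- 1) integrable_on {p..q}" using hi[OF that] by blast+
    show "norm (g' 1 x) \<le> g' (- 1) x" for x using \<open>0 < \<alpha>\<close> by (simp add: g'_def abs_mult)
  qed
  have "is_primitive a b (g' 1) (\<lambda>t. \<bar>t - c\<bar> powr \<alpha>)"
    unfolding is_primitive_def
  proof (intro conjI allI impI)
    show "set_integrable lebesgue {a..b} (g' 1)" using ai[of a b] by (cases "a \<le> b") (auto simp: set_integrable_def)
    fix p q assume "a \<le> p \<and> p \<le> q \<and> q \<le> b"
    then show "\<bar>q - c\<bar> powr \<alpha> - \<bar>p - c\<bar> powr \<alpha> = (LINT x:{p..q}|lebesgue. g' 1 x)"
      using set_lebesgue_integral_eq_integral(2)[OF ai[of p q]] integral_unique[OF hi[of p q 1]]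
      by (simp add: g_def)
  qed
  then show thesis by (rule that)
qed

section \<open>Integration by parts for Stieltjes integrals\<close>

text \<open>The jump of the extension at 0 is included, so this function bounds |g| itself, and its
  increment over a cell bounds the oscillation there.\<close>

definition bv_variation :: "real \<Rightarrow> (real \<Rightarrow> real) \<Rightarrow> real \<Rightarrow> real" where
  "bv_variation T g x = variation (zero_ext T g) {..x}"

definition grid :: "real \<Rightarrow> nat \<Rightarrow> nat \<Rightarrow> real" where
  "grid T n i = T * real i / real n"

text \<open>Soft thresholding at level \<open>v\<close>. If \<open>v\<close> bounds the oscillation of a function on a cell, then
  thresholding any of its values gives a constant that is dominated by the function on the whole
  cell; in particular it vanishes if the function has a zero there.\<close>

definition shrink :: "real \<Rightarrow> real \<Rightarrow> real" where
  "shrink v y = max 0 (y - v) + min 0 (y + v)"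

lemma abs_shrink_le: "\<bar>y - z\<bar> \<le> v \<Longrightarrow> \<bar>shrink v y\<bar> \<le> \<bar>z\<bar>"
  unfolding shrink_def by (smt (verit))

lemma shrink_close: "0 \<le> v \<Longrightarrow> \<bar>shrink v y - y\<bar> \<le> v"
  unfolding shrink_def by (smt (verit))

lemma zero_ext_simps: "x \<in> {0..T} \<Longrightarrow> zero_ext T g x = g x" "x < 0 \<Longrightarrow> zero_ext T g x = 0" "T < x \<Longrightarrow> zero_ext T g x = 0"
  by (auto simp: zero_ext_def)

lemma grid_0 [simp]: "grid T n 0 = 0"
  and grid_n [simp]: "0 < n \<Longrightarrow> grid T n n = T"
  by (auto simp: grid_def)

lemma grid_Suc: "grid T n (Suc i) = grid T n i + T / real n"
  by (simp add: grid_def field_simps add_divide_distrib)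

lemma mono_grid: "0 \<le> T \<Longrightarrow> mono (grid T n)"
  by (auto simp: grid_def mono_def intro!: divide_right_mono mult_left_mono)

lemma grid_in: "0 \<le> T \<Longrightarrow> i \<le> n \<Longrightarrow> grid T n i \<in> {0..T}"
  by (cases "n = 0") (auto simp: grid_def field_simps intro: mult_left_mono)

context
  fixes T :: real and g :: "real \<Rightarrow> real"
  assumes T: "0 < T" and g: "g \<in> bv_functions T"
begin

lemma bv_variation_step:
  "x \<le> y \<Longrightarrow> bv_variation T g x + \<bar>zero_ext T g y - zero_ext T g x\<bar> \<le> bv_variation T g y"
  unfolding bv_variation_def using T g by (intro variation_step zero_ext_variation_bdd) auto

lemma mono_bv_variation: "mono (bv_variation T g)"
  using bv_variation_step by (intro monoI) (smt (verit))

lemma bv_osc: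
  assumes "x \<in> {p..q}" "y \<in> {p..q}"
  shows "\<bar>zero_ext T g x - zero_ext T g y\<bar> \<le> bv_variation T g q - bv_variation T g p"
proof -
  have *: "\<bar>zero_ext T g x - zero_ext T g y\<bar> \<le> bv_variation T g q - bv_variation T g p"
    if "x \<in> {p..q}" "y \<in> {p..q}" "x \<le> y" for x y
    using bv_variation_step[OF that(3)] monoD[OF mono_bv_variation, of y q] monoD[OF mono_bv_variation, of p x] that
    by auto
  show ?thesis
    using *[OF assms] *[OF assms(2,1)] by (cases "x \<le> y") (auto simp: abs_minus_commute)
qed

lemma bv_variation_nonneg: "0 \<le> bv_variation T g x"
proof -
  have "bdd_above (variation_sums (zero_ext T g) {..x})"
    using T by (intro bdd_above_variation_sums_subset[OF zero_ext_variation_bdd[OF g]]) auto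
  then show ?thesis
    unfolding bv_variation_def variation_def
    by (intro cSup_upper variation_sums_nonempty[of x]) auto
qed

lemma zero_ext_bounded: "\<bar>zero_ext T g x\<bar> \<le> bv_variation T g T"
proof (cases "x \<in> {0..T}")
  case True
  then have "\<bar>zero_ext T g x - zero_ext T g (- 1)\<bar> \<le> bv_variation T g T - bv_variation T g (- 1)"
    by (intro bv_osc) auto
  then show ?thesis using bv_variation_nonneg[of "- 1"] by (simp add: zero_ext_simps)
next
  case False
  then show ?thesis using bv_variation_nonneg[of T] by (auto simp: zero_ext_def)
qed

lemma zero_ext_measurable [measurable]: "zero_ext T g \<in> borel_measurable borel"
proof -
  have "mono (\<lambda>x. bv_variation T g x - zero_ext T g x)"
    using bv_variation_step by (intro monoI) (smt (verit))
  then have "(\<lambda>x. bv_variation T g x - (bv_variation T g x - zero_ext T g x)) \<in> borel_measurable borel"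
    using mono_bv_variation by (intro borel_measurable_diff borel_measurable_mono)
  then show ?thesis by simp
qed

text \<open>The Stieltjes masses are expressed by right limits of g; this bound exchanges them for
  sampled values at the cost of the variation on the cell.\<close>

lemma right_lim_bv_close:
  assumes "p < q"
  shows "\<bar>right_lim (zero_ext T g) p - zero_ext T g q\<bar> \<le> bv_variation T g q - bv_variation T g p"
proof (rule tendsto_upperbound)
  show "((\<lambda>x. \<bar>zero_ext T g x - zero_ext T g q\<bar>) \<longlongrightarrow> \<bar>right_lim (zero_ext T g) p - zero_ext T g q\<bar>) (at_right p)"
    using T g by (intro tendsto_intros ls_decomposition(3)) auto
  show "\<forall>\<^sub>F x in at_right p. \<bar>zero_ext T g x - zero_ext T g q\<bar> \<le> bv_variation T g q - bv_variation T g p"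
    unfolding eventually_at_right[OF assms]
    by (intro exI[of _ q] conjI allI impI bv_osc) (use assms in auto)
qed simp

text \<open>The point T counts as outside: the right limit there already sees the zero extension,
  whatever g T is. This makes the boundary term at T vanish in the summation by parts.\<close>

lemma right_lim_zero_ext_outside:
  assumes "x < 0 \<or> T \<le> x"
  shows "right_lim (zero_ext T g) x = 0"
proof -
  have "(zero_ext T g \<longlongrightarrow> 0) (at_right x)"
  proof (rule tendsto_eventually)
    show "\<forall>\<^sub>F y in at_right x. zero_ext T g y = 0"
    proof (cases "x < 0")
      case True
      then show ?thesis unfolding eventually_at_right[OF True] by (intro exI[of _ 0]) (auto simp: zero_ext_simps)
    next
      case False
      then show ?thesis
        using assms unfolding eventually_at_right[OF less_add_one]
        by (intro exI[of _ "x + 1"]) (auto simp: zero_ext_simps)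
    qed
  qed
  then show ?thesis unfolding right_lim_def by (intro tendsto_Lim) auto
qed

lemma sets_ls [simp, measurable_cong]: "sets (ls_plus T g) = sets borel" "sets (ls_minus T g) = sets borel"
  and space_ls [simp]: "space (ls_plus T g) = UNIV" "space (ls_minus T g) = UNIV"
  by (simp_all add: ls_plus_def ls_minus_def)

lemma finite_ls: "finite_measure (ls_plus T g)" "finite_measure (ls_minus T g)"
  using ls_decomposition(1,2)[OF g] T by auto

text \<open>The grid cells (x i, x (i+1)] miss this atom. It is the limit of the masses of
  (-1/(k+1), 0], each of which equals the right limit at 0 because the extension vanishes to the
  left.\<close>

lemma ls_atom_0:
  "measure (ls_plus T g) {0} - measure (ls_minus T g) {0} = right_lim (zero_ext T g) 0"
proof (rule LIMSEQ_unique)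
  let ?A = "\<lambda>k::nat. {- inverse (real (Suc k))<..0::real}"
  have A: "(\<Inter>k. ?A k) = {0}"
  proof (intro equalityI subsetI)
    fix x assume x: "x \<in> (\<Inter>k. ?A k)"
    have "x \<ge> 0"
    proof (rule ccontr)
      assume "\<not> x \<ge> 0"
      then obtain k where "inverse (real (Suc k)) < - x" using reals_Archimedean[of "- x"] by auto
      then show False using INT_D[OF x, of k] by simp
    qed
    then show "x \<in> {0}" using x by auto
  qed auto
  have dec: "decseq ?A"
  proof (rule decseq_SucI)
    fix k
    have sub: "{- b<..0} \<subseteq> {- a<..0}" if "b \<le> a" for a b :: real using that by auto
    show "?A (Suc k) \<le> ?A k" by (rule sub, rule le_imp_inverse_le) auto
  qed
  have lim: "(\<lambda>k. measure m (?A k)) \<longlonglongrightarrow> measure m {0}" if "finite_measure m" "sets m = sets borel" for m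
  proof -
    have "(\<lambda>k. measure m (?A k)) \<longlonglongrightarrow> measure m (\<Inter>k. ?A k)"
      by (rule finite_measure.finite_Lim_measure_decseq[OF that(1) _ dec]) (auto simp: that(2))
    then show ?thesis by (simp only: A)
  qed
  show "(\<lambda>k. measure (ls_plus T g) (?A k) - measure (ls_minus T g) (?A k)) \<longlonglongrightarrow>
      measure (ls_plus T g) {0} - measure (ls_minus T g) {0}"
    by (intro tendsto_diff lim finite_ls) auto
  have "measure (ls_plus T g) (?A k) - measure (ls_minus T g) (?A k) = right_lim (zero_ext T g) 0" for k
    using T by (subst ls_decomposition(4)[OF g]) (auto simp: right_lim_zero_ext_outside)
  then show "(\<lambda>k. measure (ls_plus T g) (?A k) - measure (ls_minus T g) (?A k)) \<longlonglongrightarrow> right_lim (zero_ext T g) 0"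
    by simp
qed

end

section \<open>Riemann-Stieltjes sums on uniform grids\<close>

lemma set_integrable_finite_measure_continuous:
  fixes \<Phi> :: "real \<Rightarrow> real"
  assumes m: "finite_measure m" "sets m = sets borel" and \<Phi>: "continuous_on {a..b} \<Phi>"
    and A: "A \<subseteq> {a..b}" "A \<in> sets borel"
  shows "set_integrable m A \<Phi>"
proof -
  have "bounded (\<Phi> ` {a..b})" by (intro compact_imp_bounded compact_continuous_image \<Phi>) auto
  then have "\<exists>B. \<forall>x\<in>{a..b}. \<bar>\<Phi> x\<bar> \<le> B" unfolding bounded_iff by auto
  then obtain B where B: "\<And>x. x \<in> {a..b} \<Longrightarrow> \<bar>\<Phi> x\<bar> \<le> B" by blast
  have "set_integrable m {a..b} \<Phi>"
    unfolding set_integrable_def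
  proof (rule finite_measure.integrable_const_bound[OF m(1), of _ "max 0 B"])
    show "(\<lambda>x. indicator {a..b} x *\<^sub>R \<Phi> x) \<in> borel_measurable m"
      using borel_measurable_continuous_on_indicator[OF _ \<Phi>] m(2) by (simp cong: measurable_cong_sets)
    show "AE x in m. norm (indicator {a..b} x *\<^sub>R \<Phi> x) \<le> max 0 B"
      using B by (intro AE_I2) (auto simp: indicator_def le_max_iff_disj)
  qed
  then show ?thesis by (rule set_integrable_subset) (use A m(2) in auto)
qed

text \<open>The atom at 0 enters exactly, since no half-open cell contains 0; every further cell
  adds an error of at most \<omega> times its mass.\<close>

lemma set_integral_step_approx:
  fixes \<Phi> :: "real \<Rightarrow> real" and x :: "nat \<Rightarrow> real"
  assumes m: "finite_measure m" "sets m = sets borel" and \<Phi>: "continuous_on {0..T} \<Phi>"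
    and x: "mono x" "x 0 = 0" "x n \<le> T"
    and osc: "\<And>i y. i < n \<Longrightarrow> y \<in> {x i<..x (Suc i)} \<Longrightarrow> \<bar>\<Phi> y - \<Phi> (x (Suc i))\<bar> \<le> \<omega>"
    and k: "k \<le> n"
  shows "\<bar>(LINT y:{0..x k}|m. \<Phi> y) - (\<Phi> 0 * measure m {0} + (\<Sum>i<k. \<Phi> (x (Suc i)) * measure m {x i<..x (Suc i)}))\<bar>
    \<le> \<omega> * measure m {0<..x k}"
  using k
proof (induction k)
  case 0
  have "space m = UNIV" using sets_eq_imp_space_eq[OF m(2)] by simp
  then have "(LINT y:{0}|m. \<Phi> y) = \<Phi> 0 * measure m {0}"
    using set_integral_const[of "{0}" m "\<Phi> 0"] m finite_measure.emeasure_finite[OF m(1)]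
    by (subst set_lebesgue_integral_cong[where g="\<lambda>_. \<Phi> 0"]) (auto simp: mult.commute)
  then show ?case by (simp add: x(2))
next
  case (Suc k)
  have xk: "0 \<le> x k" "x k \<le> x (Suc k)" "x (Suc k) \<le> T"
    using monoD[OF x(1), of 0 k] monoD[OF x(1), of k "Suc k"] monoD[OF x(1), of "Suc k" n] x(2,3) Suc.prems by auto
  let ?I = "{x k<..x (Suc k)}"
  have "{0..x (Suc k)} = {0..x k} \<union> ?I" using xk by auto
  then have split: "(LINT y:{0..x (Suc k)}|m. \<Phi> y) = (LINT y:{0..x k}|m. \<Phi> y) + (LINT y:?I|m. \<Phi> y)"
    using xk by (auto intro!: set_integral_Un set_integrable_finite_measure_continuous[OF m \<Phi>])
  have fin: "emeasure m ?I \<noteq> \<infinity>" using finite_measure.emeasure_finite[OF m(1)] by simp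
  have intI: "set_integrable m ?I \<Phi>"
    using xk by (intro set_integrable_finite_measure_continuous[OF m \<Phi>]) auto
  have intc: "set_integrable m ?I (\<lambda>_. c)" for c :: real
    using fin m(2) by (auto simp: set_integrable_def top.not_eq_extremum)
  have c: "(LINT y:?I|m. c) = c * measure m ?I" for c :: real
    using set_integral_const[of ?I m c] fin m(2) by (simp add: mult.commute)
  have "\<bar>(LINT y:?I|m. \<Phi> y) - \<Phi> (x (Suc k)) * measure m ?I\<bar> = \<bar>LINT y:?I|m. \<Phi> y - \<Phi> (x (Suc k))\<bar>"
    using intI intc c by (subst set_integral_diff) auto
  also have "\<dots> \<le> (LINT y:?I|m. \<bar>\<Phi> y - \<Phi> (x (Suc k))\<bar>)"
    using set_integral_norm_bound[OF set_integral_diff(1)[OF intI intc]] by simp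
  also have "\<dots> \<le> (LINT y:?I|m. \<omega>)"
    using osc[of k] Suc.prems intI intc
    by (intro set_integral_mono set_integrable_abs set_integral_diff(1)) auto
  also have "\<dots> = \<omega> * measure m ?I" by (rule c)
  finally have new: "\<bar>(LINT y:?I|m. \<Phi> y) - \<Phi> (x (Suc k)) * measure m ?I\<bar> \<le> \<omega> * measure m ?I" .
  have "{0<..x (Suc k)} = {0<..x k} \<union> ?I" using xk by auto
  then have "measure m {0<..x (Suc k)} = measure m {0<..x k} + measure m ?I"
    using finite_measure.finite_measure_Union[OF m(1), of "{0<..x k}" ?I] m(2) by auto
  then show ?case using Suc.IH Suc.prems new split by (simp add: distrib_left abs_le_iff)
qed

lemma summation_by_parts:
  fixes a b :: "nat \<Rightarrow> 'a :: comm_ring"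
  shows "a 0 * b 0 + (\<Sum>i<n. a (Suc i) * (b (Suc i) - b i)) = a n * b n + (\<Sum>i<n. b i * (a i - a (Suc i)))"
  by (induction n) (auto simp: algebra_simps)

text \<open>Sum \<Phi> at the right ends of the cells against the increments of the right limits of
  g; summation by parts moves the increments to \<Phi>. Exchanging the right limits for c then costs
  the oscillation of \<Phi> on a cell times twice the total variation, which vanishes in the
  limit.\<close>

theorem ls_integral_riemann_stieltjes:
  assumes T: "0 < T" and g: "g \<in> bv_functions T" and \<Phi>: "continuous_on {0..T} \<Phi>"
    and c: "\<And>n i. i < n \<Longrightarrow> \<bar>c n i - zero_ext T g (grid T n (Suc i))\<bar>
        \<le> bv_variation T g (grid T n (Suc i)) - bv_variation T g (grid T n i)"
  shows "(\<lambda>n. \<Sum>i<n. c n i * (\<Phi> (grid T n i) - \<Phi> (grid T n (Suc i)))) \<longlonglongrightarrow> ls_integral T g \<Phi>"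
proof (rule LIMSEQ_I)
  fix \<epsilon> :: real assume \<epsilon>: "0 < \<epsilon>"
  let ?V = "bv_variation T g" and ?P = "ls_plus T g" and ?N = "ls_minus T g" and ?r = "right_lim (zero_ext T g)"
  \<comment> \<open>Factors of e in the errors: the two total masses from replacing \<Phi> by its
    grid values, and twice the variation from replacing right limits by c. The extra 1 ensures 0 <
    K.\<close>
  define K where "K = measure ?P UNIV + measure ?N UNIV + 2 * ?V T + 1"
  have K: "0 < K" unfolding K_def using bv_variation_nonneg[OF T g, of T]
    by (intro add_nonneg_pos add_nonneg_nonneg) auto
  define e where "e = \<epsilon> / (2 * K)"
  have e: "0 < e" using \<epsilon> K by (simp add: e_def)
  have "uniformly_continuous_on {0..T} \<Phi>" by (rule compact_uniformly_continuous[OF \<Phi>]) simp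
  then obtain d where d: "0 < d" "\<And>x y. x \<in> {0..T} \<Longrightarrow> y \<in> {0..T} \<Longrightarrow> \<bar>x - y\<bar> < d \<Longrightarrow> \<bar>\<Phi> x - \<Phi> y\<bar> < e"
    using e unfolding uniformly_continuous_on_def dist_real_def by metis
  obtain n0 :: nat where n0: "T / d < real n0" using reals_Archimedean2 by blast
  have n0pos: "0 < n0" using n0 T d(1) by (metis divide_pos_pos less_trans of_nat_0_less_iff)
  show "\<exists>n0. \<forall>n\<ge>n0. norm ((\<Sum>i<n. c n i * (\<Phi> (grid T n i) - \<Phi> (grid T n (Suc i)))) - ls_integral T g \<Phi>) < \<epsilon>"
  proof (intro exI[of _ n0] allI impI)
    fix n assume "n0 \<le> n"
    then have n: "0 < n" "T / d < real n" using n0 n0pos by auto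
    then have w: "0 < T / real n" "T / real n < d" using T d(1) by (auto simp: field_simps)
    define x where "x = grid T n"
    have x: "mono x" "x 0 = 0" "x n = T" using mono_grid[of T n] T n(1) by (auto simp: x_def)
    have xS: "x (Suc i) = x i + T / real n" for i by (simp add: x_def grid_Suc)
    have xin: "x i \<in> {0..T}" if "i \<le> n" for i using grid_in[of T i n] T that by (auto simp: x_def)
    have osc: "\<bar>\<Phi> y - \<Phi> (x (Suc i))\<bar> \<le> e" if "i < n" "y \<in> {x i..x (Suc i)}" for i y
      using d(2)[of y "x (Suc i)"] xin[of i] xin[of "Suc i"] that w xS[of i] by (auto intro!: less_imp_le)
    have approx: "\<bar>(LINT y:{0..T}|m. \<Phi> y) - (\<Phi> 0 * measure m {0} + (\<Sum>i<n. \<Phi> (x (Suc i)) * measure m {x i<..x (Suc i)}))\<bar>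
        \<le> e * measure m UNIV" if m: "finite_measure m" "sets m = sets borel" for m
    proof -
      have "measure m {0<..T} \<le> measure m UNIV"
        using finite_measure.finite_measure_mono[OF m(1), of "{0<..T}" UNIV] m(2) by auto
      then have "e * measure m {0<..T} \<le> e * measure m UNIV" using e by simp
      moreover have "\<bar>(LINT y:{0..x n}|m. \<Phi> y) - (\<Phi> 0 * measure m {0} + (\<Sum>i<n. \<Phi> (x (Suc i)) * measure m {x i<..x (Suc i)}))\<bar>
        \<le> e * measure m {0<..x n}"
        using osc x by (intro set_integral_step_approx[OF m \<Phi> x(1,2)]) auto
      ultimately show ?thesis using x(3) by simp
    qed
    define S where "S = (\<Sum>i<n. ?r (x i) * (\<Phi> (x i) - \<Phi> (x (Suc i))))"
    have "\<Phi> 0 * measure ?P {0} + (\<Sum>i<n. \<Phi> (x (Suc i)) * measure ?P {x i<..x (Suc i)})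
        - (\<Phi> 0 * measure ?N {0} + (\<Sum>i<n. \<Phi> (x (Suc i)) * measure ?N {x i<..x (Suc i)}))
        = \<Phi> (x 0) * ?r (x 0) + (\<Sum>i<n. \<Phi> (x (Suc i)) * (?r (x (Suc i)) - ?r (x i)))"
    proof -
      have "measure ?P {x i<..x (Suc i)} - measure ?N {x i<..x (Suc i)} = ?r (x (Suc i)) - ?r (x i)" for i
        using T monoD[OF x(1), of i "Suc i"] by (intro ls_decomposition(4)[OF g]) auto
      then show ?thesis
        unfolding x(2) ls_atom_0[OF T g, symmetric]
        by (simp add: right_diff_distrib sum_subtractf flip: \<open>\<And>i. _ = ?r (x (Suc i)) - ?r (x i)\<close>)
    qed
    \<comment> \<open>The boundary term at x n = T is zero because the right limit of the extension
      vanishes there.\<close>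
    also have "\<dots> = S"
      using summation_by_parts[of "\<lambda>i. \<Phi> (x i)" "\<lambda>i. ?r (x i)" n] T
      by (simp add: S_def x(3) right_lim_zero_ext_outside[OF T g])
    finally have "\<bar>ls_integral T g \<Phi> - S\<bar> \<le> e * measure ?P UNIV + e * measure ?N UNIV"
      using approx[OF finite_ls(1)[OF T g] sets_ls(1)[OF T g]] approx[OF finite_ls(2)[OF T g] sets_ls(2)[OF T g]]
      unfolding ls_integral_def by linarith
    moreover have "\<bar>(\<Sum>i<n. c n i * (\<Phi> (x i) - \<Phi> (x (Suc i)))) - S\<bar> \<le> e * (2 * ?V T)"
    proof -
      have "\<bar>(\<Sum>i<n. c n i * (\<Phi> (x i) - \<Phi> (x (Suc i)))) - S\<bar>
          \<le> (\<Sum>i<n. \<bar>(c n i - ?r (x i)) * (\<Phi> (x i) - \<Phi> (x (Suc i)))\<bar>)"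
        unfolding S_def sum_subtractf[symmetric] left_diff_distrib[symmetric] by (rule sum_abs)
      also have "\<dots> \<le> (\<Sum>i<n. (2 * (?V (x (Suc i)) - ?V (x i))) * e)"
      proof (rule sum_mono)
        fix i assume i: "i \<in> {..<n}"
        then have "\<bar>c n i - ?r (x i)\<bar> \<le> 2 * (?V (x (Suc i)) - ?V (x i))"
          using c[of i n] right_lim_bv_close[OF T g, of "x i" "x (Suc i)"] w xS[of i] by (auto simp: x_def)
        moreover have "\<bar>\<Phi> (x i) - \<Phi> (x (Suc i))\<bar> \<le> e" using i osc[of i "x i"] monoD[OF x(1), of i "Suc i"] by auto
        ultimately show "\<bar>(c n i - ?r (x i)) * (\<Phi> (x i) - \<Phi> (x (Suc i)))\<bar> \<le> (2 * (?V (x (Suc i)) - ?V (x i))) * e"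
          unfolding abs_mult by (intro mult_mono) auto
      qed
      also have "\<dots> = (2 * (?V (x n) - ?V (x 0))) * e"
        by (simp only: sum_lessThan_telescope[of "\<lambda>i. ?V (x i)" n, symmetric] sum_distrib_right sum_distrib_left)
      also have "\<dots> \<le> e * (2 * ?V T)"
        using e bv_variation_nonneg[OF T g, of 0] by (simp add: x mult.commute[of _ e])
      finally show ?thesis .
    qed
    ultimately have "\<bar>(\<Sum>i<n. c n i * (\<Phi> (x i) - \<Phi> (x (Suc i)))) - ls_integral T g \<Phi>\<bar> \<le> e * (K - 1)"
      unfolding K_def by (simp add: algebra_simps abs_le_iff)
    also have "\<dots> < \<epsilon>"
    proof -
      have "e * K = \<epsilon> / 2" using K by (simp add: e_def)
      then show ?thesis using \<epsilon> e by (simp add: right_diff_distrib)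
    qed
    finally show "norm ((\<Sum>i<n. c n i * (\<Phi> (grid T n i) - \<Phi> (grid T n (Suc i)))) - ls_integral T g \<Phi>) < \<epsilon>"
      by (simp add: x_def)
  qed
qed

lemma set_integral_Ioc_lebesgue:
  fixes \<psi> :: "real \<Rightarrow> real"
  assumes "set_integrable lebesgue {a..b} \<psi>"
  shows "(LINT x:{a<..b}|lebesgue. \<psi> x) = (LINT x:{a..b}|lebesgue. \<psi> x)"
proof -
  have "set_integrable lebesgue {a<..b} \<psi>" by (rule set_integrable_subset[OF assms]) auto
  then show ?thesis
    using assms AE_lebesgue_neq[of a] unfolding set_lebesgue_integral_def set_integrable_def
    by (intro integral_cong_AE) (auto elim!: eventually_mono simp: indicator_def)
qed

section \<open>Thresholded step functions and integration by parts\<close>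

context
  fixes T :: real and g :: "real \<Rightarrow> real"
  assumes T: "0 < T" and g: "g \<in> bv_functions T"
begin

text \<open>The threshold is the variation on the cell: large enough for domination by |g| on the
  whole closed cell, small enough for an admissible coefficient in
  \<open>ls_integral_riemann_stieltjes\<close>.\<close>

definition bv_coeff :: "nat \<Rightarrow> nat \<Rightarrow> real" where
  "bv_coeff n i = shrink (bv_variation T g (grid T n (Suc i)) - bv_variation T g (grid T n i))
     (zero_ext T g (grid T n (Suc i)))"

definition bv_step :: "nat \<Rightarrow> real \<Rightarrow> real" where
  "bv_step n x = (\<Sum>i<n. bv_coeff n i * indicator {grid T n i<..grid T n (Suc i)} x)"

lemma bv_coeff_le:
  "x \<in> {grid T n i..grid T n (Suc i)} \<Longrightarrow> \<bar>bv_coeff n i\<bar> \<le> \<bar>zero_ext T g x\<bar>"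
  unfolding bv_coeff_def
  by (rule abs_shrink_le, rule bv_osc[OF T g]) (use monoD[OF mono_grid, of T i "Suc i"] T in auto)

lemma bv_coeff_close:
  "\<bar>bv_coeff n i - zero_ext T g (grid T n (Suc i))\<bar> \<le> bv_variation T g (grid T n (Suc i)) - bv_variation T g (grid T n i)"
  unfolding bv_coeff_def
  by (rule shrink_close) (use monoD[OF mono_bv_variation[OF T g], of "grid T n i"] monoD[OF mono_grid, of T i "Suc i"] T in auto)

lemma grid_cell_subset: "i < n \<Longrightarrow> {grid T n i..grid T n (Suc i)} \<subseteq> {0..T}"
  using grid_in[of T i n] grid_in[of T "Suc i" n] T by auto

lemma grid_cell_ex:
  assumes "x \<in> {0<..T}" "0 < n"
  obtains i where "i < n" "x \<in> {grid T n i<..grid T n (Suc i)}"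
  using Ioc_subset_UN_Ioc[of "grid T n" n] assms by auto

lemma bv_step_eq:
  assumes "i < n" "x \<in> {grid T n i<..grid T n (Suc i)}"
  shows "bv_step n x = bv_coeff n i"
proof -
  have "x \<notin> {grid T n j<..grid T n (Suc j)}" if "j \<noteq> i" for j
    using disjoint_family_Ioc[OF mono_grid, of T n] T assms(2) that unfolding disjoint_family_on_def by fastforce
  then have "bv_step n x = (\<Sum>j<n. if j = i then bv_coeff n i else 0)"
    unfolding bv_step_def using assms(2) by (intro sum.cong) auto
  then show ?thesis using assms(1) by simp
qed

lemma bv_step_outside:
  assumes "x \<notin> {0<..T}"
  shows "bv_step n x = 0"
  unfolding bv_step_def
proof (intro sum.neutral ballI)
  fix i assume "i \<in> {..<n}"
  then show "bv_coeff n i * indicator {grid T n i<..grid T n (Suc i)} x = 0"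
    using grid_in[of T i n] grid_in[of T "Suc i" n] T assms by (auto simp: indicator_def)
qed

lemma bv_step_le: "\<bar>bv_step n x\<bar> \<le> \<bar>zero_ext T g x\<bar>"
proof (cases "x \<in> {0<..T} \<and> 0 < n")
  case True
  then obtain i where i: "i < n" "x \<in> {grid T n i<..grid T n (Suc i)}" using grid_cell_ex by blast
  then show ?thesis using bv_coeff_le[of x n i] by (auto simp: bv_step_eq[OF i])
next
  case False
  then show ?thesis using bv_step_outside[of x n] by (auto simp: bv_step_def)
qed

text \<open>The cell of x lies between x - T/n and x + T/n. Thresholding, and moving from the right
  end of the cell to x, each cost at most the increment of the variation, which tends to 0 at a
  continuity point.\<close>

lemma bv_step_tendsto:
  assumes x: "x \<in> {0<..<T}" and cont: "isCont (bv_variation T g) x"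
  shows "(\<lambda>n. bv_step n x) \<longlonglongrightarrow> g x"
proof -
  let ?V = "bv_variation T g"
  have lim: "(\<lambda>n. ?V (x + c * inverse (real n))) \<longlonglongrightarrow> ?V x" for c
  proof -
    have "(\<lambda>n. x + c * inverse (real n)) \<longlonglongrightarrow> x + c * 0" by (intro tendsto_intros lim_inverse_n)
    then show ?thesis by (intro isCont_tendsto_compose[OF cont]) simp
  qed
  have "(\<lambda>n. 2 * (?V (x + T * inverse (real n)) - ?V (x + (- T) * inverse (real n)))) \<longlonglongrightarrow> 2 * (?V x - ?V x)"
    by (intro tendsto_intros lim)
  then have lim0: "(\<lambda>n. 2 * ?V (x + T * inverse (real n)) - 2 * ?V (x - T * inverse (real n))) \<longlonglongrightarrow> 0"
    by (simp add: right_diff_distrib)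
  have "(\<lambda>n. bv_step n x - g x) \<longlonglongrightarrow> 0"
  proof (rule Lim_null_comparison[OF _ lim0], unfold real_norm_def)
    show "\<forall>\<^sub>F n in sequentially. \<bar>bv_step n x - g x\<bar> \<le> 2 * ?V (x + T * inverse (real n)) - 2 * ?V (x - T * inverse (real n))"
      using eventually_gt_at_top[of "0::nat"]
    proof eventually_elim
      case (elim n)
      obtain i where i: "i < n" "x \<in> {grid T n i<..grid T n (Suc i)}"
        using grid_cell_ex[of x n] x elim by auto
      have "\<bar>bv_coeff n i - zero_ext T g (grid T n (Suc i))\<bar> \<le> ?V (grid T n (Suc i)) - ?V (grid T n i)"
        by (rule bv_coeff_close)
      moreover have "\<bar>zero_ext T g (grid T n (Suc i)) - zero_ext T g x\<bar> \<le> ?V (grid T n (Suc i)) - ?V (grid T n i)"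
        using i by (intro bv_osc[OF T g]) auto
      moreover have "?V (grid T n (Suc i)) \<le> ?V (x + T * inverse (real n))" "?V (x - T * inverse (real n)) \<le> ?V (grid T n i)"
        using i grid_Suc[of T n i] by (auto intro!: monoD[OF mono_bv_variation[OF T g]] simp: divide_inverse)
      moreover have "zero_ext T g x = g x" using x by (simp add: zero_ext_simps)
      ultimately show ?case unfolding bv_step_eq[OF i] by linarith
    qed
  qed
  then show ?thesis by (simp add: LIM_zero_iff)
qed

lemma AE_bv_step_tendsto: "AE x in lebesgue. (\<lambda>n. bv_step n x) \<longlonglongrightarrow> zero_ext T g x"
proof -
  have "countable {x. \<not> isCont (bv_variation T g) x}"
    by (rule mono_ctble_discont[OF mono_bv_variation[OF T g]])
  then have "{x. \<not> isCont (bv_variation T g) x} \<in> null_sets lebesgue"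
    by (intro null_sets_completionI countable_imp_null_set_lborel)
  then have "AE x in lebesgue. isCont (bv_variation T g) x" by (rule AE_not_in[THEN eventually_mono]) simp
  with AE_lebesgue_neq[of 0] AE_lebesgue_neq[of T] show ?thesis
  proof eventually_elim
    case (elim x)
    show ?case
    proof (cases "x \<in> {0<..<T}")
      case True
      then show ?thesis using bv_step_tendsto[OF True elim(3)] by (simp add: zero_ext_simps)
    next
      case False
      then have "x \<notin> {0..T}" using elim by auto
      then have "bv_step n x = 0" "zero_ext T g x = 0" for n
        using bv_step_outside[of x n] by (auto simp: zero_ext_def)
      then show ?thesis by simp
    qed
  qed
qed

lemma zero_ext_measurable_lebesgue: "zero_ext T g \<in> borel_measurable lebesgue"
  using zero_ext_measurable[OF T g] by (simp add: measurable_completion)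

text \<open>The increments of \<open>\<Phi>\<close> are required to be integrals of \<open>\<psi>\<close> only where \<open>\<bar>g\<bar>\<close> is bounded below,
  because integrability of \<open>g \<psi>\<close> says nothing about \<open>\<psi>\<close> near the zeros of \<open>g\<close>.\<close>

theorem ls_integral_by_parts:
  assumes \<Phi>: "continuous_on {0..T} \<Phi>"
    and int: "set_integrable lebesgue {0..T} (\<lambda>x. g x * \<psi> x)"
    and inc: "\<And>c d e. 0 \<le> c \<Longrightarrow> c \<le> d \<Longrightarrow> d \<le> T \<Longrightarrow> 0 < e \<Longrightarrow> (\<And>x. x \<in> {c..d} \<Longrightarrow> e \<le> \<bar>g x\<bar>) \<Longrightarrow>
      \<Phi> d - \<Phi> c = (LINT x:{c..d}|lebesgue. \<psi> x)"
  shows "ls_integral T g \<Phi> = - (LINT x:{0..T}|lebesgue. g x * \<psi> x)"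
proof -
  define q where "q x = zero_ext T g x * \<psi> x" for x
  have q: "q = (\<lambda>x. indicator {0..T} x *\<^sub>R (g x * \<psi> x))" by (auto simp: q_def zero_ext_def indicator_def)
  have qint: "integrable lebesgue q" using int unfolding set_integrable_def q .
  let ?x = "grid T"
  \<comment> \<open>A nonzero coefficient forces |g| to be at least |bv_coeff n i| > 0 on the closed
    cell, so \<psi> = q / g is measurable and integrable there and \<open>inc\<close> applies with
    this lower bound. A zero coefficient makes both claims trivial.\<close>
  have piece: "integrable lebesgue (\<lambda>x. bv_coeff n i * (indicator {?x n i<..?x n (Suc i)} x * \<psi> x))"
    "(LINT x|lebesgue. bv_coeff n i * (indicator {?x n i<..?x n (Suc i)} x * \<psi> x)) = bv_coeff n i * (\<Phi> (?x n (Suc i)) - \<Phi> (?x n i))"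
    if i: "i < n" for n i
  proof (atomize (full), cases "bv_coeff n i = 0")
    case False
    let ?I = "{?x n i..?x n (Suc i)}"
    have low: "\<bar>bv_coeff n i\<bar> \<le> \<bar>zero_ext T g x\<bar>" if "x \<in> ?I" for x using bv_coeff_le[OF that] .
    have "integrable lebesgue (\<lambda>x. indicator ?I x *\<^sub>R \<psi> x)"
    proof (rule Bochner_Integration.integrable_bound)
      show "integrable lebesgue (\<lambda>x. q x / \<bar>bv_coeff n i\<bar>)" using qint by simp
      have eq: "(\<lambda>x. indicator ?I x *\<^sub>R \<psi> x) = (\<lambda>x. indicator ?I x / zero_ext T g x * q x)"
        using low False by (fastforce simp: q_def indicator_def)
      show "(\<lambda>x. indicator ?I x *\<^sub>R \<psi> x) \<in> borel_measurable lebesgue"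
        unfolding eq using zero_ext_measurable_lebesgue qint
        by (intro borel_measurable_times borel_measurable_divide borel_measurable_indicator) auto
      show "AE x in lebesgue. norm (indicator ?I x *\<^sub>R \<psi> x) \<le> norm (q x / \<bar>bv_coeff n i\<bar>)"
      proof (intro AE_I2)
        fix x
        show "norm (indicator ?I x *\<^sub>R \<psi> x) \<le> norm (q x / \<bar>bv_coeff n i\<bar>)"
        proof (cases "x \<in> ?I")
          case True
          have "\<bar>bv_coeff n i\<bar> * \<bar>\<psi> x\<bar> \<le> \<bar>zero_ext T g x\<bar> * \<bar>\<psi> x\<bar>" using low[OF True] by (rule mult_right_mono) simp
          then show ?thesis using True False by (simp add: q_def abs_mult field_simps)
        qed simp
      qed
    qed
    then have si: "set_integrable lebesgue ?I \<psi>" by (simp add: set_integrable_def)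
    have "\<Phi> (?x n (Suc i)) - \<Phi> (?x n i) = (LINT x:?I|lebesgue. \<psi> x)"
    proof (rule inc[of _ _ "\<bar>bv_coeff n i\<bar>"])
      show "\<bar>bv_coeff n i\<bar> \<le> \<bar>g x\<bar>" if "x \<in> ?I" for x
        using low[OF that] grid_cell_subset[OF i] that by (simp add: zero_ext_simps subset_iff)
    qed (use False grid_in[of T i n] grid_in[of T "Suc i" n] i T monoD[OF mono_grid, of T i "Suc i"] in auto)
    then have eq: "(LINT x:{?x n i<..?x n (Suc i)}|lebesgue. \<psi> x) = \<Phi> (?x n (Suc i)) - \<Phi> (?x n i)"
      using set_integral_Ioc_lebesgue[OF si] by simp
    have "set_integrable lebesgue {?x n i<..?x n (Suc i)} \<psi>" by (rule set_integrable_subset[OF si]) auto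
    then show "integrable lebesgue (\<lambda>x. bv_coeff n i * (indicator {?x n i<..?x n (Suc i)} x * \<psi> x)) \<and>
      (LINT x|lebesgue. bv_coeff n i * (indicator {?x n i<..?x n (Suc i)} x * \<psi> x)) = bv_coeff n i * (\<Phi> (?x n (Suc i)) - \<Phi> (?x n i))"
      using eq by (simp add: set_integrable_def set_lebesgue_integral_def)
  qed simp
  have S: "(\<lambda>x. bv_step n x * \<psi> x) = (\<lambda>x. \<Sum>i<n. bv_coeff n i * (indicator {?x n i<..?x n (Suc i)} x * \<psi> x))" for n
    by (simp only: bv_step_def sum_distrib_right mult.assoc)
  have intS: "integrable lebesgue (\<lambda>x. bv_step n x * \<psi> x)" for n
    unfolding S using piece(1) by (intro Bochner_Integration.integrable_sum) auto
  have LS: "(LINT x|lebesgue. bv_step n x * \<psi> x) = - (\<Sum>i<n. bv_coeff n i * (\<Phi> (?x n i) - \<Phi> (?x n (Suc i))))" for n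
  proof -
    have "(LINT x|lebesgue. bv_step n x * \<psi> x) = (\<Sum>i<n. bv_coeff n i * (\<Phi> (?x n (Suc i)) - \<Phi> (?x n i)))"
      unfolding S using piece(1)
      by (subst Bochner_Integration.integral_sum) (auto intro!: sum.cong piece(2) simp del: Bochner_Integration.integral_mult_right_zero mult_cancel_left)
    also have "\<dots> = - (\<Sum>i<n. bv_coeff n i * (\<Phi> (?x n i) - \<Phi> (?x n (Suc i))))"
      unfolding sum_negf[symmetric] by (intro sum.cong) (auto simp: algebra_simps)
    finally show ?thesis .
  qed
  have "(\<lambda>n. LINT x|lebesgue. bv_step n x * \<psi> x) \<longlonglongrightarrow> (LINT x|lebesgue. q x)"
  proof (rule integral_dominated_convergence[where w="\<lambda>x. \<bar>q x\<bar>"])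
    show "AE x in lebesgue. (\<lambda>n. bv_step n x * \<psi> x) \<longlonglongrightarrow> q x"
      using AE_bv_step_tendsto by eventually_elim (auto simp: q_def intro: tendsto_mult_right)
    show "AE x in lebesgue. norm (bv_step n x * \<psi> x) \<le> \<bar>q x\<bar>" for n
      using bv_step_le by (intro AE_I2) (auto simp: q_def abs_mult intro: mult_right_mono)
  qed (use qint intS in auto)
  moreover have "(\<lambda>n. LINT x|lebesgue. bv_step n x * \<psi> x) \<longlonglongrightarrow> - ls_integral T g \<Phi>"
    unfolding LS by (intro tendsto_minus ls_integral_riemann_stieltjes[OF T g \<Phi>] bv_coeff_close)
  ultimately have "- ls_integral T g \<Phi> = (LINT x|lebesgue. q x)" using LIMSEQ_unique by blast
  then show ?thesis by (simp add: set_lebesgue_integral_def q)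
qed

text \<open>The bound already holds for the sum at every n: the cells are disjoint, so the moduli of
  the coefficients weighted by p add up to the integral of |bv_step n| p, and |bv_step n| is at most
  |g| on [0, T]. A limit is taken on the left side only.\<close>

theorem ls_integral_le:
  assumes \<Phi>: "continuous_on {0..T} \<Phi>" and p: "set_integrable lebesgue {0..T} p" "\<And>x. 0 \<le> p x" and A: "0 \<le> A"
    and inc: "\<And>c d. 0 \<le> c \<Longrightarrow> c \<le> d \<Longrightarrow> d \<le> T \<Longrightarrow> \<bar>\<Phi> d - \<Phi> c\<bar> \<le> A * (LINT x:{c..d}|lebesgue. p x)"
  shows "\<bar>ls_integral T g \<Phi>\<bar> \<le> A * (LINT x:{0..T}|lebesgue. \<bar>g x\<bar> * p x)"
proof (rule tendsto_upperbound)
  let ?x = "grid T" and ?p = "\<lambda>x. indicator {0..T} x * p x"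
  show "(\<lambda>n. \<bar>\<Sum>i<n. bv_coeff n i * (\<Phi> (?x n i) - \<Phi> (?x n (Suc i)))\<bar>) \<longlonglongrightarrow> \<bar>ls_integral T g \<Phi>\<bar>"
    by (intro tendsto_rabs ls_integral_riemann_stieltjes[OF T g \<Phi>] bv_coeff_close)
  have pint: "integrable lebesgue ?p" using p(1) by (simp add: set_integrable_def)
  have gint: "integrable lebesgue (\<lambda>x. \<bar>zero_ext T g x\<bar> * ?p x)"
  proof (rule Bochner_Integration.integrable_bound)
    show "integrable lebesgue (\<lambda>x. bv_variation T g T * ?p x)" using pint by simp
    show "(\<lambda>x. \<bar>zero_ext T g x\<bar> * ?p x) \<in> borel_measurable lebesgue"
      by (rule borel_measurable_times[OF borel_measurable_abs[OF zero_ext_measurable_lebesgue] borel_measurable_integrable[OF pint]])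
    show "AE x in lebesgue. norm (\<bar>zero_ext T g x\<bar> * ?p x) \<le> norm (bv_variation T g T * ?p x)"
      using zero_ext_bounded[OF T g] bv_variation_nonneg[OF T g, of T]
      by (intro AE_I2) (auto simp: abs_mult intro!: mult_right_mono)
  qed
  have "\<bar>\<Sum>i<n. bv_coeff n i * (\<Phi> (?x n i) - \<Phi> (?x n (Suc i)))\<bar> \<le> A * (LINT x:{0..T}|lebesgue. \<bar>g x\<bar> * p x)" for n
  proof -
    have cell: "\<bar>\<Phi> (?x n i) - \<Phi> (?x n (Suc i))\<bar> \<le> A * (LINT x|lebesgue. indicator {?x n i<..?x n (Suc i)} x * ?p x)"
      and celli: "integrable lebesgue (\<lambda>x. indicator {?x n i<..?x n (Suc i)} x * ?p x)"
      if i: "i < n" for i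
    proof -
      have si: "set_integrable lebesgue {?x n i..?x n (Suc i)} p"
        using grid_cell_subset[OF i] by (intro set_integrable_subset[OF p(1)]) auto
      have eq: "indicator {?x n i<..?x n (Suc i)} x * ?p x = indicator {?x n i<..?x n (Suc i)} x *\<^sub>R p x" for x
        using grid_cell_subset[OF i] by (auto simp: indicator_def subset_iff)
      have "\<bar>\<Phi> (?x n i) - \<Phi> (?x n (Suc i))\<bar> \<le> A * (LINT x:{?x n i..?x n (Suc i)}|lebesgue. p x)"
        using inc[of "?x n i" "?x n (Suc i)"] grid_in[of T i n] grid_in[of T "Suc i" n] i T monoD[OF mono_grid, of T i "Suc i"]
        by (auto simp: abs_minus_commute)
      then show "\<bar>\<Phi> (?x n i) - \<Phi> (?x n (Suc i))\<bar> \<le> A * (LINT x|lebesgue. indicator {?x n i<..?x n (Suc i)} x * ?p x)"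
        unfolding eq set_integral_Ioc_lebesgue[OF si, symmetric] by (simp add: set_lebesgue_integral_def)
      have "set_integrable lebesgue {?x n i<..?x n (Suc i)} p" by (rule set_integrable_subset[OF si]) auto
      then show "integrable lebesgue (\<lambda>x. indicator {?x n i<..?x n (Suc i)} x * ?p x)"
        unfolding eq set_integrable_def .
    qed
    have "\<bar>\<Sum>i<n. bv_coeff n i * (\<Phi> (?x n i) - \<Phi> (?x n (Suc i)))\<bar>
        \<le> (\<Sum>i<n. \<bar>bv_coeff n i\<bar> * (A * (LINT x|lebesgue. indicator {?x n i<..?x n (Suc i)} x * ?p x)))"
      using cell by (intro order_trans[OF sum_abs] sum_mono) (auto simp: abs_mult intro!: mult_left_mono)
    also have "\<dots> = A * (\<Sum>i<n. LINT x|lebesgue. \<bar>bv_coeff n i\<bar> * (indicator {?x n i<..?x n (Suc i)} x * ?p x))"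
      by (simp only: Bochner_Integration.integral_mult_right_zero sum_distrib_left mult.left_commute[of _ A])
    also have "(\<Sum>i<n. LINT x|lebesgue. \<bar>bv_coeff n i\<bar> * (indicator {?x n i<..?x n (Suc i)} x * ?p x))
        = (LINT x|lebesgue. (\<Sum>i<n. \<bar>bv_coeff n i\<bar> * (indicator {?x n i<..?x n (Suc i)} x * ?p x)))"
      using celli by (intro Bochner_Integration.integral_sum[symmetric]) auto
    also have "\<dots> \<le> (LINT x|lebesgue. \<bar>zero_ext T g x\<bar> * ?p x)"
    proof (rule integral_mono[OF _ gint])
      show "integrable lebesgue (\<lambda>x. \<Sum>i<n. \<bar>bv_coeff n i\<bar> * (indicator {?x n i<..?x n (Suc i)} x * ?p x))"
        using celli by (intro Bochner_Integration.integrable_sum) auto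
      fix x
      have "(\<Sum>i<n. \<bar>bv_coeff n i\<bar> * (indicator {?x n i<..?x n (Suc i)} x * ?p x)) = \<bar>bv_step n x\<bar> * ?p x"
      proof (cases "x \<in> {0<..T} \<and> 0 < n")
        case True
        then obtain j where j: "j < n" "x \<in> {?x n j<..?x n (Suc j)}" using grid_cell_ex by blast
        have "x \<notin> {?x n i<..?x n (Suc i)}" if "i \<noteq> j" for i
          using disjoint_family_Ioc[OF mono_grid, of T n] T j(2) that unfolding disjoint_family_on_def by fastforce
        then have "(\<Sum>i<n. \<bar>bv_coeff n i\<bar> * (indicator {?x n i<..?x n (Suc i)} x * ?p x)) = (\<Sum>i<n. if i = j then \<bar>bv_coeff n j\<bar> * ?p x else 0)"
          using j(2) by (intro sum.cong) auto
        then show ?thesis using j(1) by (simp add: bv_step_eq[OF j])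
      next
        case False
        have "indicator {?x n i<..?x n (Suc i)} x = (0::real)" if "i < n" for i
          using False that grid_in[of T i n] grid_in[of T "Suc i" n] T by (auto simp: indicator_def)
        then show ?thesis using False bv_step_outside[of x n] by (auto simp: bv_step_def)
      qed
      also have "\<dots> \<le> \<bar>zero_ext T g x\<bar> * ?p x" using bv_step_le p(2) by (intro mult_right_mono) auto
      finally show "(\<Sum>i<n. \<bar>bv_coeff n i\<bar> * (indicator {?x n i<..?x n (Suc i)} x * ?p x)) \<le> \<bar>zero_ext T g x\<bar> * ?p x" .
    qed
    also have "\<dots> = (LINT x:{0..T}|lebesgue. \<bar>g x\<bar> * p x)"
      unfolding set_lebesgue_integral_def by (intro Bochner_Integration.integral_cong) (auto simp: zero_ext_def indicator_def)
    finally show ?thesis using A by (simp add: mult_left_mono)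
  qed
  then show "\<forall>\<^sub>F n in sequentially. \<bar>\<Sum>i<n. bv_coeff n i * (\<Phi> (?x n i) - \<Phi> (?x n (Suc i)))\<bar> \<le> A * (LINT x:{0..T}|lebesgue. \<bar>g x\<bar> * p x)"
    by simp
qed simp

end

section \<open>Iterated integrals and covariance inner products\<close>

lemma lebesgue_integral_AE_eq:
  fixes f h :: "real \<Rightarrow> real"
  assumes f: "f \<in> borel_measurable borel" and ae: "AE x in lborel. f x = h x"
  shows "integrable lebesgue h \<longleftrightarrow> integrable lborel f" "(LINT x|lebesgue. h x) = (LINT x|lborel. f x)"
proof -
  have ae': "AE x in lebesgue. f x = h x" using ae by (rule AE_completion)
  have fm: "f \<in> borel_measurable lebesgue" using f by (simp add: measurable_completion)
  note hm = borel_measurable_AE[OF fm ae']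
  show "integrable lebesgue h \<longleftrightarrow> integrable lborel f"
    using integrable_cong_AE[OF fm hm ae'] integrable_completion[of f lborel] f by simp
  show "(LINT x|lebesgue. h x) = (LINT x|lborel. f x)"
    using integral_cong_AE[OF fm hm ae'] integral_completion[of f lborel] f by simp
qed

text \<open>The exceptional set is first enclosed in a Borel null set N, because exchanging the
  order of the two quantifiers requires measurability.\<close>

lemma AE_lborel_sections:
  fixes P :: "real \<times> real \<Rightarrow> bool"
  assumes "AE z in lborel. P z"
  shows "AE x in lborel. AE y in lborel. P (x, y)" "AE y in lborel. AE x in lborel. P (x, y)"
proof -
  from assms obtain N :: "(real \<times> real) set" where N: "{z. \<not> P z} \<subseteq> N" "N \<in> null_sets lborel"
    by (auto elim!: AE_E simp: null_sets_def)
  then have N': "N \<in> null_sets (lborel \<Otimes>\<^sub>M lborel)" by (simp add: lborel_prod)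
  then have ae: "AE x in lborel. AE y in lborel. (x, y) \<notin> N"
    by (intro lborel_pair.AE_pair[of "\<lambda>z. z \<notin> N", simplified]) (auto dest: AE_not_in)
  have ae2: "AE y in lborel. AE x in lborel. (x, y) \<notin> N"
  proof (rule iffD1[OF lborel_pair.AE_commute ae])
    have "{z \<in> space (lborel \<Otimes>\<^sub>M lborel). (fst z, snd z) \<notin> N} = space (lborel \<Otimes>\<^sub>M lborel) - N" by auto
    then show "{z \<in> space (lborel \<Otimes>\<^sub>M lborel). (fst z, snd z) \<notin> N} \<in> sets (lborel \<Otimes>\<^sub>M lborel)"
      using N' by (simp only: null_setsD2 sets.compl_sets)
  qed
  have P: "P z" if "z \<notin> N" for z using N(1) that by auto
  show "AE x in lborel. AE y in lborel. P (x, y)"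
    using ae by (rule eventually_mono) (erule eventually_mono, rule P)
  show "AE y in lborel. AE x in lborel. P (x, y)"
    using ae2 by (rule eventually_mono) (erule eventually_mono, rule P)
qed

lemma lebesgue_iterated_integral:
  fixes R R' :: "real \<Rightarrow> real \<Rightarrow> real"
  assumes ae: "AE x in lborel. AE y in lborel. R' x y = R x y"
    and int: "integrable (lborel \<Otimes>\<^sub>M lborel) (\<lambda>(x, y). R' x y)"
  shows "integrable lebesgue (\<lambda>x. LINT y|lebesgue. R x y)"
    "(LINT x|lebesgue. LINT y|lebesgue. R x y) = (LINT z|(lborel \<Otimes>\<^sub>M lborel). (case z of (x, y) \<Rightarrow> R' x y))"
proof -
  have m: "(\<lambda>(x, y). R' x y) \<in> borel_measurable (lborel \<Otimes>\<^sub>M lborel)" using int by auto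
  have R'm: "R' x \<in> borel_measurable borel" for x
    using measurable_Pair2[OF m, of x] by simp
  have ae1: "AE x in lborel. (LINT y|lborel. R' x y) = (LINT y|lebesgue. R x y)"
    using ae by eventually_elim (rule lebesgue_integral_AE_eq(2)[OF R'm, symmetric])
  have om: "(\<lambda>x. LINT y|lborel. R' x y) \<in> borel_measurable borel"
    using lborel.borel_measurable_lebesgue_integral[OF m] by simp
  show "integrable lebesgue (\<lambda>x. LINT y|lebesgue. R x y)"
    unfolding lebesgue_integral_AE_eq(1)[OF om ae1] using lborel_pair.integrable_fst'[OF int] by simp
  show "(LINT x|lebesgue. LINT y|lebesgue. R x y) = (LINT z|(lborel \<Otimes>\<^sub>M lborel). (case z of (x, y) \<Rightarrow> R' x y))"
    unfolding lebesgue_integral_AE_eq(2)[OF om ae1] using lborel_pair.integral_fst'[OF int] by simp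
qed

text \<open>\<open>lebesgue\<close> on the plane is the completion of the product of two copies of
  \<open>lborel\<close>, not itself a product measure. Fubini's theorem is therefore applied to a
  Borel version Q' and carried back to Q along almost every section.\<close>

lemma lebesgue_Fubini:
  fixes Q :: "real \<times> real \<Rightarrow> real"
  assumes "integrable lebesgue Q"
  shows "integrable lebesgue (\<lambda>x. LINT y|lebesgue. Q (x, y))"
    and "(LINT x|lebesgue. LINT y|lebesgue. Q (x, y)) = (LINT z|lebesgue. Q z)"
    and "(LINT y|lebesgue. LINT x|lebesgue. Q (x, y)) = (LINT z|lebesgue. Q z)"
proof -
  obtain Q' where Q'[measurable]: "Q' \<in> borel_measurable lborel" and ae: "AE z in lborel. Q z = Q' z"
    using completion_ex_borel_measurable_real[of Q lborel] assms by auto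
  have ae': "AE z in lebesgue. Q z = Q' z" using ae by (rule AE_completion)
  have Q'm: "Q' \<in> borel_measurable lebesgue" using Q' by (rule measurable_completion)
  have "integrable lebesgue Q'"
    using assms integrable_cong_AE[OF borel_measurable_integrable[OF assms] Q'm ae'] by simp
  then have "integrable lborel Q'" using integrable_completion[OF Q'] by simp
  then have int: "integrable (lborel \<Otimes>\<^sub>M lborel) (\<lambda>(x, y). Q' (x, y))" by (simp add: lborel_prod)
  have val: "(LINT z|lebesgue. Q z) = (LINT z|(lborel \<Otimes>\<^sub>M lborel). Q' z)"
    using integral_cong_AE[OF borel_measurable_integrable[OF assms] Q'm ae'] integral_completion[OF Q']
    by (simp add: lborel_prod)
  have s: "AE x in lborel. AE y in lborel. Q' (x, y) = Q (x, y)" "AE y in lborel. AE x in lborel. Q' (x, y) = Q (x, y)"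
    using AE_lborel_sections[OF ae] by (simp_all add: eq_commute)
  show "integrable lebesgue (\<lambda>x. LINT y|lebesgue. Q (x, y))"
    "(LINT x|lebesgue. LINT y|lebesgue. Q (x, y)) = (LINT z|lebesgue. Q z)"
    using lebesgue_iterated_integral[OF s(1) int] by (simp_all add: val)
  have int': "integrable (lborel \<Otimes>\<^sub>M lborel) (\<lambda>(y, x). Q' (x, y))"
    using lborel_pair.integrable_product_swap[OF int] by (simp add: split_beta)
  have "(LINT z|(lborel \<Otimes>\<^sub>M lborel). (case z of (y, x) \<Rightarrow> Q' (x, y))) = (LINT z|(lborel \<Otimes>\<^sub>M lborel). Q' z)"
    using lborel_pair.integral_product_swap[of Q'] by (simp add: lborel_prod)
  then show "(LINT y|lebesgue. LINT x|lebesgue. Q (x, y)) = (LINT z|lebesgue. Q z)"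
    using lebesgue_iterated_integral(2)[OF s(2) int'] by (simp add: val)
qed

section \<open>Stieltjes integrals depending on a parameter\<close>

context
  fixes T :: real and g :: "real \<Rightarrow> real"
  assumes T: "0 < T" and g: "g \<in> bv_functions T"
begin

lemma ls_integral_cong:
  "(\<And>x. x \<in> {0..T} \<Longrightarrow> h x = k x) \<Longrightarrow> ls_integral T g h = ls_integral T g k"
  unfolding ls_integral_def
  by (intro arg_cong2[where f="(-)"] set_lebesgue_integral_cong) (auto simp: sets_ls[OF T g])

lemma ls_integral_diff:
  assumes "continuous_on {0..T} h" "continuous_on {0..T} k"
  shows "ls_integral T g (\<lambda>x. h x - k x) = ls_integral T g h - ls_integral T g k"
proof -
  have "(LINT x:{0..T}|m. h x - k x) = (LINT x:{0..T}|m. h x) - (LINT x:{0..T}|m. k x)"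
    if m: "finite_measure m" "sets m = sets borel" for m
    by (intro set_integral_diff(2) set_integrable_finite_measure_continuous[OF m assms(1)]
        set_integrable_finite_measure_continuous[OF m assms(2)]) auto
  from this[OF finite_ls(1)[OF T g] sets_ls(1)[OF T g]] this[OF finite_ls(2)[OF T g] sets_ls(2)[OF T g]]
  show ?thesis unfolding ls_integral_def by linarith
qed

lemma abs_ls_integral_le:
  assumes h: "continuous_on {0..T} h" and B: "\<And>x. x \<in> {0..T} \<Longrightarrow> \<bar>h x\<bar> \<le> B"
  shows "\<bar>ls_integral T g h\<bar> \<le> B * (measure (ls_plus T g) {0..T} + measure (ls_minus T g) {0..T})"
proof -
  have *: "\<bar>LINT x:{0..T}|m. h x\<bar> \<le> B * measure m {0..T}" if m: "finite_measure m" "sets m = sets borel" for m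
  proof -
    have int: "set_integrable m {0..T} h" by (rule set_integrable_finite_measure_continuous[OF m h]) auto
    have fin: "emeasure m {0..T} \<noteq> \<infinity>" using finite_measure.emeasure_finite[OF m(1)] by simp
    have intB: "set_integrable m {0..T} (\<lambda>_. B)" using fin m(2) by (auto simp: set_integrable_def top.not_eq_extremum)
    have "\<bar>LINT x:{0..T}|m. h x\<bar> \<le> (LINT x:{0..T}|m. \<bar>h x\<bar>)"
      using set_integral_norm_bound[OF int] by simp
    also have "\<dots> \<le> (LINT x:{0..T}|m. B)"
      using int intB B by (intro set_integral_mono set_integrable_abs) auto
    also have "\<dots> = B * measure m {0..T}"
      using set_integral_const[of "{0..T}" m B] fin m(2) by (simp add: mult.commute)
    finally show ?thesis .
  qed
  show ?thesis
    using *[OF finite_ls(1)[OF T g] sets_ls(1)[OF T g]] *[OF finite_ls(2)[OF T g] sets_ls(2)[OF T g]]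
    unfolding ls_integral_def distrib_left by linarith
qed

lemma section_continuous:
  assumes "continuous_on ({0..T} \<times> {0..T}) (\<lambda>(s, t). K s t)" "s \<in> {0..T}"
  shows "continuous_on {0..T} (K s)"
  using assms(2) by (intro continuous_on_compose2[OF assms(1), of "{0..T}" "\<lambda>t. (s, t)", simplified])
    (auto intro!: continuous_intros)

text \<open>Uniform continuity of K on the square is played against the finite total mass. This
  makes the inner Stieltjes integral an admissible \<Phi> for the outer one.\<close>

lemma continuous_on_ls_integral:
  assumes K: "continuous_on ({0..T} \<times> {0..T}) (\<lambda>(s, t). K s t)"
  shows "continuous_on {0..T} (\<lambda>s. ls_integral T g (K s))"
  unfolding continuous_on_iff
proof (intro ballI allI impI)
  fix s \<epsilon> :: real assume s: "s \<in> {0..T}" and \<epsilon>: "0 < \<epsilon>"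
  let ?M = "measure (ls_plus T g) {0..T} + measure (ls_minus T g) {0..T}"
  define e where "e = \<epsilon> / (?M + 1)"
  have M: "0 < ?M + 1" by (intro add_nonneg_pos add_nonneg_nonneg) auto
  then have e: "0 < e" using \<epsilon> unfolding e_def by (intro divide_pos_pos)
  have "uniformly_continuous_on ({0..T} \<times> {0..T}) (\<lambda>(s, t). K s t)"
    by (rule compact_uniformly_continuous[OF K]) (auto intro: compact_Times)
  then obtain d where d: "0 < d" "\<And>z w. z \<in> {0..T} \<times> {0..T} \<Longrightarrow> w \<in> {0..T} \<times> {0..T} \<Longrightarrow> dist w z < d \<Longrightarrow>
      dist (case w of (s, t) \<Rightarrow> K s t) (case z of (s, t) \<Rightarrow> K s t) < e"
    using e unfolding uniformly_continuous_on_def by metis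
  have "dist (ls_integral T g (K s')) (ls_integral T g (K s)) < \<epsilon>" if s': "s' \<in> {0..T}" "dist s' s < d" for s'
  proof -
    have "\<bar>K s' t - K s t\<bar> \<le> e" if "t \<in> {0..T}" for t
      using d(2)[of "(s, t)" "(s', t)"] s s' that by (auto simp: dist_Pair_Pair dist_real_def less_imp_le)
    then have "\<bar>ls_integral T g (\<lambda>t. K s' t - K s t)\<bar> \<le> e * ?M"
      using s s' by (intro abs_ls_integral_le continuous_on_diff section_continuous[OF K]) auto
    also have "\<dots> < e * (?M + 1)" using e by simp
    also have "\<dots> = \<epsilon>" using M unfolding e_def by (metis nonzero_divide_eq_eq less_irrefl)
    finally show ?thesis
      using s s' by (simp add: dist_real_def ls_integral_diff section_continuous[OF K])
  qed
  with d(1) show "\<exists>d>0. \<forall>s'\<in>{0..T}. dist s' s < d \<longrightarrow> dist (ls_integral T g (K s')) (ls_integral T g (K s)) < \<epsilon>" by blast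
qed

lemma set_integrable_bv_mult:
  assumes "set_integrable lebesgue {0..T} p"
  shows "set_integrable lebesgue {0..T} (\<lambda>x. g x * p x)"
  unfolding set_integrable_def
proof (rule Bochner_Integration.integrable_bound)
  let ?p = "\<lambda>x. indicator {0..T} x *\<^sub>R p x"
  have p: "integrable lebesgue ?p" using assms by (simp add: set_integrable_def)
  then show "integrable lebesgue (\<lambda>x. bv_variation T g T * ?p x)" by (rule integrable_mult_right)
  have eq: "(\<lambda>x. indicator {0..T} x *\<^sub>R (g x * p x)) = (\<lambda>x. zero_ext T g x * ?p x)"
    by (auto simp: zero_ext_def indicator_def)
  show "(\<lambda>x. indicator {0..T} x *\<^sub>R (g x * p x)) \<in> borel_measurable lebesgue"
    unfolding eq by (rule borel_measurable_times[OF zero_ext_measurable_lebesgue[OF T g] borel_measurable_integrable[OF p]])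
  show "AE x in lebesgue. norm (indicator {0..T} x *\<^sub>R (g x * p x)) \<le> norm (bv_variation T g T * ?p x)"
    using zero_ext_bounded[OF T g] bv_variation_nonneg[OF T g, of T]
    by (intro AE_I2) (auto simp: fun_eq_iff abs_mult indicator_def zero_ext_def intro!: mult_right_mono; metis atLeastAtMost_iff)
qed

end

lemma cov_inner_diff:
  assumes T: "0 < T" and f: "f \<in> bv_functions T" and g: "g \<in> bv_functions T"
    and R: "continuous_on ({0..T} \<times> {0..T}) (\<lambda>(s, t). R s t)"
    and S: "continuous_on ({0..T} \<times> {0..T}) (\<lambda>(s, t). S s t)"
  shows "cov_inner R T f g - cov_inner S T f g = cov_inner (\<lambda>s t. R s t - S s t) T f g"
proof -
  have "cov_inner R T f g - cov_inner S T f g = ls_integral T g (\<lambda>s. ls_integral T f (R s) - ls_integral T f (S s))"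
    unfolding cov_inner_def
    by (rule ls_integral_diff[OF T g, symmetric]) (intro continuous_on_ls_integral[OF T f] R S)+
  also have "\<dots> = cov_inner (\<lambda>s t. R s t - S s t) T f g"
    unfolding cov_inner_def
    by (intro ls_integral_cong[OF T g] ls_integral_diff[OF T f, symmetric] section_continuous[OF T f R] section_continuous[OF T f S])
  finally show ?thesis .
qed

section \<open>The fractional Brownian covariance and the weight x^(H-1)\<close>

lemma fbm_cov_continuous:
  assumes "0 < H"
  shows "continuous_on ({0..T} \<times> {0..T}) (\<lambda>(s, t). fbm_cov H s t)"
  unfolding fbm_cov_def split_beta using assms
  by (intro continuous_intros continuous_on_powr') (auto simp: mem_Times_iff)

text \<open>On [0, T] the covariance is, up to a constant in t, half the difference of |t - 0| powr
  (2 H) and |t - s| powr (2 H), so \<open>is_primitive_abs_powr\<close> handles both singular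
  points.\<close>

lemma fbm_cov_primitive:
  assumes "0 < H"
  shows "is_primitive 0 T (deriv (fbm_cov H s)) (fbm_cov H s)"
proof -
  have H2: "0 < 2 * H" using assms by simp
  obtain \<phi> where 1: "is_primitive 0 T \<phi> (\<lambda>t. \<bar>t - 0\<bar> powr (2 * H))" by (rule is_primitive_abs_powr[OF H2])
  obtain \<psi> where 2: "is_primitive 0 T \<psi> (\<lambda>t. \<bar>t - s\<bar> powr (2 * H))" by (rule is_primitive_abs_powr[OF H2])
  have "is_primitive 0 T (\<lambda>x. 1 / 2 * (\<phi> x - \<psi> x)) (fbm_cov H s)"
    by (rule is_primitive_transform[OF is_primitive_cmult[OF is_primitive_diff[OF 1 2]], where c="s powr (2 * H) / 2"])
       (auto simp: fbm_cov_def field_simps)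
  then show ?thesis by (rule is_primitive_deriv)
qed

text \<open>Integrability is read off from the primitive |t| powr H: its density must agree almost
  everywhere with the classical derivative H * x powr (H - 1).\<close>

lemma set_integrable_powr:
  fixes H T :: real
  assumes "0 < H"
  shows "set_integrable lebesgue {0..T} (\<lambda>x. x powr (H - 1))"
proof -
  obtain \<phi> where \<phi>: "is_primitive 0 T \<phi> (\<lambda>t. \<bar>t - 0\<bar> powr H)" by (rule is_primitive_abs_powr[OF assms])
  have "AE x\<in>{0..T} in lebesgue. H * x powr (H - 1) = \<phi> x"
    using is_primitive_AE_deriv[OF \<phi>] AE_lebesgue_neq[of 0]
  proof eventually_elim
    case (elim x)
    show ?case
    proof
      assume "x \<in> {0..T}"
      then have x: "0 < x" and der: "((\<lambda>t. \<bar>t - 0\<bar> powr H) has_real_derivative \<phi> x) (at x)" using elim by auto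
      have "((\<lambda>t. t powr H) has_real_derivative H * x powr (H - 1)) (at x)" by (rule has_real_derivative_powr[OF x])
      then have "((\<lambda>t. \<bar>t - 0\<bar> powr H) has_real_derivative H * x powr (H - 1)) (at x)"
        by (rule has_field_derivative_transform_within_open[of _ _ _ "{0<..}"]) (use x in auto)
      then show "H * x powr (H - 1) = \<phi> x" using der by (rule DERIV_unique)
    qed
  qed
  from is_primitive_cong_AE[OF \<phi> this] have "set_integrable lebesgue {0..T} (\<lambda>x. H * x powr (H - 1))"
    by (simp add: is_primitive_def)
  then show ?thesis using assms by simp
qed

lemma nu_integral_abs:
  assumes T: "0 < T" and f: "f \<in> bv_functions T"
  shows "nu_integral H T (\<lambda>x. \<bar>f x\<bar>) = (LINT x:{0..T}|lebesgue. \<bar>f x\<bar> * x powr (H - 1))"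
proof -
  have [measurable]: "zero_ext T f \<in> borel_measurable borel" by (rule zero_ext_measurable[OF T f])
  have "nu_integral H T (\<lambda>x. \<bar>f x\<bar>) = (LINT x|density lborel (\<lambda>x. ennreal (x powr (H - 1))). \<bar>zero_ext T f x\<bar>)"
    unfolding nu_integral_def set_lebesgue_integral_def
    by (intro Bochner_Integration.integral_cong) (auto simp: zero_ext_def indicator_def)
  also have "\<dots> = (LINT x|lborel. x powr (H - 1) * \<bar>zero_ext T f x\<bar>)"
    by (subst integral_real_density) auto
  also have "\<dots> = (LINT x|lebesgue. x powr (H - 1) * \<bar>zero_ext T f x\<bar>)"
    by (subst integral_completion) auto
  also have "\<dots> = (LINT x:{0..T}|lebesgue. \<bar>f x\<bar> * x powr (H - 1))"
    unfolding set_lebesgue_integral_def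
    by (intro Bochner_Integration.integral_cong) (auto simp: zero_ext_def indicator_def)
  finally show ?thesis .
qed

section \<open>The difference of the covariances\<close>

context
  fixes T :: real and \<Delta> D :: "real \<Rightarrow> real \<Rightarrow> real" and f g :: "real \<Rightarrow> real"
  assumes T: "0 < T" and f: "f \<in> bv_functions T" and g: "g \<in> bv_functions T"
    and cont: "continuous_on ({0..T} \<times> {0..T}) (\<lambda>(s, t). \<Delta> s t)"
    and prim: "\<And>s. s \<in> {0..T} \<Longrightarrow> is_primitive 0 T (D s) (\<Delta> s)"
    and prim2: "\<And>t. t \<in> {0..T} \<Longrightarrow> is_primitive 0 T (\<lambda>s. deriv (\<lambda>s. D s t) s) (\<lambda>s. D s t)"
begin

text \<open>Integrability of the product is automatic here, since f is bounded and
  \<open>D s\<close> is integrable; this is what may fail for the outer integral.\<close>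

lemma ls_integral_section:
  assumes s: "s \<in> {0..T}"
  shows "ls_integral T f (\<Delta> s) = - (LINT t:{0..T}|lebesgue. f t * D s t)"
proof (rule ls_integral_by_parts[OF T f section_continuous[OF T f cont s]])
  show "set_integrable lebesgue {0..T} (\<lambda>t. f t * D s t)"
    using prim[OF s] by (intro set_integrable_bv_mult[OF T f]) (simp add: is_primitive_def)
  show "\<Delta> s d - \<Delta> s c = (LINT t:{c..d}|lebesgue. D s t)" if "0 \<le> c" "c \<le> d" "d \<le> T" for c d
    using is_primitiveD(2)[OF prim[OF s] that] .
qed

text \<open>Access to the increments of the outer integrand: for every t, D d t - D c t is the
  integral of the mixed derivative over [c, d].\<close>

lemma ls_integral_section_diff:
  assumes "0 \<le> c" "c \<le> d" "d \<le> T"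
  shows "ls_integral T f (\<Delta> d) - ls_integral T f (\<Delta> c) = - (LINT t:{0..T}|lebesgue. f t * (D d t - D c t))"
    and "set_integrable lebesgue {0..T} (\<lambda>t. f t * (D d t - D c t))"
proof -
  have cd: "c \<in> {0..T}" "d \<in> {0..T}" using assms by auto
  have int: "set_integrable lebesgue {0..T} (\<lambda>t. f t * D s t)" if "s \<in> {0..T}" for s
    using prim[OF that] by (intro set_integrable_bv_mult[OF T f]) (simp add: is_primitive_def)
  have "(LINT t:{0..T}|lebesgue. f t * D d t - f t * D c t) = (LINT t:{0..T}|lebesgue. f t * D d t) - (LINT t:{0..T}|lebesgue. f t * D c t)"
    by (rule set_integral_diff(2)[OF int[OF cd(2)] int[OF cd(1)]])
  then show "ls_integral T f (\<Delta> d) - ls_integral T f (\<Delta> c) = - (LINT t:{0..T}|lebesgue. f t * (D d t - D c t))"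
    unfolding ls_integral_section[OF cd(1)] ls_integral_section[OF cd(2)] right_diff_distrib by linarith
  show "set_integrable lebesgue {0..T} (\<lambda>t. f t * (D d t - D c t))"
    unfolding right_diff_distrib by (rule set_integral_diff(1)[OF int[OF cd(2)] int[OF cd(1)]])
qed

lemma cov_inner_eq_integral:
  assumes int: "set_integrable lebesgue ({0..T} \<times> {0..T}) (\<lambda>(s, t). f t * g s * deriv (\<lambda>s. D s t) s)"
  shows "cov_inner \<Delta> T f g = (LINT (s, t):{0..T} \<times> {0..T}|lebesgue. f t * g s * deriv (\<lambda>s. D s t) s)"
proof -
  define E where "E s t = deriv (\<lambda>s. D s t) s" for s t
  define Q where "Q z = indicator ({0..T} \<times> {0..T}) z *\<^sub>R (case z of (s, t) \<Rightarrow> f t * g s * E s t)" for z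
  have Q: "integrable lebesgue Q" using int unfolding set_integrable_def Q_def E_def .
  \<comment> \<open>Formal derivative in s of the inner Stieltjes integral; its minus sign cancels
    the one from the outer integration by parts.\<close>
  define \<psi> where "\<psi> s = - (LINT t:{0..T}|lebesgue. f t * E s t)" for s
  have inner: "(LINT t|lebesgue. Q (s, t)) = - (indicator {0..T} s *\<^sub>R (g s * \<psi> s))" for s
  proof -
    have "Q (s, t) = indicator {0..T} s * g s * (indicator {0..T} t *\<^sub>R (f t * E s t))" for t
      by (simp add: Q_def indicator_def)
    then show ?thesis by (simp add: \<psi>_def set_lebesgue_integral_def)
  qed
  have "ls_integral T g (\<lambda>s. ls_integral T f (\<Delta> s)) = - (LINT s:{0..T}|lebesgue. g s * \<psi> s)"
  proof (rule ls_integral_by_parts[OF T g continuous_on_ls_integral[OF T f cont]])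
    show "set_integrable lebesgue {0..T} (\<lambda>s. g s * \<psi> s)"
      using lebesgue_Fubini(1)[OF Q] unfolding inner set_integrable_def by simp
    fix c d e :: real assume cd: "0 \<le> c" "c \<le> d" "d \<le> T" and e: "0 < e" "\<And>x. x \<in> {c..d} \<Longrightarrow> e \<le> \<bar>g x\<bar>"
    \<comment> \<open>Dividing by g on the strip c <= s <= d, where |g| >= e, isolates f(t) E(s,t)
      as an integrable function of two variables, so that both orders of integration agree.\<close>
    define Q2 where "Q2 z = indicator {c..d} (fst z) / zero_ext T g (fst z) * Q z" for z
    have ze: "zero_ext T g s = g s" if "s \<in> {c..d}" for s using that cd by (simp add: zero_ext_simps)
    have Q2: "integrable lebesgue Q2"
    proof (rule Bochner_Integration.integrable_bound)
      show "integrable lebesgue (\<lambda>z. Q z / e)" using Q by simp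
      have [measurable]: "zero_ext T g \<in> borel_measurable borel" by (rule zero_ext_measurable[OF T g])
      have "(\<lambda>z::real \<times> real. indicator {c..d} (fst z) / zero_ext T g (fst z)) \<in> borel_measurable (borel \<Otimes>\<^sub>M borel)"
        by measurable
      then have "(\<lambda>z::real \<times> real. indicator {c..d} (fst z) / zero_ext T g (fst z)) \<in> borel_measurable lborel"
        by (simp add: borel_prod)
      then have "(\<lambda>z::real \<times> real. indicator {c..d} (fst z) / zero_ext T g (fst z)) \<in> borel_measurable lebesgue"
        by (rule measurable_completion)
      then show "Q2 \<in> borel_measurable lebesgue"
        unfolding Q2_def[abs_def] by (rule borel_measurable_times[OF _ borel_measurable_integrable[OF Q]])
      show "AE z in lebesgue. norm (Q2 z) \<le> norm (Q z / e)"
      proof (intro AE_I2)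
        fix z :: "real \<times> real"
        show "norm (Q2 z) \<le> norm (Q z / e)"
        proof (cases "fst z \<in> {c..d}")
          case True
          have "\<bar>Q z\<bar> / \<bar>g (fst z)\<bar> \<le> \<bar>Q z\<bar> / e"
            using e(1) e(2)[OF True] by (intro divide_left_mono) auto
          then show ?thesis using True e(1) by (simp add: Q2_def ze[OF True] abs_mult)
        qed (use e(1) in \<open>simp add: Q2_def\<close>)
      qed
    qed
    have Q2_eq: "Q2 (s, t) = indicator {c..d} s * (indicator {0..T} t * (f t * E s t))" for s t
      using cd e(1) e(2)[of s] ze[of s] by (cases "s \<in> {c..d}") (auto simp: Q2_def Q_def indicator_def)
    have "(LINT s|lebesgue. LINT t|lebesgue. Q2 (s, t)) = - (LINT s:{c..d}|lebesgue. \<psi> s)"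
      by (simp add: Q2_eq \<psi>_def set_lebesgue_integral_def)
    \<comment> \<open>In this order the integral over s is evaluated for every t by the absolute
      continuity of D in s.\<close>
    moreover have "(LINT t|lebesgue. LINT s|lebesgue. Q2 (s, t)) = (LINT t:{0..T}|lebesgue. f t * (D d t - D c t))"
    proof -
      have "(LINT s|lebesgue. Q2 (s, t)) = indicator {0..T} t *\<^sub>R (f t * (D d t - D c t))" for t
      proof (cases "t \<in> {0..T}")
        case True
        have "(LINT s|lebesgue. Q2 (s, t)) = f t * (LINT s:{c..d}|lebesgue. E s t)"
          using True by (simp add: Q2_eq set_lebesgue_integral_def mult.left_commute)
        then show ?thesis using True is_primitiveD(2)[OF prim2[OF True] cd] by (simp add: E_def)
      qed (simp add: Q2_eq)
      then show ?thesis by (simp add: set_lebesgue_integral_def)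
    qed
    ultimately show "ls_integral T f (\<Delta> d) - ls_integral T f (\<Delta> c) = (LINT s:{c..d}|lebesgue. \<psi> s)"
      using lebesgue_Fubini(2,3)[OF Q2] ls_integral_section_diff(1)[OF cd] by simp
  qed
  also have "\<dots> = (LINT s|lebesgue. LINT t|lebesgue. Q (s, t))"
    unfolding inner set_lebesgue_integral_def by simp
  also have "\<dots> = (LINT z|lebesgue. Q z)" by (rule lebesgue_Fubini(2)[OF Q])
  finally show ?thesis
    unfolding cov_inner_def by (simp add: set_lebesgue_integral_def Q_def[abs_def] E_def)
qed

text \<open>The increments of the inner integral over [c, d] are at most C nu(|f|) nu([c, d]), so
  \<open>ls_integral_le\<close> applies with A = C nu(|f|). The mixed derivative is integrated in s
  only, at fixed t, which requires no joint measurability.\<close>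

lemma cov_inner_le:
  assumes H: "0 < H" and C: "0 < C"
    and bound: "AE (s, t)\<in>{0..T} \<times> {0..T} in lborel. \<bar>deriv (\<lambda>s. D s t) s\<bar> \<le> C * (t * s) powr (H - 1)"
  shows "\<bar>cov_inner \<Delta> T f g\<bar> \<le> C * nu_integral H T (\<lambda>x. \<bar>f x\<bar>) * nu_integral H T (\<lambda>x. \<bar>g x\<bar>)"
proof -
  define p :: "real \<Rightarrow> real" where "p x = x powr (H - 1)" for x
  have p: "set_integrable lebesgue {0..T} p" unfolding p_def by (rule set_integrable_powr[OF H])
  have fp: "set_integrable lebesgue {0..T} (\<lambda>t. \<bar>f t\<bar> * p t)"
    using set_integrable_abs[OF set_integrable_bv_mult[OF T f p]] by (simp add: abs_mult p_def)
  let ?F = "LINT t:{0..T}|lebesgue. \<bar>f t\<bar> * p t"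
  have F0: "0 \<le> ?F" unfolding set_lebesgue_integral_def by (intro Bochner_Integration.integral_nonneg) (simp add: p_def)
  have ae: "AE t in lebesgue. AE s in lebesgue. t \<in> {0..T} \<longrightarrow> s \<in> {0..T} \<longrightarrow> \<bar>deriv (\<lambda>s. D s t) s\<bar> \<le> C * p t * p s"
  proof -
    \<comment> \<open>t is the outer variable because the bound is integrated in s at fixed
      t.\<close>
    have "AE t in lborel. AE s in lborel. (s, t) \<in> {0..T} \<times> {0..T} \<longrightarrow> \<bar>deriv (\<lambda>s. D s t) s\<bar> \<le> C * (t * s) powr (H - 1)"
      using AE_lborel_sections(2)[OF bound] by simp
    then have "AE t in lebesgue. AE s in lborel. (s, t) \<in> {0..T} \<times> {0..T} \<longrightarrow> \<bar>deriv (\<lambda>s. D s t) s\<bar> \<le> C * (t * s) powr (H - 1)"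
      by (rule AE_completion)
    then show ?thesis
    proof eventually_elim
      case (elim t)
      from AE_completion[OF elim] show ?case
        by eventually_elim (auto simp: p_def powr_mult mult.assoc)
    qed
  qed
  have "\<bar>ls_integral T g (\<lambda>s. ls_integral T f (\<Delta> s))\<bar> \<le> C * ?F * (LINT x:{0..T}|lebesgue. \<bar>g x\<bar> * p x)"
  proof (rule ls_integral_le[OF T g continuous_on_ls_integral[OF T f cont] p])
    show "0 \<le> p x" for x by (simp add: p_def)
    show "0 \<le> C * ?F" using C F0 by simp
    fix c d :: real assume cd: "0 \<le> c" "c \<le> d" "d \<le> T"
    let ?P = "LINT s:{c..d}|lebesgue. p s"
    have pcd: "set_integrable lebesgue {c..d} p" by (rule set_integrable_subset[OF p]) (use cd in auto)
    have inc: "AE t\<in>{0..T} in lebesgue. \<bar>D d t - D c t\<bar> \<le> C * p t * ?P"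
      using ae
    proof eventually_elim
      case (elim t)
      show ?case
      proof
        assume t: "t \<in> {0..T}"
        let ?E = "\<lambda>s. deriv (\<lambda>s. D s t) s"
        have iE: "set_integrable lebesgue {c..d} ?E" by (rule is_primitiveD(1)[OF prim2[OF t] cd])
        have "\<bar>D d t - D c t\<bar> = \<bar>LINT s:{c..d}|lebesgue. ?E s\<bar>"
          using is_primitiveD(2)[OF prim2[OF t] cd] by simp
        also have "\<dots> \<le> (LINT s:{c..d}|lebesgue. \<bar>?E s\<bar>)" using set_integral_norm_bound[OF iE] by simp
        also have "\<dots> \<le> (LINT s:{c..d}|lebesgue. C * p t * p s)"
        proof (rule set_integral_mono_AE)
          show "set_integrable lebesgue {c..d} (\<lambda>s. \<bar>?E s\<bar>)" by (rule set_integrable_abs[OF iE])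
          show "set_integrable lebesgue {c..d} (\<lambda>s. C * p t * p s)" using pcd by simp
          show "AE s\<in>{c..d} in lebesgue. \<bar>?E s\<bar> \<le> C * p t * p s"
            using elim by eventually_elim (use t cd in auto)
        qed
        also have "\<dots> = C * p t * ?P" by simp
        finally show "\<bar>D d t - D c t\<bar> \<le> C * p t * ?P" .
      qed
    qed
    note diff = ls_integral_section_diff[OF cd]
    have "\<bar>ls_integral T f (\<Delta> d) - ls_integral T f (\<Delta> c)\<bar> = \<bar>LINT t:{0..T}|lebesgue. f t * (D d t - D c t)\<bar>"
      by (simp add: diff(1))
    also have "\<dots> \<le> (LINT t:{0..T}|lebesgue. \<bar>f t * (D d t - D c t)\<bar>)"
      using set_integral_norm_bound[OF diff(2)] by simp
    also have "\<dots> \<le> (LINT t:{0..T}|lebesgue. C * ?P * (\<bar>f t\<bar> * p t))"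
    proof (rule set_integral_mono_AE)
      show "set_integrable lebesgue {0..T} (\<lambda>t. \<bar>f t * (D d t - D c t)\<bar>)" by (rule set_integrable_abs[OF diff(2)])
      show "set_integrable lebesgue {0..T} (\<lambda>t. C * ?P * (\<bar>f t\<bar> * p t))" using fp by simp
      show "AE t\<in>{0..T} in lebesgue. \<bar>f t * (D d t - D c t)\<bar> \<le> C * ?P * (\<bar>f t\<bar> * p t)"
        using inc
      proof eventually_elim
        case (elim t)
        show ?case
        proof
          assume "t \<in> {0..T}"
          then have "\<bar>f t\<bar> * \<bar>D d t - D c t\<bar> \<le> \<bar>f t\<bar> * (C * p t * ?P)" using elim by (intro mult_left_mono) auto
          then show "\<bar>f t * (D d t - D c t)\<bar> \<le> C * ?P * (\<bar>f t\<bar> * p t)" by (simp add: abs_mult mult_ac)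
        qed
      qed
    qed
    also have "\<dots> = C * ?F * ?P" by simp
    finally show "\<bar>ls_integral T f (\<Delta> d) - ls_integral T f (\<Delta> c)\<bar> \<le> C * ?F * ?P" .
  qed
  then show ?thesis
    unfolding cov_inner_def nu_integral_abs[OF T f] nu_integral_abs[OF T g] p_def .
qed

end

theorem corollary2p2:
  fixes H C :: real
  assumes "0 < H" and "H < 1" and "0 < C"
  shows "\<exists>C'>0. \<forall>T>0. \<forall>(M :: 'a measure) (G :: real \<Rightarrow> 'a \<Rightarrow> real) (D :: real \<Rightarrow> real \<Rightarrow> real).
    centred_gaussian_process M {0..T} G \<and>
    (AE \<omega> in M. G 0 \<omega> = 0) \<and>
    (AE \<omega> in M. continuous_on {0..T} (\<lambda>t. G t \<omega>)) \<and>
    continuous_on ({0..T} \<times> {0..T}) (\<lambda>(s, t). covariance M G s t) \<and>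
    (\<forall>s\<in>{0..T}. abs_continuous_on {0..T} (\<lambda>t. covariance M G s t)) \<and>
    derivative_difference H T (covariance M G) D \<and>
    (\<forall>t\<in>{0..T}. abs_continuous_on {0..T} (\<lambda>s. D s t)) \<longrightarrow>
    (\<forall>f\<in>bv_functions T. \<forall>g\<in>bv_functions T.
        set_integrable lebesgue ({0..T} \<times> {0..T}) (\<lambda>(s, t). f t * g s * deriv (\<lambda>s. D s t) s) \<longrightarrow>
        cov_inner (covariance M G) T f g - cov_inner (fbm_cov H) T f g =
        (LINT (s, t):{0..T} \<times> {0..T}|lebesgue. f t * g s * deriv (\<lambda>s. D s t) s)) \<and>
    ((AE (s, t)\<in>{0..T} \<times> {0..T} in lborel. \<bar>deriv (\<lambda>s. D s t) s\<bar> \<le> C * (t * s) powr (H - 1)) \<longrightarrow>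
     (\<forall>f\<in>bv_functions T. \<forall>g\<in>bv_functions T.
        \<bar>cov_inner (covariance M G) T f g - cov_inner (fbm_cov H) T f g\<bar> \<le>
        C' * nu_integral H T (\<lambda>x. \<bar>f x\<bar>) * nu_integral H T (\<lambda>x. \<bar>g x\<bar>)))"
proof (rule exI[of _ C], intro conjI[OF \<open>0 < C\<close>] allI impI, elim conjE)
  \<comment> \<open>The constant C of the pointwise bound serves as C'; it is fixed before T and the
    process.\<close>
  fix T :: real and M :: "'a measure" and G D
  assume T: "0 < T"
    and cont: "continuous_on ({0..T} \<times> {0..T}) (\<lambda>(s, t). covariance M G s t)"
    and ac: "\<forall>s\<in>{0..T}. abs_continuous_on {0..T} (\<lambda>t. covariance M G s t)"
    and D: "derivative_difference H T (covariance M G) D"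
    and acD: "\<forall>t\<in>{0..T}. abs_continuous_on {0..T} (\<lambda>s. D s t)"
  let ?R = "covariance M G" and ?B = "fbm_cov H"
  note contB = fbm_cov_continuous[OF \<open>0 < H\<close>, of T]
  have cont\<Delta>: "continuous_on ({0..T} \<times> {0..T}) (\<lambda>(s, t). ?R s t - ?B s t)"
    using continuous_on_diff[OF cont contB] by (simp add: split_beta)
  \<comment> \<open>\<open>D s\<close> agrees with the difference of the derivatives only almost
    everywhere, which is enough for a density of the difference of the two covariances.\<close>
  have prim: "is_primitive 0 T (D s) (\<lambda>t. ?R s t - ?B s t)" if s: "s \<in> {0..T}" for s
  proof -
    obtain \<phi> where "is_primitive 0 T \<phi> (?R s)"
      using abs_continuous_primitive ac s by blast
    then have "is_primitive 0 T (deriv (?R s)) (?R s)" by (rule is_primitive_deriv)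
    note is_primitive_diff[OF this fbm_cov_primitive[OF \<open>0 < H\<close>]]
    moreover have "AE t in lebesgue. t \<in> {0..T} \<longrightarrow> D s t = deriv (?R s) t - deriv (?B s) t"
      using D s unfolding derivative_difference_def by (intro AE_completion) auto
    ultimately show ?thesis by (rule is_primitive_cong_AE)
  qed
  have prim2: "is_primitive 0 T (\<lambda>s. deriv (\<lambda>s. D s t) s) (\<lambda>s. D s t)" if t: "t \<in> {0..T}" for t
  proof -
    obtain \<phi> where "is_primitive 0 T \<phi> (\<lambda>s. D s t)"
      using abs_continuous_primitive acD t by blast
    then show ?thesis by (rule is_primitive_deriv)
  qed
  note diff = cov_inner_diff[OF T _ _ cont contB]
  show "(\<forall>f\<in>bv_functions T. \<forall>g\<in>bv_functions T.
        set_integrable lebesgue ({0..T} \<times> {0..T}) (\<lambda>(s, t). f t * g s * deriv (\<lambda>s. D s t) s) \<longrightarrow>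
        cov_inner ?R T f g - cov_inner ?B T f g =
        (LINT (s, t):{0..T} \<times> {0..T}|lebesgue. f t * g s * deriv (\<lambda>s. D s t) s)) \<and>
    ((AE (s, t)\<in>{0..T} \<times> {0..T} in lborel. \<bar>deriv (\<lambda>s. D s t) s\<bar> \<le> C * (t * s) powr (H - 1)) \<longrightarrow>
     (\<forall>f\<in>bv_functions T. \<forall>g\<in>bv_functions T.
        \<bar>cov_inner ?R T f g - cov_inner ?B T f g\<bar> \<le>
        C * nu_integral H T (\<lambda>x. \<bar>f x\<bar>) * nu_integral H T (\<lambda>x. \<bar>g x\<bar>)))"
  proof (intro conjI ballI impI)
    fix f g assume f: "f \<in> bv_functions T" and g: "g \<in> bv_functions T"
    show "cov_inner ?R T f g - cov_inner ?B T f g =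
        (LINT (s, t):{0..T} \<times> {0..T}|lebesgue. f t * g s * deriv (\<lambda>s. D s t) s)"
      if "set_integrable lebesgue ({0..T} \<times> {0..T}) (\<lambda>(s, t). f t * g s * deriv (\<lambda>s. D s t) s)"
      unfolding diff[OF f g] by (rule cov_inner_eq_integral[OF T f g cont\<Delta> prim prim2 that])
    show "\<bar>cov_inner ?R T f g - cov_inner ?B T f g\<bar>
        \<le> C * nu_integral H T (\<lambda>x. \<bar>f x\<bar>) * nu_integral H T (\<lambda>x. \<bar>g x\<bar>)"
      if "AE (s, t)\<in>{0..T} \<times> {0..T} in lborel. \<bar>deriv (\<lambda>s. D s t) s\<bar> \<le> C * (t * s) powr (H - 1)"
      unfolding diff[OF f g] by (rule cov_inner_le[OF T f g cont\<Delta> prim prim2 \<open>0 < H\<close> \<open>0 < C\<close> that])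
  qed
qed

end
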